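(* Suppose that $s_j=0$ and $t_j$ is even for $j=1,\dots,N$, that the spectral problem $A(x,D)u-\lambda u=f$ in $\mathbb{R}^n$ is weakly smooth and parameter-elliptic in $\mathcal{L}$, and that $a^{jk}_\alpha\in C^{n}(\overline{\mathbb{R}^n})$ for $|\alpha|\le t_k$, $1\le j,k\le N$. Suppose in addition that for $1\le j,k\le N$, $a^{jk}_\alpha\in C^{|\alpha|+n}(\overline{\mathbb{R}^n})\cap C^{|\alpha|+1,0}(\overline{\mathbb{R}^n})$ for $|\alpha|\le t_k$, with $a^{jk}_\alpha(x)=0$ for all $x\in\mathbb{R}^n$ if $j>k$, $t_j<t_k$ and $|\alpha|\ge t_j$, and also if $j<k$, $t_j>t_k$ and $|\alpha|=t_k$. Then the eigenvalues of $A_p$ lying in $\mathcal{L}^{\dagger}$, as well as their geometric and algebraic multiplicities, are the same for all $p$ with $1<p<\infty$.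
   Context: Setting. Let $n,N\in\mathbb{N}$ with $N>1$, and let $s_1\ge\cdots\ge s_N\ge 0$ and $t_1\ge\cdots\ge t_N>0$ be integers; put $m_j=s_j+t_j$. Let $0=k_0<k_1<\cdots<k_d=N$ be the integers such that $m_j$ is constant for $k_{r-1}<j\le k_r$ ($r=1,\dots,d$) and $m_{k_1}>m_{k_2}>\cdots>m_{k_d}>0$. With $D_j=-i\,\partial/\partial x_j$, let $A(x,D)=(A_{jk}(x,D))_{j,k=1}^N$, where $A_{jk}(x,D)=\sum_{|\alpha|\le s_j+t_k}a^{jk}_\alpha(x)D^\alpha$ with complex-valued coefficients on $\mathbb{R}^n$. The spectral problem is $A(x,D)u(x)-\lambda u(x)=f(x)$ in $\mathbb{R}^n$, with $u=(u_1,\dots,u_N)^T$, $f=(f_1,\dots,f_N)^T$ and $\lambda\in\mathbb{C}$. $I_N$ is the $N\times N$ identity matrix. Coefficient spaces. $C^\ell(\overline{\mathbb{R}^n})$ ($\ell\ge 0$ an integer) is the space of $\phi\in C^\ell(\mathbb{R}^n)$ such that $\phi$ and its partial derivatives of order up to $\ell$ are bounded and uniformly continuous on $\mathbb{R}^n$. For $\ell\ge1$, $C^{\ell,0}(\overline{\mathbb{R}^n})$ is the set of $\phi\in C^\ell(\overline{\mathbb{R}^n})$ with $|D^\alpha\phi(x)|\to0$ as $|x|\to\infty$ for $1\le|\alpha|\le\ell$. $C^{0,0}(\overline{\mathbb{R}^n})$ is the set of $\phi\in C^0(\overline{\mathbb{R}^n})$ with $\sup_{|x-y|\le1}|\phi(x)-\phi(y)|\to0$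 as $|x|\to\infty$. Minimally smooth: for each pair $j,k$, if $s_j>0$ then $a^{jk}_\alpha\in C^{s_j}(\overline{\mathbb{R}^n})$ for $|\alpha|\le s_j+t_k$; if $s_j=0$ then $a^{jk}_\alpha\in L_\infty(\mathbb{R}^n)$ for $|\alpha|<t_k$ and $a^{jk}_\alpha\in C^0(\overline{\mathbb{R}^n})$ for $|\alpha|=t_k$. Weakly smooth: minimally smooth and, in addition, for all $1\le j,k\le N$, $a^{jk}_\alpha\in C^{0,0}(\overline{\mathbb{R}^n})$ if $|\alpha|\le t_k$ and $a^{jk}_\alpha\in C^{|\alpha|-t_k,0}(\overline{\mathbb{R}^n})$ otherwise. Parameter-ellipticity. Let $\mathcal{L}$ be a closed sector in the complex plane with vertex at the origin. Let $\mathring{A}_{jk}(x,\xi)=\sum_{|\alpha|=s_j+t_k}a^{jk}_\alpha(x)\xi^\alpha$, $\mathcal{A}^{(r)}_{11}(x,\xi)=(\mathring{A}_{jk}(x,\xi))_{j,k=1}^{k_r}$, let $\tilde I_{r,0}$ be the $k_r\times k_r$ diagonal matrix whose first $k_{r-1}$ diagonal entries are $0$ and whose remaining $k_r-k_{r-1}$ diagonal entries are $1$, and let $\langle\xi,\lambda\rangle_j=(|\xi|^2+|\lambda|^{2/m_j})^{1/2}$, $N_0=0$, $N_r=\sum_{j=1}^{k_r}m_j$. The spectral problem is parameter-elliptic in $\mathcal{L}$ if it is minimally smooth and for each $r=1,\dots,d$ there is a constant $\kappa_r>0$ with $|\det(\mathcal{A}^{(r)}_{11}(x,\xi)-\lambda\tilde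 I_{r,0})|\ge\kappa_r|\xi|^{N_{r-1}}$ for all $x,\xi\in\mathbb{R}^n$ and $\lambda\in\mathcal{L}$ with $\langle\xi,\lambda\rangle_{k_r}=1$. Spaces and operator. For $1<p<\infty$, $W^{(t)}_p(\mathbb{R}^n)=\prod_{k=1}^N W^{t_k}_p(\mathbb{R}^n)$ (Sobolev spaces) and $H^{(-s)}_p(\mathbb{R}^n)=\prod_{k=1}^N H^{-s_k}_p(\mathbb{R}^n)$ (Bessel potential spaces; when all $s_k=0$ this is $L_p(\mathbb{R}^n)^N$). $A_p$ is the operator on $H^{(-s)}_p(\mathbb{R}^n)$ that acts like $A(x,D)$ with domain $D(A_p)=W^{(t)}_p(\mathbb{R}^n)$. The set $\mathcal{L}^{\dagger}$. When the spectral problem is weakly smooth and parameter-elliptic in $\mathcal{L}$, there is a number $\lambda^{\dagger}>0$, independent of $p$, such that, with $\mathcal{L}^{\dagger}=\{\lambda\in\mathcal{L}:|\lambda|\ge\lambda^{\dagger}\}$, for every $1<p<\infty$: $A_p-\lambda I_N: D(A_p)\to H^{(-s)}_p(\mathbb{R}^n)$ is bounded and Fredholm of index $0$ for all $\lambda\in\mathcal{L}^{\dagger}$; all $\lambda\in\mathcal{L}^\dagger$ of sufficiently large modulus (depending on $p$) lie in the resolvent set of $A_p$; and the spectrum of $A_p$ in $\mathcal{L}^{\dagger}$ consists of at most finitely many eigenvalues, each of finite algebraic multiplicity. Such a number $\lambda^\dagger$ is fixed throughout. *)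

theory Defs
  imports
    "HOL-Analysis.Analysis"
    "HOL-Library.Function_Algebras"
    "Jordan_Normal_Form.Determinant"
begin

no_notation vec_index (infixl \<open>$\<close> 100)

section \<open>Multi-indices and classical derivatives\<close>

type_synonym 'n midx = "'n \<Rightarrow> nat"

definition mdeg :: "('n::finite) midx \<Rightarrow> nat" where
  "mdeg \<alpha> = (\<Sum>i\<in>UNIV. \<alpha> i)"

lemma finite_mdeg_le: "finite {\<alpha> :: ('n::finite) midx. mdeg \<alpha> \<le> m}"
proof (rule finite_subset)
  show "{\<alpha> :: 'n midx. mdeg \<alpha> \<le> m} \<subseteq> (\<Pi>\<^sub>E i\<in>UNIV. {..m})"
  proof (intro subsetI PiE_I)
    fix \<alpha> :: "'n midx" and i :: 'n
    assume "\<alpha> \<in> {\<alpha>. mdeg \<alpha> \<le> m}"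
    moreover have "\<alpha> i \<le> mdeg \<alpha>"
      unfolding mdeg_def by (rule member_le_sum) auto
    ultimately show "\<alpha> i \<in> {..m}" by simp
  qed simp
  show "finite ((\<Pi>\<^sub>E i\<in>UNIV. {..m}) :: 'n midx set)"
    by (rule finite_PiE) auto
qed

definition mpow :: "real ^ 'n \<Rightarrow> ('n::finite) midx \<Rightarrow> real" where
  "mpow \<xi> \<alpha> = (\<Prod>i\<in>UNIV. (\<xi> $ i) ^ \<alpha> i)"

definition pdiff :: "'n \<Rightarrow> (real ^ 'n::finite \<Rightarrow> complex) \<Rightarrow> real ^ 'n \<Rightarrow> complex" where
  "pdiff i f x = vector_derivative (\<lambda>h. f (x + h *\<^sub>R axis i 1)) (at 0)"

text \<open>The index type carries no order, so the partial derivatives making up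
  \<open>\<partial>\<^sup>\<alpha>\<close> are taken in some unspecified order. By Schwarz's theorem this does not
  matter for functions of class \<open>C_class l\<close> with \<open>mdeg \<alpha> \<le> l\<close>, and
  \<open>mdiff \<alpha>\<close> is only applied to such functions.\<close>

definition mdiff :: "('n::finite) midx \<Rightarrow> (real ^ 'n \<Rightarrow> complex) \<Rightarrow> real ^ 'n \<Rightarrow> complex" where
  "mdiff \<alpha> f = foldr pdiff (SOME is. \<forall>i. count_list is i = \<alpha> i) f"

primrec C_class :: "nat \<Rightarrow> (real ^ 'n::finite \<Rightarrow> complex) \<Rightarrow> bool" where
  "C_class 0 f \<longleftrightarrow> continuous_on UNIV f"
| "C_class (Suc l) f \<longleftrightarrow> continuous_on UNIV f \<and>
     (\<forall>i. (\<forall>x. (\<lambda>h::real. f (x + h *\<^sub>R axis i 1)) differentiable (at 0)) \<and>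
          C_class l (pdiff i f))"

definition test_function :: "(real ^ 'n::finite \<Rightarrow> complex) \<Rightarrow> bool" where
  "test_function \<phi> \<longleftrightarrow> (\<forall>l. C_class l \<phi>) \<and> (\<exists>K. compact K \<and> (\<forall>x. x \<notin> K \<longrightarrow> \<phi> x = 0))"

section \<open>Coefficient spaces\<close>

definition C_bar :: "nat \<Rightarrow> (real ^ 'n::finite \<Rightarrow> complex) set" where
  "C_bar l = {\<phi>. C_class l \<phi> \<and>
     (\<forall>\<alpha>. mdeg \<alpha> \<le> l \<longrightarrow>
        bounded (range (mdiff \<alpha> \<phi>)) \<and> uniformly_continuous_on UNIV (mdiff \<alpha> \<phi>))}"

text \<open>Below, \<open>\<partial>\<^sup>\<alpha>\<close> may replace \<open>D\<^sup>\<alpha>\<close> because the two differ by a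
  factor of modulus one.\<close>

definition C_bar0 :: "nat \<Rightarrow> (real ^ 'n::finite \<Rightarrow> complex) set" where
  "C_bar0 l =
     (if l = 0
      then {\<phi> \<in> C_bar 0. ((\<lambda>x. SUP y\<in>cball x 1. norm (\<phi> x - \<phi> y)) \<longlongrightarrow> 0) at_infinity}
      else {\<phi> \<in> C_bar l. \<forall>\<alpha>. 1 \<le> mdeg \<alpha> \<and> mdeg \<alpha> \<le> l \<longrightarrow>
              ((\<lambda>x. norm (mdiff \<alpha> \<phi> x)) \<longlongrightarrow> 0) at_infinity})"

definition L_infty :: "(real ^ 'n::finite \<Rightarrow> complex) set" where
  "L_infty = {\<phi>. \<phi> \<in> borel_measurable lebesgue \<and> (\<exists>C. AE x in lebesgue. norm (\<phi> x) \<le> C)}"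

section \<open>The differential system\<close>

text \<open>Rows, columns and blocks are numbered from 1, and \<open>a j k \<alpha>\<close> is the coefficient of
  \<open>D\<^sup>\<alpha>\<close> in \<open>A\<^sub>j\<^sub>k\<close>. Values of \<open>s\<close>, \<open>t\<close>, \<open>a\<close> at
  indices outside \<open>{1..N}\<close> and of \<open>a j k \<alpha>\<close> for \<open>mdeg \<alpha> > s j + t k\<close> are
  never used.\<close>

type_synonym 'n coeffs = "nat \<Rightarrow> nat \<Rightarrow> 'n midx \<Rightarrow> real ^ 'n \<Rightarrow> complex"

definition system_orders :: "nat \<Rightarrow> (nat \<Rightarrow> nat) \<Rightarrow> (nat \<Rightarrow> nat) \<Rightarrow> bool" where
  "system_orders N s t \<longleftrightarrow>
     (\<forall>i j. 1 \<le> i \<and> i \<le> j \<and> j \<le> N \<longrightarrow> s j \<le> s i \<and> t j \<le> t i) \<and> 0 < t N"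

definition block_indices ::
  "nat \<Rightarrow> (nat \<Rightarrow> nat) \<Rightarrow> (nat \<Rightarrow> nat) \<Rightarrow> nat \<Rightarrow> (nat \<Rightarrow> nat) \<Rightarrow> bool" where
  "block_indices N s t d kk \<longleftrightarrow>
     kk 0 = 0 \<and> kk d = N \<and>
     (\<forall>r\<in>{1..d}. kk (r - 1) < kk r) \<and>
     (\<forall>r\<in>{1..d}. \<forall>j\<in>{kk (r - 1)<..kk r}. s j + t j = s (kk r) + t (kk r)) \<and>
     (\<forall>r\<in>{1..<d}. s (kk (Suc r)) + t (kk (Suc r)) < s (kk r) + t (kk r)) \<and>
     0 < s (kk d) + t (kk d)"

definition minimally_smooth ::
  "nat \<Rightarrow> (nat \<Rightarrow> nat) \<Rightarrow> (nat \<Rightarrow> nat) \<Rightarrow> ('n::finite) coeffs \<Rightarrow> bool" where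
  "minimally_smooth N s t a \<longleftrightarrow>
     (\<forall>j\<in>{1..N}. \<forall>k\<in>{1..N}.
        (0 < s j \<longrightarrow> (\<forall>\<alpha>. mdeg \<alpha> \<le> s j + t k \<longrightarrow> a j k \<alpha> \<in> C_bar (s j))) \<and>
        (s j = 0 \<longrightarrow> (\<forall>\<alpha>. mdeg \<alpha> < t k \<longrightarrow> a j k \<alpha> \<in> L_infty) \<and>
                    (\<forall>\<alpha>. mdeg \<alpha> = t k \<longrightarrow> a j k \<alpha> \<in> C_bar 0)))"

definition weakly_smooth ::
  "nat \<Rightarrow> (nat \<Rightarrow> nat) \<Rightarrow> (nat \<Rightarrow> nat) \<Rightarrow> ('n::finite) coeffs \<Rightarrow> bool" where
  "weakly_smooth N s t a \<longleftrightarrow> minimally_smooth N s t a \<and>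
     (\<forall>j\<in>{1..N}. \<forall>k\<in>{1..N}. \<forall>\<alpha>. mdeg \<alpha> \<le> s j + t k \<longrightarrow>
        (if mdeg \<alpha> \<le> t k then a j k \<alpha> \<in> C_bar0 0 else a j k \<alpha> \<in> C_bar0 (mdeg \<alpha> - t k)))"

text \<open>A sector may degenerate to a ray.\<close>

definition closed_sector :: "complex set \<Rightarrow> bool" where
  "closed_sector L \<longleftrightarrow>
     (\<exists>\<theta>\<^sub>1 \<theta>\<^sub>2. \<theta>\<^sub>1 \<le> \<theta>\<^sub>2 \<and> \<theta>\<^sub>2 < \<theta>\<^sub>1 + 2 * pi \<and>
        L = {complex_of_real \<rho> * cis \<theta> |\<rho> \<theta>. 0 \<le> \<rho> \<and> \<theta>\<^sub>1 \<le> \<theta> \<and> \<theta> \<le> \<theta>\<^sub>2})"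

definition principal_entry ::
  "(nat \<Rightarrow> nat) \<Rightarrow> (nat \<Rightarrow> nat) \<Rightarrow> ('n::finite) coeffs \<Rightarrow>
    nat \<Rightarrow> nat \<Rightarrow> real ^ 'n \<Rightarrow> real ^ 'n \<Rightarrow> complex" where
  "principal_entry s t a j k x \<xi> =
     (\<Sum>\<alpha> | mdeg \<alpha> = s j + t k. a j k \<alpha> x * complex_of_real (mpow \<xi> \<alpha>))"

text \<open>Matrices of \<^theory>\<open>Jordan_Normal_Form.Matrix\<close> are indexed from 0, whence the shift by
  \<open>Suc\<close>.\<close>

definition principal_block ::
  "(nat \<Rightarrow> nat) \<Rightarrow> (nat \<Rightarrow> nat) \<Rightarrow> ('n::finite) coeffs \<Rightarrow> (nat \<Rightarrow> nat) \<Rightarrow>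
    nat \<Rightarrow> real ^ 'n \<Rightarrow> real ^ 'n \<Rightarrow> complex mat" where
  "principal_block s t a kk r x \<xi> =
     Matrix.mat (kk r) (kk r) (\<lambda>(i, l). principal_entry s t a (Suc i) (Suc l) x \<xi>)"

definition tail_identity :: "(nat \<Rightarrow> nat) \<Rightarrow> nat \<Rightarrow> complex mat" where
  "tail_identity kk r =
     Matrix.mat (kk r) (kk r) (\<lambda>(i, l). if i = l \<and> kk (r - 1) \<le> i then 1 else 0)"

definition parameter_elliptic ::
  "nat \<Rightarrow> (nat \<Rightarrow> nat) \<Rightarrow> (nat \<Rightarrow> nat) \<Rightarrow> nat \<Rightarrow> (nat \<Rightarrow> nat) \<Rightarrow>
    ('n::finite) coeffs \<Rightarrow> complex set \<Rightarrow> bool" where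
  "parameter_elliptic N s t d kk a L \<longleftrightarrow> minimally_smooth N s t a \<and>
     (\<forall>r\<in>{1..d}. \<exists>\<kappa>>0. \<forall>x \<xi>. \<forall>z\<in>L.
        sqrt ((norm \<xi>)\<^sup>2 + norm z powr (2 / real (s (kk r) + t (kk r)))) = 1 \<longrightarrow>
        norm (Determinant.det (principal_block s t a kk r x \<xi> - z \<cdot>\<^sub>m tail_identity kk r))
          \<ge> \<kappa> * norm \<xi> ^ (\<Sum>j = 1..kk (r - 1). s j + t j))"

section \<open>Functions modulo almost everywhere equality\<close>

quotient_type (overloaded) 'n ae_fun = "real ^ 'n::finite \<Rightarrow> complex" /
  "\<lambda>f g. AE x in lebesgue. f x = g x"
proof (rule equivpI)
  show "reflp (\<lambda>(f :: real ^ 'n \<Rightarrow> complex) g. AE x in lebesgue. f x = g x)"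
    by (rule reflpI) simp
  show "symp (\<lambda>(f :: real ^ 'n \<Rightarrow> complex) g. AE x in lebesgue. f x = g x)"
    by (rule sympI) (auto elim: eventually_mono)
  show "transp (\<lambda>(f :: real ^ 'n \<Rightarrow> complex) g. AE x in lebesgue. f x = g x)"
  proof (rule transpI)
    fix f g h :: "real ^ 'n \<Rightarrow> complex"
    assume "AE x in lebesgue. f x = g x" "AE x in lebesgue. g x = h x"
    then show "AE x in lebesgue. f x = h x" by eventually_elim simp
  qed
qed

instantiation ae_fun :: (finite) ab_group_add
begin

lift_definition zero_ae_fun :: "'a ae_fun" is "\<lambda>x. 0" .

lift_definition plus_ae_fun :: "'a ae_fun \<Rightarrow> 'a ae_fun \<Rightarrow> 'a ae_fun" is "\<lambda>f g x. f x + g x"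
  by (erule (1) eventually_elim2) simp

lift_definition minus_ae_fun :: "'a ae_fun \<Rightarrow> 'a ae_fun \<Rightarrow> 'a ae_fun" is "\<lambda>f g x. f x - g x"
  by (erule (1) eventually_elim2) simp

lift_definition uminus_ae_fun :: "'a ae_fun \<Rightarrow> 'a ae_fun" is "\<lambda>f x. - f x"
  by (erule eventually_mono) simp

instance
  by standard (transfer; simp add: algebra_simps)+

end

lift_definition fmult :: "(real ^ 'n::finite \<Rightarrow> complex) \<Rightarrow> 'n ae_fun \<Rightarrow> 'n ae_fun"
  is "\<lambda>a f x. a x * f x"
  by (erule eventually_mono) simp

definition in_Lp_fun :: "real \<Rightarrow> (real ^ 'n::finite \<Rightarrow> complex) \<Rightarrow> bool" where
  "in_Lp_fun p f \<longleftrightarrow>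
     f \<in> borel_measurable lebesgue \<and> integrable lebesgue (\<lambda>x. norm (f x) powr p)"

definition Lp_norm_fun :: "real \<Rightarrow> (real ^ 'n::finite \<Rightarrow> complex) \<Rightarrow> real" where
  "Lp_norm_fun p f = (\<integral>x. norm (f x) powr p \<partial>lebesgue) powr (1 / p)"

definition locally_integrable :: "(real ^ 'n::finite \<Rightarrow> complex) \<Rightarrow> bool" where
  "locally_integrable f \<longleftrightarrow> (\<forall>K. compact K \<longrightarrow> set_integrable lebesgue K f)"

definition weak_deriv_fun ::
  "('n::finite) midx \<Rightarrow> (real ^ 'n \<Rightarrow> complex) \<Rightarrow> (real ^ 'n \<Rightarrow> complex) \<Rightarrow> bool" where
  "weak_deriv_fun \<alpha> f g \<longleftrightarrow> locally_integrable f \<and> locally_integrable g \<and>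
     (\<forall>\<phi>. test_function \<phi> \<longrightarrow>
        (\<integral>x. f x * mdiff \<alpha> \<phi> x \<partial>lebesgue) = (- 1) ^ mdeg \<alpha> * (\<integral>x. g x * \<phi> x \<partial>lebesgue))"

lemma lebesgue_integral_cong_AE:
  fixes f g :: "real ^ 'n::finite \<Rightarrow> 'b::euclidean_space"
  assumes ae: "AE x in lebesgue. f x = g x"
  shows "integrable lebesgue f \<longleftrightarrow> integrable lebesgue g"
    and "integral\<^sup>L lebesgue f = integral\<^sup>L lebesgue g"
proof -
  have ae': "AE x in lebesgue. g x = f x"
    using ae by eventually_elim simp
  have meas: "f \<in> borel_measurable lebesgue \<longleftrightarrow> g \<in> borel_measurable lebesgue"
    using borel_measurable_AE[OF _ ae] borel_measurable_AE[OF _ ae'] by blast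
  show int: "integrable lebesgue f \<longleftrightarrow> integrable lebesgue g"
    by (metis ae ae' borel_measurable_integrable integrable_cong_AE meas)
  show "integral\<^sup>L lebesgue f = integral\<^sup>L lebesgue g"
  proof (cases "integrable lebesgue f")
    case True
    then show ?thesis
      using ae meas by (intro integral_cong_AE) auto
  next
    case False
    then show ?thesis
      using int by (simp add: not_integrable_integral_eq)
  qed
qed

lift_definition in_Lp :: "real \<Rightarrow> ('n::finite) ae_fun \<Rightarrow> bool" is in_Lp_fun
proof -
  fix p and f g :: "real ^ 'n \<Rightarrow> complex"
  assume ae: "AE x in lebesgue. f x = g x"
  then have ae': "AE x in lebesgue. g x = f x" by eventually_elim simp
  have "AE x in lebesgue. norm (f x) powr p = norm (g x) powr p"
    using ae by eventually_elim simp
  then have 1: "integrable lebesgue (\<lambda>x. norm (f x) powr p) \<longleftrightarrow>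
      integrable lebesgue (\<lambda>x. norm (g x) powr p)"
    by (rule lebesgue_integral_cong_AE(1))
  have 2: "f \<in> borel_measurable lebesgue \<longleftrightarrow> g \<in> borel_measurable lebesgue"
    by (rule iffI; erule borel_measurable_AE) (fact ae ae')+
  show "in_Lp_fun p f = in_Lp_fun p g"
    unfolding in_Lp_fun_def 1 2 ..
qed

lift_definition Lp_norm :: "real \<Rightarrow> ('n::finite) ae_fun \<Rightarrow> real" is Lp_norm_fun
proof -
  fix p and f g :: "real ^ 'n \<Rightarrow> complex"
  assume ae: "AE x in lebesgue. f x = g x"
  have "AE x in lebesgue. norm (f x) powr p = norm (g x) powr p"
    using ae by eventually_elim simp
  then have "(\<integral>x. norm (f x) powr p \<partial>lebesgue) = (\<integral>x. norm (g x) powr p \<partial>lebesgue)"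
    by (rule lebesgue_integral_cong_AE(2))
  then show "Lp_norm_fun p f = Lp_norm_fun p g"
    unfolding Lp_norm_fun_def by simp
qed

lemma locally_integrable_cong_AE:
  assumes "AE x in lebesgue. f x = g x"
  shows "locally_integrable f \<longleftrightarrow> locally_integrable g"
proof -
  have "set_integrable lebesgue K f \<longleftrightarrow> set_integrable lebesgue K g" for K
    unfolding set_integrable_def
    by (rule lebesgue_integral_cong_AE(1)) (use assms in eventually_elim, simp)
  then show ?thesis by (simp only: locally_integrable_def)
qed

lift_definition weak_deriv ::
  "('n::finite) midx \<Rightarrow> 'n ae_fun \<Rightarrow> 'n ae_fun \<Rightarrow> bool" is weak_deriv_fun
proof -
  fix \<alpha> :: "'n midx" and f f' g g' :: "real ^ 'n \<Rightarrow> complex"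
  assume f: "AE x in lebesgue. f x = f' x" and g: "AE x in lebesgue. g x = g' x"
  have 1: "(\<integral>x. f x * h x \<partial>lebesgue) = (\<integral>x. f' x * h x \<partial>lebesgue)" for h
    by (rule lebesgue_integral_cong_AE(2)) (use f in eventually_elim, simp)
  have 2: "(\<integral>x. g x * h x \<partial>lebesgue) = (\<integral>x. g' x * h x \<partial>lebesgue)" for h
    by (rule lebesgue_integral_cong_AE(2)) (use g in eventually_elim, simp)
  show "weak_deriv_fun \<alpha> f g = weak_deriv_fun \<alpha> f' g'"
    unfolding weak_deriv_fun_def 1 2
    using locally_integrable_cong_AE[OF f] locally_integrable_cong_AE[OF g] by simp
qed

definition weak_diff :: "('n::finite) midx \<Rightarrow> 'n ae_fun \<Rightarrow> 'n ae_fun" where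
  "weak_diff \<alpha> u = (THE v. weak_deriv \<alpha> u v)"

definition D_op :: "('n::finite) midx \<Rightarrow> 'n ae_fun \<Rightarrow> 'n ae_fun" where
  "D_op \<alpha> u = fmult (\<lambda>x. (- \<i>) ^ mdeg \<alpha>) (weak_diff \<alpha> u)"

definition sobolev :: "real \<Rightarrow> nat \<Rightarrow> ('n::finite) ae_fun set" where
  "sobolev p l = {u. in_Lp p u \<and> (\<forall>\<alpha>. mdeg \<alpha> \<le> l \<longrightarrow> (\<exists>v. in_Lp p v \<and> weak_deriv \<alpha> u v))}"

definition sobolev_norm :: "real \<Rightarrow> nat \<Rightarrow> ('n::finite) ae_fun \<Rightarrow> real" where
  "sobolev_norm p l u = (\<Sum>\<alpha> | mdeg \<alpha> \<le> l. Lp_norm p (weak_diff \<alpha> u) powr p) powr (1 / p)"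

section \<open>Vector functions and the operators \<open>A\<^sub>p\<close>\<close>

text \<open>An element of a product of \<open>N\<close> function spaces is a sequence which vanishes outside
  \<open>{1..N}\<close>.\<close>

type_synonym 'n sys = "nat \<Rightarrow> 'n ae_fun"

definition sscale :: "complex \<Rightarrow> ('n::finite) sys \<Rightarrow> 'n sys" where
  "sscale c u = (\<lambda>k. fmult (\<lambda>x. c) (u k))"

global_interpretation sys: vector_space "sscale :: complex \<Rightarrow> ('n::finite) sys \<Rightarrow> 'n sys"
proof
  fix a b :: complex and u v :: "'n sys"
  have d1: "fmult (\<lambda>x. a) (f + g) = fmult (\<lambda>x. a) f + fmult (\<lambda>x. a) g" for f g :: "'n ae_fun"
    by transfer (simp add: algebra_simps)
  have d2: "fmult (\<lambda>x. a + b) f = fmult (\<lambda>x. a) f + fmult (\<lambda>x. b) f" for f :: "'n ae_fun"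
    by transfer (simp add: algebra_simps)
  have d3: "fmult (\<lambda>x. a) (fmult (\<lambda>x. b) f) = fmult (\<lambda>x. a * b) f" for f :: "'n ae_fun"
    by transfer (simp add: algebra_simps)
  have d4: "fmult (\<lambda>x. 1) f = f" for f :: "'n ae_fun"
    by transfer simp
  show "sscale a (u + v) = sscale a u + sscale a v"
    by (simp add: sscale_def fun_eq_iff d1)
  show "sscale (a + b) u = sscale a u + sscale b u"
    by (simp add: sscale_def fun_eq_iff d2)
  show "sscale a (sscale b u) = sscale (a * b) u"
    by (simp add: sscale_def fun_eq_iff d3)
  show "sscale 1 u = u"
    by (simp add: sscale_def d4)
qed

definition finite_dim :: "('n::finite) sys set \<Rightarrow> bool" where
  "finite_dim V \<longleftrightarrow> (\<exists>B. finite B \<and> V \<subseteq> sys.span B)"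

definition Lp_sys :: "nat \<Rightarrow> real \<Rightarrow> ('n::finite) sys set" where
  "Lp_sys N p = {f. (\<forall>k\<in>{1..N}. in_Lp p (f k)) \<and> (\<forall>k. k \<notin> {1..N} \<longrightarrow> f k = 0)}"

definition Lp_sys_norm :: "nat \<Rightarrow> real \<Rightarrow> ('n::finite) sys \<Rightarrow> real" where
  "Lp_sys_norm N p f = (\<Sum>k = 1..N. Lp_norm p (f k))"

definition sobolev_sys :: "nat \<Rightarrow> (nat \<Rightarrow> nat) \<Rightarrow> real \<Rightarrow> ('n::finite) sys set" where
  "sobolev_sys N t p = {u. (\<forall>k\<in>{1..N}. u k \<in> sobolev p (t k)) \<and> (\<forall>k. k \<notin> {1..N} \<longrightarrow> u k = 0)}"

definition sobolev_sys_norm :: "nat \<Rightarrow> (nat \<Rightarrow> nat) \<Rightarrow> real \<Rightarrow> ('n::finite) sys \<Rightarrow> real" where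
  "sobolev_sys_norm N t p u = (\<Sum>k = 1..N. sobolev_norm p (t k) (u k))"

text \<open>For \<open>s = 0\<close>, the operator \<open>A\<^sub>p\<close> on \<open>L\<^sub>p(\<real>\<^sup>n)\<^sup>N\<close> is \<open>A_op N s t a\<close>
  restricted to the domain \<open>sobolev_sys N t p\<close>.\<close>

definition A_op ::
  "nat \<Rightarrow> (nat \<Rightarrow> nat) \<Rightarrow> (nat \<Rightarrow> nat) \<Rightarrow> ('n::finite) coeffs \<Rightarrow> 'n sys \<Rightarrow> 'n sys" where
  "A_op N s t a u = (\<lambda>j. if j \<in> {1..N}
     then \<Sum>k = 1..N. \<Sum>\<alpha> | mdeg \<alpha> \<le> s j + t k. fmult (a j k \<alpha>) (D_op \<alpha> (u k))
     else 0)"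

definition shifted :: "(('n::finite) sys \<Rightarrow> 'n sys) \<Rightarrow> complex \<Rightarrow> 'n sys \<Rightarrow> 'n sys" where
  "shifted T z u = T u - sscale z u"

section \<open>Spectral notions\<close>

text \<open>\<open>T\<close> is an operator with domain \<open>D\<close>. The codimension of the range entering the index
  is the dimension of an algebraic complement \<open>C\<close> of the range in \<open>Y\<close>.\<close>

definition kernel_on :: "('n::finite) sys set \<Rightarrow> ('n sys \<Rightarrow> 'n sys) \<Rightarrow> 'n sys set" where
  "kernel_on D T = {u \<in> D. T u = 0}"

definition bounded_between ::
  "('n::finite) sys set \<Rightarrow> ('n sys \<Rightarrow> real) \<Rightarrow> 'n sys set \<Rightarrow> ('n sys \<Rightarrow> real) \<Rightarrow>
    ('n sys \<Rightarrow> 'n sys) \<Rightarrow> bool" where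
  "bounded_between X nX Y nY T \<longleftrightarrow> T ` X \<subseteq> Y \<and> (\<exists>C. \<forall>u\<in>X. nY (T u) \<le> C * nX u)"

definition closed_in_norm :: "('n::finite) sys set \<Rightarrow> ('n sys \<Rightarrow> real) \<Rightarrow> 'n sys set \<Rightarrow> bool" where
  "closed_in_norm Y nY R \<longleftrightarrow>
     (\<forall>F g. (\<forall>i::nat. F i \<in> R) \<and> g \<in> Y \<and> (\<lambda>i. nY (F i - g)) \<longlonglongrightarrow> 0 \<longrightarrow> g \<in> R)"

definition fredholm_with_index ::
  "('n::finite) sys set \<Rightarrow> 'n sys set \<Rightarrow> ('n sys \<Rightarrow> real) \<Rightarrow> ('n sys \<Rightarrow> 'n sys) \<Rightarrow> int \<Rightarrow> bool" where
  "fredholm_with_index X Y nY T i \<longleftrightarrow>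
     finite_dim (kernel_on X T) \<and> closed_in_norm Y nY (T ` X) \<and>
     (\<exists>C. sys.subspace C \<and> C \<subseteq> Y \<and> finite_dim C \<and> C \<inter> T ` X = {0} \<and>
          Y = {f + g |f g. f \<in> T ` X \<and> g \<in> C} \<and>
          int (sys.dim (kernel_on X T)) - int (sys.dim C) = i)"

definition resolvent_set ::
  "('n::finite) sys set \<Rightarrow> 'n sys set \<Rightarrow> ('n sys \<Rightarrow> real) \<Rightarrow> ('n sys \<Rightarrow> 'n sys) \<Rightarrow> complex set" where
  "resolvent_set D Y nY T =
     {z. bij_betw (shifted T z) D Y \<and> (\<exists>C. \<forall>u\<in>D. nY u \<le> C * nY (shifted T z u))}"

definition eigenvalue_of ::
  "('n::finite) sys set \<Rightarrow> ('n sys \<Rightarrow> 'n sys) \<Rightarrow> complex \<Rightarrow> bool" where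
  "eigenvalue_of D T z \<longleftrightarrow> (\<exists>u\<in>D. u \<noteq> 0 \<and> T u = sscale z u)"

primrec iterated_kernel ::
  "('n::finite) sys set \<Rightarrow> ('n sys \<Rightarrow> 'n sys) \<Rightarrow> nat \<Rightarrow> 'n sys set" where
  "iterated_kernel D T 0 = {0}"
| "iterated_kernel D T (Suc m) = {u \<in> D. T u \<in> iterated_kernel D T m}"

definition principal_subspace ::
  "('n::finite) sys set \<Rightarrow> ('n sys \<Rightarrow> 'n sys) \<Rightarrow> complex \<Rightarrow> 'n sys set" where
  "principal_subspace D T z = (\<Union>m. iterated_kernel D (shifted T z) m)"

definition geom_mult :: "('n::finite) sys set \<Rightarrow> ('n sys \<Rightarrow> 'n sys) \<Rightarrow> complex \<Rightarrow> nat" where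
  "geom_mult D T z = sys.dim (kernel_on D (shifted T z))"

definition alg_mult :: "('n::finite) sys set \<Rightarrow> ('n sys \<Rightarrow> 'n sys) \<Rightarrow> complex \<Rightarrow> nat" where
  "alg_mult D T z = sys.dim (principal_subspace D T z)"

definition L_dagger :: "complex set \<Rightarrow> real \<Rightarrow> complex set" where
  "L_dagger L \<mu> = {z \<in> L. \<mu> \<le> norm z}"

text \<open>The defining properties of the number \<open>\<lambda>\<^sup>\<dagger>\<close> (here \<open>\<mu>\<close>), in the case
  \<open>s = 0\<close>. The number does not depend on \<open>p\<close>; the radius \<open>R\<close> may.\<close>

definition admissible_threshold ::
  "nat \<Rightarrow> (nat \<Rightarrow> nat) \<Rightarrow> (nat \<Rightarrow> nat) \<Rightarrow> ('n::finite) coeffs \<Rightarrow> complex set \<Rightarrow> real \<Rightarrow> bool" where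
  "admissible_threshold N s t a L \<mu> \<longleftrightarrow> 0 < \<mu> \<and>
     (\<forall>p>1. let X = sobolev_sys N t p; nX = sobolev_sys_norm N t p;
                Y = Lp_sys N p; nY = Lp_sys_norm N p; T = A_op N s t a;
                spec = - resolvent_set X Y nY T \<inter> L_dagger L \<mu>
       in (\<forall>z\<in>L_dagger L \<mu>. bounded_between X nX Y nY (shifted T z) \<and>
                             fredholm_with_index X Y nY (shifted T z) 0) \<and>
          (\<exists>R. \<forall>z\<in>L_dagger L \<mu>. R \<le> norm z \<longrightarrow> z \<in> resolvent_set X Y nY T) \<and>
          finite spec \<and>
          (\<forall>z\<in>spec. eigenvalue_of X T z \<and> finite_dim (principal_subspace X T z)))"

end

theory Submission
  imports Defs
begin

text \<open>
  The eigenvalues and their multiplicities do not depend on the exponent because the root spaces, as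
  sets of functions, do not. The argument compares the Fredholm operators for two exponents; it rests on
  their having index \<open>0\<close> and on the boundedness of the coefficients.

  Let \<open>1 < q < p\<close> and \<open>T = A - z\<close>, and write \<open>X\<^sub>r\<close> and \<open>Y\<^sub>r\<close> for the Sobolev and Lebesgue spaces of
  systems with exponent \<open>r\<close>. If \<open>X\<^sub>p\<close> were contained in \<open>X\<^sub>q\<close>, one could perturb \<open>T\<close> by a finite-rank
  operator \<open>F\<close> so that \<open>T + F\<close> is invertible from \<open>X\<^sub>q\<close> to \<open>Y\<^sub>q\<close>; it would be injective on \<open>X\<^sub>p\<close>, hence
  bijective from \<open>X\<^sub>p\<close> to \<open>Y\<^sub>p\<close> because the index is \<open>0\<close>
  (\<open>fredholm_rank_perturbation_surj\<close>), and the two inverses would agree. So \<open>T u \<in> Y\<^sub>p\<close> and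
  \<open>u \<in> X\<^sub>q\<close> would imply \<open>u \<in> X\<^sub>p\<close>, and conversely.

  On the whole space there is no such inclusion, but there is one after multiplication by a decaying
  weight: \<open>w = \<Prod>i. sech (s x i)\<close> maps \<open>L\<^sub>p\<close> into \<open>L\<^sub>q\<close> (\<open>in_Lp_base_weight\<close>), so both \<open>X\<^sub>p\<close> and \<open>X\<^sub>q\<close> lie
  in \<open>w\<^sup>-\<^sup>1 X\<^sub>q\<close>. Conjugating \<open>T\<close> with \<open>w\<close> changes it on \<open>X\<^sub>q\<close> by an operator of norm \<open>O(s)\<close>, since every
  derivative of \<open>w\<close> carries a factor \<open>s\<close> and is otherwise dominated by \<open>w\<close>
  (\<open>weighted_leibniz\<close>, \<open>weighted_commutator\<close>). For small \<open>s\<close> the invertibility of \<open>T + F\<close> on \<open>X\<^sub>q\<close>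
  therefore shows that \<open>T + w\<^sup>-\<^sup>1 F w\<close> is injective on \<open>w\<^sup>-\<^sup>1 X\<^sub>q\<close>, in particular on \<open>X\<^sub>p + X\<^sub>q\<close>, and the
  argument above applies to this operator (\<open>fredholm_regularity\<close>). For it to act between all the
  spaces involved, \<open>F\<close> is built from bounded functions with bounded support
  (\<open>injective_cutoff_perturbation\<close>); a lower bound for \<open>T + F\<close> comes from the bounded inverse theorem,
  and thus from the completeness of the Sobolev spaces.

  Knowing that \<open>T u\<close> and \<open>u\<close> pass together from one exponent to the other, induction on \<open>m\<close> shows that
  the kernels of the \<open>m\<close>-th powers coincide.
\<close>

section \<open>Smooth functions and partial derivatives\<close>

lemma pdiff_eqI:
  "((\<lambda>h. f (x + h *\<^sub>R axis i 1)) has_vector_derivative d) (at 0) \<Longrightarrow> pdiff i f x = d"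
  unfolding pdiff_def by (rule vector_derivative_at)

lemma C_class_continuous: "C_class l f \<Longrightarrow> continuous_on UNIV f"
  by (cases l) auto

lemma C_class_Suc_has_derivative:
  assumes "C_class (Suc l) f"
  shows "((\<lambda>h. f (x + h *\<^sub>R axis i 1)) has_vector_derivative pdiff i f (x + h0 *\<^sub>R axis i 1)) (at h0)"
proof -
  let ?y = "x + h0 *\<^sub>R axis i 1"
  have "((\<lambda>h. f (?y + h *\<^sub>R axis i 1)) has_vector_derivative pdiff i f ?y) (at 0)"
    using assms unfolding pdiff_def by (simp add: vector_derivative_works)
  then have "((\<lambda>h. f (?y + h *\<^sub>R axis i 1)) has_vector_derivative pdiff i f ?y) (at (h0 - h0))"
    by simp
  then have "(((\<lambda>h. f (?y + h *\<^sub>R axis i 1)) \<circ> (\<lambda>h. h - h0)) has_vector_derivative (1 *\<^sub>R pdiff i f ?y)) (at h0)"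
    by (intro vector_diff_chain_at)
      (auto intro!: derivative_eq_intros has_vector_derivative_diff[THEN has_vector_derivative_eq_rhs])
  then show ?thesis
    by (simp add: o_def algebra_simps)
qed

lemma C_class_SucD: "C_class (Suc l) f \<Longrightarrow> C_class l f"
proof (induction l arbitrary: f)
  case (Suc l)
  then show ?case by (metis C_class.simps(2))
qed auto

lemma C_class_SucI:
  assumes "continuous_on UNIV f"
    and "\<And>i x. ((\<lambda>h. f (x + h *\<^sub>R axis i 1)) has_vector_derivative g i x) (at 0)"
    and "\<And>i. C_class l (g i)"
  shows "C_class (Suc l) f"
proof -
  have "pdiff i f = g i" for i
    using pdiff_eqI[OF assms(2)] by blast
  then show ?thesis
    using assms unfolding C_class.simps
    by (metis differentiableI_vector)
qed

lemma C_class_const: "C_class l (\<lambda>_. c)"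
proof (induction l arbitrary: c)
  case (Suc l)
  show ?case by (rule C_class_SucI[where g = "\<lambda>_ _. 0"]) (auto simp: Suc)
qed auto

lemma C_class_add: "C_class l f \<Longrightarrow> C_class l g \<Longrightarrow> C_class l (\<lambda>x. f x + g x)"
proof (induction l arbitrary: f g)
  case 0
  then show ?case by (auto intro: continuous_on_add)
next
  case (Suc l)
  show ?case
  proof (rule C_class_SucI)
    show "continuous_on UNIV (\<lambda>x. f x + g x)"
      by (intro continuous_on_add C_class_continuous[OF Suc.prems(1)] C_class_continuous[OF Suc.prems(2)])
    show "((\<lambda>h. f (x + h *\<^sub>R axis i 1) + g (x + h *\<^sub>R axis i 1)) has_vector_derivative
        pdiff i f x + pdiff i g x) (at 0)" for i x
      using C_class_Suc_has_derivative[OF Suc.prems(1), of x i 0]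
        C_class_Suc_has_derivative[OF Suc.prems(2), of x i 0]
      by (auto intro: has_vector_derivative_add)
    show "C_class l (\<lambda>x. pdiff i f x + pdiff i g x)" for i
      using Suc by auto
  qed
qed

lemma has_vector_derivative_mult_complex:
  fixes f g :: "real \<Rightarrow> complex"
  assumes "(f has_vector_derivative f') (at x)" "(g has_vector_derivative g') (at x)"
  shows "((\<lambda>h. f h * g h) has_vector_derivative f x * g' + f' * g x) (at x)"
  using bounded_bilinear.has_vector_derivative[OF bounded_bilinear_mult assms] by simp

lemma C_class_mult: "C_class l f \<Longrightarrow> C_class l g \<Longrightarrow> C_class l (\<lambda>x. f x * g x)"
proof (induction l arbitrary: f g)
  case 0
  then show ?case by (auto intro: continuous_on_mult)
next
  case (Suc l)
  show ?case
  proof (rule C_class_SucI)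
    show "continuous_on UNIV (\<lambda>x. f x * g x)"
      by (intro continuous_on_mult C_class_continuous[OF Suc.prems(1)] C_class_continuous[OF Suc.prems(2)])
    show "((\<lambda>h. f (x + h *\<^sub>R axis i 1) * g (x + h *\<^sub>R axis i 1)) has_vector_derivative
        f x * pdiff i g x + pdiff i f x * g x) (at 0)" for i x
      using has_vector_derivative_mult_complex[OF C_class_Suc_has_derivative[OF Suc.prems(1), of x i 0]
        C_class_Suc_has_derivative[OF Suc.prems(2), of x i 0]]
      by simp
    show "C_class l (\<lambda>x. f x * pdiff i g x + pdiff i f x * g x)" for i
      using Suc.prems by (intro C_class_add Suc.IH) (auto intro: C_class_SucD simp del: C_class.simps simp: C_class.simps(2)[of l])
  qed
qed

lemma C_class_prod:
  assumes "finite I" "\<And>i. i \<in> I \<Longrightarrow> C_class l (f i)"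
  shows "C_class l (\<lambda>x. \<Prod>i\<in>I. f i x)"
  using assms by (induction I rule: finite_induct) (auto intro: C_class_const C_class_mult)

definition smooth :: "(real ^ 'n::finite \<Rightarrow> complex) \<Rightarrow> bool" where
  "smooth f \<longleftrightarrow> (\<forall>l. C_class l f)"

lemma smooth_pdiff: "smooth f \<Longrightarrow> smooth (pdiff i f)"
  unfolding smooth_def by (metis C_class.simps(2))

lemma smooth_mult: "smooth f \<Longrightarrow> smooth g \<Longrightarrow> smooth (\<lambda>x. f x * g x)"
  unfolding smooth_def by (simp add: C_class_mult)

lemma smooth_prod:
  "finite I \<Longrightarrow> (\<And>i. i \<in> I \<Longrightarrow> smooth (f i)) \<Longrightarrow> smooth (\<lambda>x. \<Prod>i\<in>I. f i x)"
  unfolding smooth_def by (simp add: C_class_prod)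

lemma smooth_continuous: "smooth f \<Longrightarrow> continuous_on UNIV f"
  unfolding smooth_def by (metis C_class_continuous)

lemma smooth_has_derivative:
  "smooth f \<Longrightarrow> ((\<lambda>h. f (x + h *\<^sub>R axis i 1)) has_vector_derivative pdiff i f x) (at 0)"
  using C_class_Suc_has_derivative[of _ f x i 0] unfolding smooth_def by fastforce

lemma pdiff_mult:
  assumes "smooth f" "smooth g"
  shows "pdiff i (\<lambda>x. f x * g x) = (\<lambda>x. f x * pdiff i g x + pdiff i f x * g x)"
proof
  fix x
  show "pdiff i (\<lambda>x. f x * g x) x = f x * pdiff i g x + pdiff i f x * g x"
    using has_vector_derivative_mult_complex[OF smooth_has_derivative[OF assms(1)] smooth_has_derivative[OF assms(2)], of x i x i]
    by (intro pdiff_eqI) simp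
qed

text \<open>The double difference \<open>F h h - F h 0 - F 0 h + F 0 0\<close> equals, by the mean value theorem
  applied in either order, \<open>h\<^sup>2\<close> times either mixed derivative at some point of the square
  \<open>(0, h)\<^sup>2\<close>.\<close>

lemma mixed_derivatives_eq_real:
  fixes F Fs Ft Fst Fts :: "real \<Rightarrow> real \<Rightarrow> real"
  assumes 1: "\<And>s t. ((\<lambda>s. F s t) has_real_derivative Fs s t) (at s)"
    and 2: "\<And>s t. ((\<lambda>t. Fs s t) has_real_derivative Fst s t) (at t)"
    and 3: "\<And>s t. ((\<lambda>t. F s t) has_real_derivative Ft s t) (at t)"
    and 4: "\<And>s t. ((\<lambda>s. Ft s t) has_real_derivative Fts s t) (at s)"
    and c1: "isCont (\<lambda>p. Fst (fst p) (snd p)) (0, 0)"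
    and c2: "isCont (\<lambda>p. Fts (fst p) (snd p)) (0, 0)"
  shows "Fst 0 0 = Fts 0 0"
proof -
  have ex: "\<exists>p q. 0 < fst p \<and> fst p < h \<and> 0 < snd p \<and> snd p < h \<and>
      0 < fst q \<and> fst q < h \<and> 0 < snd q \<and> snd q < h \<and> Fst (fst p) (snd p) = Fts (fst q) (snd q)"
    if h: "h > 0" for h
  proof -
    have "\<exists>z>0. z < h \<and> (F h h - F h 0) - (F 0 h - F 0 0) = (h - 0) * (Fs z h - Fs z 0)"
      using h by (intro MVT2) (auto intro!: derivative_eq_intros 1)
    then obtain z where z: "z > 0" "z < h" "(F h h - F h 0) - (F 0 h - F 0 0) = h * (Fs z h - Fs z 0)"
      by auto
    have "\<exists>w>0. w < h \<and> Fs z h - Fs z 0 = (h - 0) * Fst z w"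
      using h by (intro MVT2) (auto intro!: derivative_eq_intros 2)
    then obtain w where w: "w > 0" "w < h" "Fs z h - Fs z 0 = h * Fst z w"
      by auto
    have "\<exists>z>0. z < h \<and> (F h h - F 0 h) - (F h 0 - F 0 0) = (h - 0) * (Ft h z - Ft 0 z)"
      using h by (intro MVT2[where f = "\<lambda>t. F h t - F 0 t"]) (auto intro!: derivative_eq_intros 3)
    then obtain z' where z': "z' > 0" "z' < h" "(F h h - F 0 h) - (F h 0 - F 0 0) = h * (Ft h z' - Ft 0 z')"
      by auto
    have "\<exists>w>0. w < h \<and> Ft h z' - Ft 0 z' = (h - 0) * Fts w z'"
      using h by (intro MVT2[where f = "\<lambda>s. Ft s z'"]) (auto intro!: derivative_eq_intros 4)
    then obtain w' where w': "w' > 0" "w' < h" "Ft h z' - Ft 0 z' = h * Fts w' z'"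
      by auto
    have "h * (h * Fst z w) = h * (h * Fts w' z')"
      using z(3) w(3) z'(3) w'(3) by (simp add: algebra_simps)
    then have "Fst z w = Fts w' z'" using h by simp
    then show ?thesis
      using z w z' w' by (intro exI[of _ "(z, w)"] exI[of _ "(w', z')"]) auto
  qed
  define h where "h n = inverse (real (Suc n))" for n
  have hpos: "h n > 0" for n by (simp add: h_def)
  have h0: "h \<longlonglongrightarrow> 0" unfolding h_def by (rule LIMSEQ_inverse_real_of_nat)
  obtain p q where pq: "\<And>n. 0 < fst (p n) \<and> fst (p n) < h n \<and> 0 < snd (p n) \<and> snd (p n) < h n \<and>
      0 < fst (q n) \<and> fst (q n) < h n \<and> 0 < snd (q n) \<and> snd (q n) < h n \<and>
      Fst (fst (p n)) (snd (p n)) = Fts (fst (q n)) (snd (q n))"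
    using ex[OF hpos] by metis
  have sq: "r \<longlonglongrightarrow> 0" if "\<And>n. 0 < r n \<and> r n < h n" for r :: "nat \<Rightarrow> real"
    by (rule tendsto_sandwich[OF _ _ tendsto_const h0]) (auto intro!: always_eventually less_imp_le simp: that)
  have "(\<lambda>n. (fst (p n), snd (p n))) \<longlonglongrightarrow> (0, 0)" "(\<lambda>n. (fst (q n), snd (q n))) \<longlonglongrightarrow> (0, 0)"
    by (intro tendsto_Pair sq; use pq in blast)+
  then have "p \<longlonglongrightarrow> (0, 0)" "q \<longlonglongrightarrow> (0, 0)" by simp_all
  then have "(\<lambda>n. Fst (fst (p n)) (snd (p n))) \<longlonglongrightarrow> Fst 0 0"
      "(\<lambda>n. Fts (fst (q n)) (snd (q n))) \<longlonglongrightarrow> Fts 0 0"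
    using isCont_tendsto_compose[OF c1] isCont_tendsto_compose[OF c2] by fastforce+
  moreover have "(\<lambda>n. Fst (fst (p n)) (snd (p n))) = (\<lambda>n. Fts (fst (q n)) (snd (q n)))"
    using pq by auto
  ultimately show ?thesis using LIMSEQ_unique by metis
qed

lemma pdiff_commute:
  fixes f :: "real ^ 'n::finite \<Rightarrow> complex"
  assumes "smooth f"
  shows "pdiff i (pdiff j f) = pdiff j (pdiff i f)"
proof
  fix x :: "real ^ 'n"
  let ?e = "axis i 1 :: real ^ 'n" and ?d = "axis j 1 :: real ^ 'n"
  have key: "\<phi> (pdiff i (pdiff j f) x) = \<phi> (pdiff j (pdiff i f) x)"
    if \<phi>: "bounded_linear \<phi>" for \<phi> :: "complex \<Rightarrow> real"
  proof -
    have der: "((\<lambda>h. \<phi> (g (y + h *\<^sub>R axis k 1))) has_real_derivative \<phi> (pdiff k g (y + h *\<^sub>R axis k 1))) (at h)"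
      if "smooth g" for g :: "real ^ 'n \<Rightarrow> complex" and y k h
      using bounded_linear.has_vector_derivative[OF \<phi> C_class_Suc_has_derivative[of 0 g y k h]] that
      by (auto simp: has_real_derivative_iff_has_vector_derivative smooth_def simp del: C_class.simps)
    have cont: "isCont (\<lambda>p. \<phi> (g (x + fst p *\<^sub>R ?e + snd p *\<^sub>R ?d))) (0, 0)" if "smooth g" for g
    proof -
      have "isCont (\<lambda>p. x + fst p *\<^sub>R ?e + snd p *\<^sub>R ?d) (0, 0)"
        by (intro continuous_intros)
      moreover have "isCont g y" for y
        using smooth_continuous[OF that] by (simp add: continuous_on_eq_continuous_at)
      ultimately have "isCont (g \<circ> (\<lambda>p. x + fst p *\<^sub>R ?e + snd p *\<^sub>R ?d)) (0, 0)"
        by (rule continuous_at_compose)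
      then show ?thesis
        using bounded_linear.continuous[OF \<phi>] by (simp add: o_def)
    qed
    have sm: "smooth (pdiff i f)" "smooth (pdiff j f)" "smooth (pdiff i (pdiff j f))" "smooth (pdiff j (pdiff i f))"
      using assms by (auto intro: smooth_pdiff)
    have "\<phi> (pdiff j (pdiff i f) (x + 0 *\<^sub>R ?e + 0 *\<^sub>R ?d)) = \<phi> (pdiff i (pdiff j f) (x + 0 *\<^sub>R ?e + 0 *\<^sub>R ?d))"
    proof (rule mixed_derivatives_eq_real[where F = "\<lambda>s t. \<phi> (f (x + s *\<^sub>R ?e + t *\<^sub>R ?d))"
        and Fs = "\<lambda>s t. \<phi> (pdiff i f (x + s *\<^sub>R ?e + t *\<^sub>R ?d))"
        and Ft = "\<lambda>s t. \<phi> (pdiff j f (x + s *\<^sub>R ?e + t *\<^sub>R ?d))"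
        and Fst = "\<lambda>s t. \<phi> (pdiff j (pdiff i f) (x + s *\<^sub>R ?e + t *\<^sub>R ?d))"
        and Fts = "\<lambda>s t. \<phi> (pdiff i (pdiff j f) (x + s *\<^sub>R ?e + t *\<^sub>R ?d))"])
      fix s t
      have sw: "x + s *\<^sub>R ?e + t *\<^sub>R ?d = x + t *\<^sub>R ?d + s *\<^sub>R ?e" for s t
        by (simp add: algebra_simps)
      show "((\<lambda>s. \<phi> (f (x + s *\<^sub>R ?e + t *\<^sub>R ?d))) has_real_derivative \<phi> (pdiff i f (x + s *\<^sub>R ?e + t *\<^sub>R ?d))) (at s)"
        unfolding sw by (rule der[OF assms])
      show "((\<lambda>s. \<phi> (pdiff j f (x + s *\<^sub>R ?e + t *\<^sub>R ?d))) has_real_derivative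
          \<phi> (pdiff i (pdiff j f) (x + s *\<^sub>R ?e + t *\<^sub>R ?d))) (at s)"
        unfolding sw by (rule der[OF sm(2)])
    qed (use der assms sm cont in auto)
    then show ?thesis by simp
  qed
  show "pdiff i (pdiff j f) x = pdiff j (pdiff i f) x"
    using key[OF bounded_linear_Re] key[OF bounded_linear_Im] by (simp add: complex_eq_iff)
qed

lemma smooth_foldr_pdiff: "smooth f \<Longrightarrow> smooth (foldr pdiff is f)"
  by (induction "is") (auto intro: smooth_pdiff)

lemma foldr_pdiff_remove1:
  "smooth f \<Longrightarrow> i \<in> set js \<Longrightarrow> foldr pdiff js f = pdiff i (foldr pdiff (remove1 i js) f)"
  by (induction js) (auto simp: pdiff_commute smooth_foldr_pdiff)

lemma foldr_pdiff_perm: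
  "smooth f \<Longrightarrow> mset is = mset js \<Longrightarrow> foldr pdiff is f = foldr pdiff js f"
proof (induction "is" arbitrary: js)
  case (Cons i "is")
  have i: "i \<in> set js" using Cons.prems(2) by (metis list.set_intros(1) set_mset_mset)
  have "mset is = mset (remove1 i js)"
    using Cons.prems(2) by (metis add_mset_remove_trivial mset.simps(2) mset_remove1)
  then show ?case
    using Cons.IH[OF Cons.prems(1), of "remove1 i js"] i Cons.prems(1) by (simp add: foldr_pdiff_remove1 del: mset_remove1)
qed auto

lemma ex_list_counts: "\<exists>is. \<forall>i. count_list is i = (\<alpha> :: 'n::finite midx) i"
proof -
  obtain xs where "mset xs = Abs_multiset \<alpha>" using ex_mset by blast
  then have "count (mset xs) = \<alpha>" by simp
  then show ?thesis by (metis count_mset)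
qed

lemma mdiff_eq_foldr:
  assumes "smooth f" "\<And>i. count_list is i = \<alpha> i"
  shows "mdiff \<alpha> f = foldr pdiff is f"
proof -
  let ?js = "SOME is. \<forall>i. count_list is i = \<alpha> i"
  have "\<forall>i. count_list ?js i = \<alpha> i" by (rule someI_ex) (rule ex_list_counts)
  then have "mset ?js = mset is" using assms(2) by (intro multiset_eqI) (simp add: count_mset)
  then show ?thesis unfolding mdiff_def by (intro foldr_pdiff_perm assms(1))
qed

lemma mdiff_zero: "mdiff (\<lambda>_. 0) f = f"
proof -
  let ?js = "SOME is. \<forall>i. count_list is i = (0::nat)"
  have "\<forall>i. count_list ?js i = 0" by (rule someI[of _ "[]"]) simp
  then have "?js = []" by (metis count_list_0_iff last_in_set)
  then show ?thesis unfolding mdiff_def by (metis foldr.simps(1) id_apply)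
qed

lemma mdiff_upd:
  assumes "smooth f"
  shows "mdiff (\<alpha>(i := Suc (\<alpha> i))) f = mdiff \<alpha> (pdiff i f)"
proof -
  obtain "is" where is': "\<forall>k. count_list is k = \<alpha> k" using ex_list_counts by blast
  have "mdiff (\<alpha>(i := Suc (\<alpha> i))) f = foldr pdiff (is @ [i]) f"
    using is' by (intro mdiff_eq_foldr assms) auto
  also have "\<dots> = mdiff \<alpha> (pdiff i f)"
    using is' mdiff_eq_foldr[OF smooth_pdiff[OF assms], of "is" \<alpha>] by simp
  finally show ?thesis .
qed

lemma mdeg_zero [simp]: "mdeg (\<lambda>_. 0) = 0"
  by (simp add: mdeg_def)

lemma mdeg_upd [simp]: "mdeg (\<alpha>(i := Suc (\<alpha> i))) = Suc (mdeg (\<alpha> :: 'n::finite midx))"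
proof -
  have "mdeg (\<alpha>(i := Suc (\<alpha> i))) = (\<Sum>k\<in>UNIV. \<alpha> k + (if k = i then 1 else 0))"
    unfolding mdeg_def by (rule sum.cong) auto
  then show ?thesis by (simp add: mdeg_def sum.distrib)
qed

lemma mdeg_eq_0_iff: "mdeg \<alpha> = 0 \<longleftrightarrow> \<alpha> = (\<lambda>_. 0 :: nat)"
  by (auto simp: mdeg_def fun_eq_iff)

lemma midx_induct [case_names zero upd]:
  fixes \<alpha> :: "'n::finite midx"
  assumes "P (\<lambda>_. 0)" "\<And>\<alpha> i. P \<alpha> \<Longrightarrow> P (\<alpha>(i := Suc (\<alpha> i)))"
  shows "P \<alpha>"
proof (induction "mdeg \<alpha>" arbitrary: \<alpha>)
  case 0
  then have "\<alpha> = (\<lambda>_. 0)" by (simp add: mdeg_eq_0_iff)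
  then show ?case using assms(1) by simp
next
  case (Suc m)
  then have "\<alpha> \<noteq> (\<lambda>_. 0)" by auto
  then obtain i where i: "\<alpha> i > 0" by (auto simp: fun_eq_iff)
  define \<beta> where "\<beta> = \<alpha>(i := \<alpha> i - 1)"
  have \<alpha>: "\<alpha> = \<beta>(i := Suc (\<beta> i))" using i by (auto simp: \<beta>_def)
  then have "mdeg \<alpha> = Suc (mdeg \<beta>)" by (metis mdeg_upd)
  then show ?case using Suc assms(2) \<alpha> by (metis nat.inject)
qed

lemma test_function_alt:
  "test_function \<phi> \<longleftrightarrow> smooth \<phi> \<and> (\<exists>K. compact K \<and> (\<forall>x. x \<notin> K \<longrightarrow> \<phi> x = 0))"
  by (simp add: test_function_def smooth_def)

lemma test_function_mult: "smooth f \<Longrightarrow> test_function \<phi> \<Longrightarrow> test_function (\<lambda>x. f x * \<phi> x)"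
  unfolding test_function_alt using smooth_mult by (metis mult_zero_right)

lemma test_function_pdiff:
  assumes "test_function (\<phi> :: real ^ 'n::finite \<Rightarrow> complex)"
  shows "test_function (pdiff i \<phi>)"
proof -
  from assms obtain K where K: "compact K" "\<And>x. x \<notin> K \<Longrightarrow> \<phi> x = 0" and s: "smooth \<phi>"
    unfolding test_function_alt by blast
  have "pdiff i \<phi> x = 0" if x: "x \<notin> K" for x
  proof (rule pdiff_eqI)
    have "open ((\<lambda>h. x + h *\<^sub>R axis i 1) -` (- K))"
      by (rule open_vimage) (use K(1) compact_imp_closed in \<open>auto intro!: continuous_intros\<close>)
    moreover have "((\<lambda>h. 0 :: complex) has_vector_derivative 0) (at (0::real))" by simp
    ultimately show "((\<lambda>h. \<phi> (x + h *\<^sub>R axis i 1)) has_vector_derivative 0) (at 0)"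
      using x K(2) has_vector_derivative_transform_within_open[of "\<lambda>_. 0" 0 0 _ "\<lambda>h. \<phi> (x + h *\<^sub>R axis i 1)"]
      by fastforce
  qed
  then show ?thesis using K(1) s smooth_pdiff unfolding test_function_alt by blast
qed

section \<open>Lebesgue spaces\<close>

lemma powr_convex_combination:
  fixes a b t p :: real
  assumes "0 \<le> a" "0 \<le> b" "0 < t" "t < 1" "1 \<le> p"
  shows "(t * a + (1 - t) * b) powr p \<le> t * a powr p + (1 - t) * b powr p"
proof -
  have le: "(c * x) powr p \<le> c * x powr p" if "0 < c" "c < 1" "0 \<le> x" for c x :: real
  proof -
    have "c powr p \<le> c powr 1" using that assms(5) by (intro powr_mono') auto
    then show ?thesis using that by (simp add: powr_mult mult_right_mono)
  qed
  consider "a = 0" | "b = 0" | "a > 0" "b > 0" using assms by linarith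
  then show ?thesis
  proof cases
    case 3
    then show ?thesis
      using convex_onD[OF powr_convex[OF assms(5)], of "1 - t" a b] assms by simp
  qed (use le[of t a] le[of "1 - t" b] assms in auto)
qed

lemma in_Lp_fun_measurable: "in_Lp_fun p f \<Longrightarrow> f \<in> borel_measurable lebesgue"
  by (simp add: in_Lp_fun_def)

lemma Lp_norm_fun_nonneg: "0 \<le> Lp_norm_fun p f"
  by (simp add: Lp_norm_fun_def)

lemma Lp_norm_fun_powr:
  assumes "p > 0"
  shows "Lp_norm_fun p f powr p = (\<integral>x. norm (f x) powr p \<partial>lebesgue)"
  using assms by (simp add: Lp_norm_fun_def powr_powr)

lemma Lp_norm_fun_le_iff:
  assumes "p > 0" "A \<ge> 0"
  shows "Lp_norm_fun p f \<le> A \<longleftrightarrow> (\<integral>x. norm (f x) powr p \<partial>lebesgue) \<le> A powr p"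
proof -
  have "Lp_norm_fun p f \<le> A \<longleftrightarrow> Lp_norm_fun p f powr p \<le> A powr p"
    using assms Lp_norm_fun_nonneg[of p f] by (meson not_le powr_less_mono2 powr_mono2 less_eq_real_def)
  then show ?thesis using Lp_norm_fun_powr[OF assms(1), of f] by simp
qed

lemma Lp_dominated:
  assumes "p > 0" "in_Lp_fun p g" "f \<in> borel_measurable lebesgue" "C \<ge> 0"
    and le: "AE x in lebesgue. norm (f x) \<le> C * norm (g x)"
  shows "in_Lp_fun p f" "Lp_norm_fun p f \<le> C * Lp_norm_fun p g"
proof -
  have ig: "integrable lebesgue (\<lambda>x. C powr p * norm (g x) powr p)"
    using assms(2) by (simp add: in_Lp_fun_def)
  have le': "AE x in lebesgue. norm (f x) powr p \<le> C powr p * norm (g x) powr p"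
    using le
  proof eventually_elim
    case (elim x)
    then have "norm (f x) powr p \<le> (C * norm (g x)) powr p"
      using assms(1) by (intro powr_mono2) auto
    then show ?case using assms(4) by (simp add: powr_mult)
  qed
  have "integrable lebesgue (\<lambda>x. norm (f x) powr p)"
    by (rule Bochner_Integration.integrable_bound[OF ig])
      (use assms(3) le' in \<open>auto elim: eventually_mono\<close>)
  then show f: "in_Lp_fun p f" using assms(3) by (simp add: in_Lp_fun_def)
  have "(\<integral>x. norm (f x) powr p \<partial>lebesgue) \<le> (\<integral>x. C powr p * norm (g x) powr p \<partial>lebesgue)"
    using f by (intro integral_mono_AE ig le') (simp add: in_Lp_fun_def)
  also have "\<dots> = (C * Lp_norm_fun p g) powr p"
    using assms by (simp add: powr_mult Lp_norm_fun_nonneg Lp_norm_fun_powr)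
  finally show "Lp_norm_fun p f \<le> C * Lp_norm_fun p g"
    using assms by (subst Lp_norm_fun_le_iff) (auto simp: Lp_norm_fun_nonneg)
qed

text \<open>Minkowski's inequality follows from the convexity of \<open>x \<mapsto> x\<^sup>p\<close>, applied to the convex
  combination \<open>(f + g) / (A + B)\<close> of \<open>f / A\<close> and \<open>g / B\<close>. The bounds \<open>A\<close>, \<open>B\<close> exceed the two
  norms, so that no norm has to be assumed positive.\<close>

lemma Lp_add:
  assumes p: "p \<ge> 1" and f: "in_Lp_fun p f" and g: "in_Lp_fun p g"
  shows "in_Lp_fun p (\<lambda>x. f x + g x)"
    and "Lp_norm_fun p (\<lambda>x. f x + g x) \<le> Lp_norm_fun p f + Lp_norm_fun p g"
proof -
  let ?I = "\<lambda>f. \<integral>x. norm (f x) powr p \<partial>lebesgue"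
  have [measurable]: "f \<in> borel_measurable lebesgue" "g \<in> borel_measurable lebesgue"
    using f g in_Lp_fun_measurable by auto
  have int: "integrable lebesgue (\<lambda>x. norm (f x) powr p)" "integrable lebesgue (\<lambda>x. norm (g x) powr p)"
    using f g by (auto simp: in_Lp_fun_def)
  have pt: "norm (f x + g x) powr p \<le> (A + B) powr p * (A / (A + B) * (norm (f x) powr p / A powr p) +
      B / (A + B) * (norm (g x) powr p / B powr p))" if AB: "A > 0" "B > 0" for A B x
  proof -
    have "norm (f x + g x) powr p \<le> (norm (f x) + norm (g x)) powr p"
      using p by (intro powr_mono2) (auto simp: norm_triangle_ineq)
    also have "norm (f x) + norm (g x) = (A + B) * (A / (A + B) * (norm (f x) / A) + (1 - A / (A + B)) * (norm (g x) / B))"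
      using AB by (simp add: divide_simps)
    also have "\<dots> powr p = (A + B) powr p * (A / (A + B) * (norm (f x) / A) + (1 - A / (A + B)) * (norm (g x) / B)) powr p"
      by (rule powr_mult)
    also have "\<dots> \<le> (A + B) powr p * (A / (A + B) * (norm (f x) / A) powr p + (1 - A / (A + B)) * (norm (g x) / B) powr p)"
      using AB p by (intro mult_left_mono powr_convex_combination) (auto simp: divide_simps)
    also have "1 - A / (A + B) = B / (A + B)" using AB by (simp add: divide_simps)
    finally show ?thesis using AB by (simp add: powr_divide)
  qed
  have int2: "integrable lebesgue (\<lambda>x. (A + B) powr p * (A / (A + B) * (norm (f x) powr p / A powr p) +
      B / (A + B) * (norm (g x) powr p / B powr p)))" for A B
    by (intro integrable_mult_right Bochner_Integration.integrable_add integrable_divide int)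
  have "integrable lebesgue (\<lambda>x. norm (f x + g x) powr p)"
    by (rule Bochner_Integration.integrable_bound[OF int2[of 1 1]])
      (use pt[of 1 1] in \<open>auto intro!: AE_I2 order_trans[OF _ abs_ge_self] simp: abs_of_nonneg[OF powr_ge_zero]\<close>)
  then show fg: "in_Lp_fun p (\<lambda>x. f x + g x)"
    by (simp add: in_Lp_fun_def)
  have *: "Lp_norm_fun p (\<lambda>x. f x + g x) \<le> A + B"
    if A: "Lp_norm_fun p f < A" and B: "Lp_norm_fun p g < B" for A B
  proof -
    have AB: "A > 0" "B > 0" using A B Lp_norm_fun_nonneg[of p] by (metis le_less_trans)+
    have ia: "?I f \<le> A powr p" "?I g \<le> B powr p"
      using Lp_norm_fun_le_iff[of p A f] Lp_norm_fun_le_iff[of p B g] A B AB p by auto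
    have "?I (\<lambda>x. f x + g x) \<le> (\<integral>x. (A + B) powr p * (A / (A + B) * (norm (f x) powr p / A powr p) +
      B / (A + B) * (norm (g x) powr p / B powr p)) \<partial>lebesgue)"
      by (rule integral_mono[OF _ int2]) (use fg pt AB in \<open>auto simp: in_Lp_fun_def\<close>)
    also have "\<dots> = (A + B) powr p * (A / (A + B) * (?I f / A powr p) + B / (A + B) * (?I g / B powr p))"
      using int by simp
    also have "\<dots> \<le> (A + B) powr p * (A / (A + B) * 1 + B / (A + B) * 1)"
      using ia AB by (intro mult_left_mono add_mono) auto
    also have "\<dots> = (A + B) powr p" using AB by (simp add: divide_simps)
    finally show ?thesis using AB p by (subst Lp_norm_fun_le_iff) auto
  qed
  show "Lp_norm_fun p (\<lambda>x. f x + g x) \<le> Lp_norm_fun p f + Lp_norm_fun p g"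
  proof (rule field_le_epsilon)
    fix e :: real assume "e > 0"
    then show "Lp_norm_fun p (\<lambda>x. f x + g x) \<le> Lp_norm_fun p f + Lp_norm_fun p g + e"
      using *[of "Lp_norm_fun p f + e / 2" "Lp_norm_fun p g + e / 2"] by simp
  qed
qed

text \<open>This is \<open>x \<le> 1 + x\<^sup>p\<close>, applied to \<open>\<bar>f\<bar> / A\<close> for every \<open>A\<close> larger than the norm of \<open>f\<close>.\<close>

lemma Lp_local_bound:
  assumes p: "p \<ge> 1" and f: "in_Lp_fun p f" and h: "h \<in> borel_measurable lebesgue"
    and K: "K \<in> lmeasurable" and C: "C \<ge> 0" and le: "\<And>x. norm (h x) \<le> C * indicator K x"
  shows "integrable lebesgue (\<lambda>x. f x * h x)"
    and "norm (\<integral>x. f x * h x \<partial>lebesgue) \<le> C * (measure lebesgue K + 1) * Lp_norm_fun p f"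
proof -
  have [measurable]: "f \<in> borel_measurable lebesgue" "h \<in> borel_measurable lebesgue" "K \<in> sets lebesgue"
    using f in_Lp_fun_measurable h K by (auto simp: fmeasurableD)
  have intK: "integrable lebesgue (indicator K :: _ \<Rightarrow> real)"
    using K by (simp add: fmeasurable_def)
  have int: "integrable lebesgue (\<lambda>x. norm (f x) powr p)"
    using f by (auto simp: in_Lp_fun_def)
  have pt: "norm (f x * h x) \<le> A * C * (indicator K x + norm (f x) powr p / A powr p)" if A: "A > 0" for A x
  proof -
    have "norm (f x) / A \<le> 1 + (norm (f x) / A) powr p"
    proof (cases "norm (f x) / A \<le> 1")
      case False
      then have "(norm (f x) / A) powr 1 \<le> (norm (f x) / A) powr p"
        using p by (intro powr_mono) auto
      then show ?thesis using A by simp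
    qed (auto intro: add_increasing2)
    then have "norm (f x) \<le> A * (1 + norm (f x) powr p / A powr p)"
      using A by (simp add: powr_divide field_simps)
    then have "norm (f x) * norm (h x) \<le> A * (1 + norm (f x) powr p / A powr p) * (C * indicator K x)"
      using le[of x] A C by (intro mult_mono) auto
    also have "\<dots> \<le> A * C * (indicator K x + norm (f x) powr p / A powr p)"
      using A C by (auto simp: indicator_def algebra_simps)
    finally show ?thesis by (simp add: norm_mult)
  qed
  have int2: "integrable lebesgue (\<lambda>x. A * C * (indicator K x + norm (f x) powr p / A powr p))" for A
    by (intro integrable_mult_right Bochner_Integration.integrable_add integrable_divide int intK)
  show i: "integrable lebesgue (\<lambda>x. f x * h x)"
    by (rule Bochner_Integration.integrable_bound[OF int2[of 1]])
      (use pt[of 1] in \<open>auto intro!: always_eventually intro: order_trans[OF _ abs_ge_self]\<close>)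
  have *: "norm (\<integral>x. f x * h x \<partial>lebesgue) \<le> C * (measure lebesgue K + 1) * A" if A: "Lp_norm_fun p f < A" for A
  proof -
    have A0: "A > 0" using A Lp_norm_fun_nonneg[of p f] by linarith
    have ia: "(\<integral>x. norm (f x) powr p \<partial>lebesgue) \<le> A powr p"
      using Lp_norm_fun_le_iff[of p A f] A A0 p by auto
    have "norm (\<integral>x. f x * h x \<partial>lebesgue) \<le> (\<integral>x. norm (f x * h x) \<partial>lebesgue)"
      by (rule integral_norm_bound)
    also have "\<dots> \<le> (\<integral>x. A * C * (indicator K x + norm (f x) powr p / A powr p) \<partial>lebesgue)"
      by (rule integral_mono[OF _ int2]) (use i pt[OF A0] in auto)
    also have "\<dots> = A * C * (measure lebesgue K + (\<integral>x. norm (f x) powr p \<partial>lebesgue) / A powr p)"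
      using int intK by simp
    also have "\<dots> \<le> A * C * (measure lebesgue K + 1)"
      using A0 C ia by (intro mult_left_mono add_mono) auto
    finally show ?thesis by (simp add: algebra_simps)
  qed
  show "norm (\<integral>x. f x * h x \<partial>lebesgue) \<le> C * (measure lebesgue K + 1) * Lp_norm_fun p f"
  proof (rule field_le_epsilon)
    fix e :: real assume e: "e > 0"
    let ?D = "C * (measure lebesgue K + 1)"
    have D: "?D \<ge> 0" using C by simp
    have "norm (\<integral>x. f x * h x \<partial>lebesgue) \<le> ?D * (Lp_norm_fun p f + e / (?D + 1))"
      using e D by (intro *) (simp add: add_nonneg_pos)
    also have "\<dots> \<le> ?D * Lp_norm_fun p f + e"
    proof -
      have "?D * (e / (?D + 1)) \<le> (?D + 1) * (e / (?D + 1))"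
        using e D by (intro mult_right_mono) auto
      also have "\<dots> = e" using D by simp
      finally show ?thesis unfolding distrib_left by simp
    qed
    finally show "norm (\<integral>x. f x * h x \<partial>lebesgue) \<le> ?D * Lp_norm_fun p f + e" .
  qed
qed

lemma in_Lp_fun_locally_integrable:
  assumes "p \<ge> 1" "in_Lp_fun p f"
  shows "locally_integrable f"
proof -
  have "set_integrable lebesgue K f" if "compact K" for K
  proof -
    have K: "K \<in> lmeasurable" using that by (rule lmeasurable_compact)
    have "(\<lambda>x. indicator K x :: complex) \<in> borel_measurable lebesgue"
      using K by (auto intro: borel_measurable_indicator fmeasurableD)
    then have "integrable lebesgue (\<lambda>x. f x * indicator K x)"
      by (rule Lp_local_bound(1)[OF assms _ K, of _ 1]) (auto simp: indicator_def)
    moreover have "(\<lambda>x. indicator K x *\<^sub>R f x) = (\<lambda>x. f x * indicator K x)"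
      by (auto simp: indicator_def)
    ultimately show ?thesis unfolding set_integrable_def by simp
  qed
  then show ?thesis unfolding locally_integrable_def by blast
qed

lemma Lp_norm_fun_eq_0:
  assumes "p > 0" "in_Lp_fun p f" "Lp_norm_fun p f = 0"
  shows "AE x in lebesgue. f x = 0"
proof -
  have "(\<integral>x. norm (f x) powr p \<partial>lebesgue) = 0"
    using assms Lp_norm_fun_powr[OF assms(1), of f] by simp
  then have "AE x in lebesgue. norm (f x) powr p = 0"
    using assms(2) by (subst (asm) integral_nonneg_eq_0_iff_AE) (auto simp: in_Lp_fun_def)
  then show ?thesis by eventually_elim simp
qed

text \<open>The integrals of the \<open>p\<close>-th powers of the differences along the subsequence decay like
  \<open>4\<^sup>-\<^sup>k\<close>; the factor \<open>2\<^sup>k\<close> still leaves a convergent series of integrals, so almost everywhere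
  the differences are dominated by a geometric sequence. Fatou's lemma then identifies the limit.\<close>

lemma Lp_complete_fun:
  fixes F :: "nat \<Rightarrow> real ^ 'n::finite \<Rightarrow> complex"
  assumes p: "p \<ge> 1" and F: "\<And>n. in_Lp_fun p (F n)"
    and Cau: "\<And>e. e > 0 \<Longrightarrow> \<exists>M. \<forall>m\<ge>M. \<forall>n\<ge>M. Lp_norm_fun p (\<lambda>x. F m x - F n x) < e"
  shows "\<exists>f. in_Lp_fun p f \<and> (\<lambda>n. Lp_norm_fun p (\<lambda>x. F n x - f x)) \<longlonglongrightarrow> 0"
proof -
  have Fm[measurable]: "F n \<in> borel_measurable lebesgue" for n
    using F in_Lp_fun_measurable by blast
  have dLp: "in_Lp_fun p (\<lambda>x. F m x - F n x)" for m n
  proof -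
    have "in_Lp_fun p (\<lambda>x. - F n x)"
      by (rule Lp_dominated(1)[OF _ F[of n], of _ 1]) (use p in auto)
    from Lp_add(1)[OF p F[of m] this] show ?thesis by simp
  qed
  let ?J = "\<lambda>f. \<integral>\<^sup>+x. ennreal (norm (f x) powr p) \<partial>lebesgue"
  have J: "?J (\<lambda>x. F m x - F n x) = ennreal (Lp_norm_fun p (\<lambda>x. F m x - F n x) powr p)" for m n
    using dLp[of m n] p
    by (subst nn_integral_eq_integral) (auto simp: in_Lp_fun_def Lp_norm_fun_powr)
  have Jle: "\<exists>M. \<forall>m\<ge>M. \<forall>n\<ge>M. ?J (\<lambda>x. F m x - F n x) \<le> ennreal e" if "e > 0" for e
  proof -
    have "e powr (1 / p) > 0" using that by simp
    from Cau[OF this] obtain M where M: "\<And>m n. m \<ge> M \<Longrightarrow> n \<ge> M \<Longrightarrow>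
        Lp_norm_fun p (\<lambda>x. F m x - F n x) < e powr (1 / p)"
      by blast
    have "Lp_norm_fun p (\<lambda>x. F m x - F n x) powr p \<le> (e powr (1 / p)) powr p" if "m \<ge> M" "n \<ge> M" for m n
      using M[OF that] p by (intro powr_mono2) (auto simp: Lp_norm_fun_nonneg)
    then show ?thesis using that p
      by (intro exI[of _ M]) (auto simp: J powr_powr)
  qed
  have "\<exists>r. \<forall>k. (\<forall>m\<ge>r k. \<forall>n\<ge>r k. ?J (\<lambda>x. F m x - F n x) \<le> ennreal ((1/4)^k)) \<and> r k < r (Suc k)"
  proof (rule dependent_nat_choice)
    show "\<exists>M. \<forall>m\<ge>M. \<forall>n\<ge>M. ?J (\<lambda>x. F m x - F n x) \<le> ennreal ((1/4)^0)"
      by (rule Jle) simp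
    show "\<exists>y. (\<forall>m\<ge>y. \<forall>n\<ge>y. ?J (\<lambda>x. F m x - F n x) \<le> ennreal ((1/4)^Suc k)) \<and> x < y" for x k
    proof -
      from Jle[of "(1/4)^Suc k"] obtain M where "\<forall>m\<ge>M. \<forall>n\<ge>M. ?J (\<lambda>x. F m x - F n x) \<le> ennreal ((1/4)^Suc k)"
        by auto
      then show ?thesis by (intro exI[of _ "max M (Suc x)"]) auto
    qed
  qed
  then obtain r where r: "\<And>k m n. m \<ge> r k \<Longrightarrow> n \<ge> r k \<Longrightarrow> ?J (\<lambda>x. F m x - F n x) \<le> ennreal ((1/4)^k)"
    and rS: "\<And>k. r k < r (Suc k)"
    by blast
  have rmono: "strict_mono r" using rS by (simp add: strict_mono_Suc_iff)
  define D where "D k x = F (r (Suc k)) x - F (r k) x" for k x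
  have [measurable]: "D k \<in> borel_measurable lebesgue" for k unfolding D_def by measurable
  have "(\<integral>\<^sup>+x. (\<Sum>k. ennreal (2^k * norm (D k x) powr p)) \<partial>lebesgue) = (\<Sum>k. \<integral>\<^sup>+x. ennreal (2^k * norm (D k x) powr p) \<partial>lebesgue)"
    by (rule nn_integral_suminf) measurable
  also have "\<dots> \<le> (\<Sum>k. ennreal ((1/2)^k))"
  proof (rule suminf_le)
    fix k
    have "(\<integral>\<^sup>+x. ennreal (2^k * norm (D k x) powr p) \<partial>lebesgue) = ennreal (2^k) * ?J (D k)"
      by (subst nn_integral_cmult[symmetric]) (auto simp: ennreal_mult)
    also have "\<dots> \<le> ennreal (2^k) * ennreal ((1/4)^k)"
      unfolding D_def using rS[of k] by (intro mult_left_mono r) auto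
    also have "\<dots> = ennreal ((1/2)^k)"
      by (simp add: ennreal_mult[symmetric] power_mult_distrib[symmetric])
    finally show "(\<integral>\<^sup>+x. ennreal (2^k * norm (D k x) powr p) \<partial>lebesgue) \<le> ennreal ((1/2)^k)" .
  qed auto
  also have "\<dots> < \<infinity>"
    using summable_geometric[of "1/2 :: real"] by (simp add: suminf_ennreal2 ennreal_less_top)
  finally have fin: "(\<integral>\<^sup>+x. (\<Sum>k. ennreal (2^k * norm (D k x) powr p)) \<partial>lebesgue) \<noteq> \<infinity>" by simp
  have "AE x in lebesgue. (\<Sum>k. ennreal (2^k * norm (D k x) powr p)) \<noteq> \<infinity>"
    by (rule nn_integral_PInf_AE[OF _ fin]) measurable
  then have conv: "AE x in lebesgue. convergent (\<lambda>k. F (r k) x)"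
  proof eventually_elim
    case (elim x)
    then have "summable (\<lambda>k. 2^k * norm (D k x) powr p)"
      by (intro summable_suminf_not_top) auto
    then have "(\<lambda>k. 2^k * norm (D k x) powr p) \<longlonglongrightarrow> 0" by (rule summable_LIMSEQ_zero)
    then have "\<forall>\<^sub>F k in sequentially. 2^k * norm (D k x) powr p < 1"
      by (rule order_tendstoD) simp
    then have ev: "\<forall>\<^sub>F k in sequentially. norm (D k x) \<le> ((1/2) powr (1/p)) ^ k"
    proof eventually_elim
      case (elim k)
      then have "norm (D k x) powr p \<le> (1/2)^k" by (simp add: field_simps)
      then have "(norm (D k x) powr p) powr (1/p) \<le> ((1/2)^k) powr (1/p)"
        using p by (intro powr_mono2) auto
      then show ?case using p by (simp add: powr_powr powr_power powr_realpow[symmetric] mult.commute)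
    qed
   have "(1/2 :: real) powr (1/p) < (1/2) powr 0" using p by (intro powr_less_mono') auto
    then have "(1/2 :: real) powr (1/p) < 1" by simp
    then have "summable (\<lambda>k. D k x)"
      by (intro summable_comparison_test_ev[OF ev] summable_geometric) simp
    then have "convergent (\<lambda>n. \<Sum>k<n. D k x)" by (simp add: summable_iff_convergent)
    moreover have "(\<Sum>k<n. D k x) = F (r n) x - F (r 0) x" for n
      unfolding D_def by (rule sum_lessThan_telescope)
    ultimately have "convergent (\<lambda>n. F (r n) x - F (r 0) x)" by simp
    then have "convergent (\<lambda>n. (F (r n) x - F (r 0) x) + F (r 0) x)"
      by (intro convergent_add convergent_const)
    then show ?case by simp
  qed
  define f where "f x = lim (\<lambda>k. F (r k) x)" for x
  have fm[measurable]: "f \<in> borel_measurable lebesgue" unfolding f_def by measurable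
  have lim: "AE x in lebesgue. (\<lambda>k. F (r k) x) \<longlonglongrightarrow> f x"
    using conv by eventually_elim (simp add: f_def convergent_LIMSEQ_iff)
  have Fat: "?J (\<lambda>x. F n x - f x) \<le> ennreal e"
    if e: "e > 0" and M: "\<And>m n. m \<ge> M \<Longrightarrow> n \<ge> M \<Longrightarrow> ?J (\<lambda>x. F m x - F n x) \<le> ennreal e" and n: "n \<ge> M" for e M n
  proof -
    have "?J (\<lambda>x. F n x - f x) = (\<integral>\<^sup>+x. liminf (\<lambda>k. ennreal (norm (F n x - F (r k) x) powr p)) \<partial>lebesgue)"
    proof (rule nn_integral_cong_AE)
      show "AE x in lebesgue. ennreal (norm (F n x - f x) powr p) = liminf (\<lambda>k. ennreal (norm (F n x - F (r k) x) powr p))"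
        using lim
      proof eventually_elim
        case (elim x)
        then have "(\<lambda>k. ennreal (norm (F n x - F (r k) x) powr p)) \<longlonglongrightarrow> ennreal (norm (F n x - f x) powr p)"
          using p by (intro tendsto_intros tendsto_powr2) auto
        then show ?case by (rule lim_imp_Liminf[OF trivial_limit_sequentially, symmetric])
      qed
    qed
    also have "\<dots> \<le> liminf (\<lambda>k. ?J (\<lambda>x. F n x - F (r k) x))"
      by (rule nn_integral_liminf) measurable
    also have "\<dots> \<le> liminf (\<lambda>k. ennreal e)"
    proof (rule Liminf_mono)
      have "r k \<ge> M" if "k \<ge> M" for k using seq_suble[OF rmono, of k] that by simp
      then show "\<forall>\<^sub>F k in sequentially. ?J (\<lambda>x. F n x - F (r k) x) \<le> ennreal e"
        using M n by (auto simp: eventually_sequentially intro!: exI[of _ M])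
    qed
    also have "\<dots> = ennreal e" by (simp add: Liminf_const)
    finally show ?thesis .
  qed
  have Lp': "in_Lp_fun p (\<lambda>x. F n x - f x) \<and> Lp_norm_fun p (\<lambda>x. F n x - f x) \<le> e powr (1/p)"
    if e: "e > 0" and le: "?J (\<lambda>x. F n x - f x) \<le> ennreal e" for n e
  proof -
    have i: "integrable lebesgue (\<lambda>x. norm (F n x - f x) powr p)"
      by (rule integrableI_nonneg) (use le in \<open>auto simp: less_top[symmetric] top_unique\<close>)
    then have "(\<integral>x. norm (F n x - f x) powr p \<partial>lebesgue) \<le> e"
      using le e by (subst (asm) nn_integral_eq_integral) auto
    then have "Lp_norm_fun p (\<lambda>x. F n x - f x) \<le> e powr (1/p)"
      using p e by (subst Lp_norm_fun_le_iff) (auto simp: powr_powr)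
    then show ?thesis using i by (auto simp: in_Lp_fun_def)
  qed
  have "in_Lp_fun p f"
  proof -
    obtain M where M: "\<And>m n. m \<ge> M \<Longrightarrow> n \<ge> M \<Longrightarrow> ?J (\<lambda>x. F m x - F n x) \<le> ennreal 1" using Jle[of 1] by auto
    have "in_Lp_fun p (\<lambda>x. F M x - f x)"
      using Lp'[of 1 M] Fat[of 1 M M, OF _ M] by simp
    then have "in_Lp_fun p (\<lambda>x. - (F M x - f x))"
      by (rule Lp_dominated(1)[of p _ _ 1, rotated]) (use p in \<open>auto simp: norm_minus_commute\<close>)
    from Lp_add(1)[OF p F[of M] this] show ?thesis by simp
  qed
  moreover have "(\<lambda>n. Lp_norm_fun p (\<lambda>x. F n x - f x)) \<longlonglongrightarrow> 0"
  proof (rule LIMSEQ_I)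
    fix e :: real assume e: "e > 0"
    let ?d = "(e/2) powr p"
    have d: "?d > 0" using e by simp
    obtain M where M: "\<And>m n. m \<ge> M \<Longrightarrow> n \<ge> M \<Longrightarrow> ?J (\<lambda>x. F m x - F n x) \<le> ennreal ?d" using Jle[OF d] by auto
    have half: "Lp_norm_fun p (\<lambda>x. F n x - f x) \<le> e / 2" if "n \<ge> M" for n
      using Lp'[OF d Fat[OF d M that]] p e by (simp add: powr_powr)
    then show "\<exists>M. \<forall>n\<ge>M. norm (Lp_norm_fun p (\<lambda>x. F n x - f x) - 0) < e"
    proof (intro exI[of _ M] allI impI)
      fix n assume "n \<ge> M"
      then have "Lp_norm_fun p (\<lambda>x. F n x - f x) \<le> e / 2" by (rule half)
      then show "norm (Lp_norm_fun p (\<lambda>x. F n x - f x) - 0) < e"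
        using e Lp_norm_fun_nonneg[of p "\<lambda>x. F n x - f x"] by simp
    qed
  qed
  ultimately show ?thesis by blast
qed

text \<open>Bounded measurable functions with bounded support lie in every Lebesgue space, and multiplication by a
  continuous function, such as a weight or its reciprocal, preserves them.\<close>

definition cutoff_fun :: "(real ^ 'n::finite \<Rightarrow> complex) \<Rightarrow> bool" where
  "cutoff_fun h \<longleftrightarrow> h \<in> borel_measurable lebesgue \<and>
     (\<exists>C R. C \<ge> 0 \<and> (\<forall>x. norm (h x) \<le> C * indicator (cball 0 R) x))"

lemma Lp_truncation:
  fixes f :: "real ^ 'n::finite \<Rightarrow> complex"
  assumes p: "p \<ge> 1" and f: "in_Lp_fun p f" and e: "e > 0"
  shows "\<exists>g. cutoff_fun g \<and> Lp_norm_fun p (\<lambda>x. f x - g x) < e"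
proof -
  have [measurable]: "f \<in> borel_measurable lebesgue" using f in_Lp_fun_measurable by blast
  define A where "A k = {x :: real ^ 'n. norm x \<le> real k} \<inter> {x. norm (f x) \<le> real k}" for k :: nat
  define g where "g k x = indicator (A k) x * f x" for k x
  have A: "A k \<in> sets lebesgue" for k
  proof -
    have "{x \<in> space lebesgue. norm (f x) \<le> real k} \<in> sets lebesgue" by measurable
    then have "{x. norm (f x) \<le> real k} \<in> sets lebesgue" by simp
    moreover have "{x :: real ^ 'n. norm x \<le> real k} \<in> sets lebesgue"
    proof -
      have "{x :: real ^ 'n. norm x \<le> real k} = cball 0 (real k)" by (auto simp: dist_norm)
      then show ?thesis by simp
    qed
    ultimately show ?thesis unfolding A_def by auto
  qed
  have gm[measurable]: "g k \<in> borel_measurable lebesgue" for k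
    unfolding g_def by (intro borel_measurable_times borel_measurable_indicator A) simp
  have cut: "cutoff_fun (g k)" for k
    unfolding cutoff_fun_def
    by (intro conjI gm exI[of _ "real k"] allI) (auto simp: g_def A_def indicator_def dist_norm norm_mult)
  have "(\<lambda>k. \<integral>x. norm (f x - g k x) powr p \<partial>lebesgue) \<longlonglongrightarrow> (\<integral>x. (0::real) \<partial>(lebesgue :: (real ^ 'n) measure))"
  proof (rule integral_dominated_convergence[where w = "\<lambda>x. norm (f x) powr p"])
    show "integrable lebesgue (\<lambda>x. norm (f x) powr p)" using f by (simp add: in_Lp_fun_def)
    show "AE x in lebesgue. (\<lambda>k. norm (f x - g k x) powr p) \<longlonglongrightarrow> 0"
    proof (rule AE_I2)
      fix x :: "real ^ 'n"
      obtain k0 :: nat where k0: "max (norm x) (norm (f x)) \<le> real k0" using real_arch_simple by blast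
      have "norm (f x - g k x) powr p = 0" if "k \<ge> k0" for k
        using k0 that by (auto simp: g_def A_def indicator_def)
      then have "\<forall>\<^sub>F k in sequentially. norm (f x - g k x) powr p = 0"
        by (auto simp: eventually_sequentially)
      then show "(\<lambda>k. norm (f x - g k x) powr p) \<longlonglongrightarrow> 0" by (rule tendsto_eventually)
    qed
    show "AE x in lebesgue. norm (norm (f x - g k x) powr p) \<le> norm (f x) powr p" for k
      by (rule AE_I2) (auto simp: g_def indicator_def)
  qed measurable
  then have "(\<lambda>k. \<integral>x. norm (f x - g k x) powr p \<partial>lebesgue) \<longlonglongrightarrow> 0" by simp
  moreover have "(e/2) powr p > 0" using e by simp
  ultimately have "\<forall>\<^sub>F k in sequentially. (\<integral>x. norm (f x - g k x) powr p \<partial>lebesgue) < (e/2) powr p"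
    by (rule order_tendstoD)
  then obtain k where "(\<integral>x. norm (f x - g k x) powr p \<partial>lebesgue) < (e/2) powr p"
    by (auto simp: eventually_sequentially)
  then have "Lp_norm_fun p (\<lambda>x. f x - g k x) \<le> e / 2"
    using p e by (subst Lp_norm_fun_le_iff) auto
  then show ?thesis using cut e by (intro exI[of _ "g k"]) auto
qed

lemma cutoff_fun_Lp:
  fixes h :: "real ^ 'n::finite \<Rightarrow> complex"
  assumes p: "p > 0" and h: "cutoff_fun h"
  shows "in_Lp_fun p h"
proof -
  obtain C R where CR: "C \<ge> 0" "\<And>x. norm (h x) \<le> C * indicator (cball 0 R) x"
    and m: "h \<in> borel_measurable lebesgue"
    using h unfolding cutoff_fun_def by blast
  have "in_Lp_fun p (\<lambda>x. indicator (cball (0 :: real ^ 'n) R) x)"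
  proof -
    have "(\<lambda>x. norm (indicator (cball (0 :: real ^ 'n) R) x :: complex) powr p) = indicator (cball 0 R)"
      using p by (auto simp: indicator_def)
    moreover have "integrable lebesgue (indicator (cball (0 :: real ^ 'n) R) :: _ \<Rightarrow> real)"
      using lmeasurable_compact[OF compact_cball[of "0 :: real ^ 'n" R]] by (simp add: fmeasurable_def)
    moreover have "(indicator (cball 0 R) :: real ^ 'n \<Rightarrow> complex) \<in> borel_measurable lebesgue"
      by (intro borel_measurable_indicator) simp
    ultimately show ?thesis by (simp add: in_Lp_fun_def)
  qed
  then show ?thesis
  proof (rule Lp_dominated(1)[OF p _ m CR(1)], intro AE_I2)
    fix x
    show "norm (h x) \<le> C * norm (indicator (cball 0 R) x :: complex)"
      using CR(2)[of x] by (cases "norm x \<le> R") (auto simp: indicator_def)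
  qed
qed

lemma cutoff_fun_mult_continuous:
  fixes h :: "real ^ 'n::finite \<Rightarrow> complex"
  assumes h: "cutoff_fun h" and w: "continuous_on UNIV w"
  shows "cutoff_fun (\<lambda>x. w x * h x)"
proof -
  obtain C R where CR: "C \<ge> 0" "\<And>x. norm (h x) \<le> C * indicator (cball 0 R) x"
    and m: "h \<in> borel_measurable lebesgue"
    using h unfolding cutoff_fun_def by blast
  have "compact (w ` cball 0 R)"
    by (rule compact_continuous_image) (auto intro: continuous_on_subset[OF w])
  then obtain B where B: "\<And>x. x \<in> cball 0 R \<Longrightarrow> norm (w x) \<le> B" "B > 0"
    using bounded_pos[of "w ` cball 0 R"] compact_imp_bounded by blast
  have wm: "w \<in> borel_measurable lebesgue"
    using borel_measurable_continuous_onI[OF w] by (intro measurable_completion) simp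
  have "norm (w x * h x) \<le> (B * C) * indicator (cball 0 R) x" for x
  proof (cases "x \<in> cball 0 R")
    case True
    then show ?thesis using mult_mono[OF B(1)[OF True] CR(2)[of x]] B(2) CR(1) by (simp add: norm_mult)
  next
    case False
    then show ?thesis using CR(2)[of x] by (simp add: indicator_def norm_mult)
  qed
  then show ?thesis
    unfolding cutoff_fun_def using wm m CR(1) B(2)
    by (intro conjI exI[of _ "B * C"] exI[of _ R]) auto
qed

subsection \<open>Classes of functions\<close>

lemma ae_fun_cases: obtains f where "u = abs_ae_fun f"
  using Quotient3_abs_rep[OF Quotient3_ae_fun, of u] by (rule that[OF sym])

lemma fmult_zero [simp]: "fmult a 0 = 0"
  by transfer simp

lemma fmult_one [simp]: "fmult (\<lambda>x. 1) u = u"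
  by transfer simp

lemma fmult_add: "fmult a (u + v) = fmult a u + fmult a v"
  by transfer (simp add: algebra_simps)

lemma fmult_diff: "fmult a (u - v) = fmult a u - fmult a v"
  by transfer (simp add: algebra_simps)

lemma fmult_fmult: "fmult a (fmult b u) = fmult (\<lambda>x. a x * b x) u"
  by transfer (simp add: algebra_simps)

lemma fmult_minus_one: "fmult (\<lambda>x. - 1) u = - u"
  by transfer simp

lemma fmult_sum: "fmult a (\<Sum>i\<in>I. u i) = (\<Sum>i\<in>I. fmult a (u i))"
  by (induction I rule: infinite_finite_induct) (auto simp: fmult_add)

lemma in_Lp_add: "1 \<le> p \<Longrightarrow> in_Lp p u \<Longrightarrow> in_Lp p v \<Longrightarrow> in_Lp p (u + v)"
  by transfer (rule Lp_add(1))

lemma Lp_norm_add: "1 \<le> p \<Longrightarrow> in_Lp p u \<Longrightarrow> in_Lp p v \<Longrightarrow> Lp_norm p (u + v) \<le> Lp_norm p u + Lp_norm p v"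
  by transfer (rule Lp_add(2))

lemma Lp_norm_nonneg [simp]: "0 \<le> Lp_norm p u"
  by transfer (rule Lp_norm_fun_nonneg)

lemma in_Lp_zero [simp]: "in_Lp p 0"
  by transfer (simp add: in_Lp_fun_def)

lemma Lp_norm_zero [simp]: "Lp_norm p 0 = 0"
  by transfer (simp add: Lp_norm_fun_def)

lemma Lp_norm_eq_0: "0 < p \<Longrightarrow> in_Lp p u \<Longrightarrow> Lp_norm p u = 0 \<Longrightarrow> u = 0"
  by transfer (rule Lp_norm_fun_eq_0)

lemma fmult_bounded:
  assumes "p > 0" "in_Lp p u" "a \<in> borel_measurable lebesgue" "C \<ge> 0" "\<And>x. norm (a x) \<le> C"
  shows "in_Lp p (fmult a u)" "Lp_norm p (fmult a u) \<le> C * Lp_norm p u"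
proof -
  show "in_Lp p (fmult a u)"
    using assms
  proof transfer
    fix p C and u a :: "real ^ 'a \<Rightarrow> complex"
    assume *: "0 < p" "in_Lp_fun p u" "a \<in> borel_measurable lebesgue" "0 \<le> C" "\<And>x. norm (a x) \<le> C"
    show "in_Lp_fun p (\<lambda>x. a x * u x)"
      by (rule Lp_dominated(1)[OF *(1,2) _ *(4)])
        (use * in \<open>auto simp: norm_mult in_Lp_fun_def intro!: AE_I2 mult_right_mono\<close>)
  qed
  show "Lp_norm p (fmult a u) \<le> C * Lp_norm p u"
    using assms
  proof transfer
    fix p C and u a :: "real ^ 'a \<Rightarrow> complex"
    assume *: "0 < p" "in_Lp_fun p u" "a \<in> borel_measurable lebesgue" "0 \<le> C" "\<And>x. norm (a x) \<le> C"
    show "Lp_norm_fun p (\<lambda>x. a x * u x) \<le> C * Lp_norm_fun p u"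
      by (rule Lp_dominated(2)[OF *(1,2) _ *(4)])
        (use * in \<open>auto simp: norm_mult in_Lp_fun_def intro!: AE_I2 mult_right_mono\<close>)
  qed
qed

lemma in_Lp_scale: "p > 0 \<Longrightarrow> in_Lp p u \<Longrightarrow> in_Lp p (fmult (\<lambda>x. c) u)"
  by (rule fmult_bounded(1)[where C = "norm c"]) auto

lemma Lp_norm_scale:
  assumes "p > 0"
  shows "Lp_norm p (fmult (\<lambda>x. c) u) = norm c * Lp_norm p u"
  using assms
proof transfer
  fix p c and u :: "real ^ 'a \<Rightarrow> complex"
  assume "p > (0 :: real)"
  then show "Lp_norm_fun p (\<lambda>x. c * u x) = norm c * Lp_norm_fun p u"
    by (simp add: Lp_norm_fun_def norm_mult powr_mult powr_powr)
qed

lemma in_Lp_uminus: "p > 0 \<Longrightarrow> in_Lp p u \<Longrightarrow> in_Lp p (- u)"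
  using in_Lp_scale[of p u "- 1"] by (simp add: fmult_minus_one)

lemma Lp_norm_uminus: "p > 0 \<Longrightarrow> Lp_norm p (- u) = Lp_norm p u"
  using Lp_norm_scale[of p "- 1" u] by (simp add: fmult_minus_one)

lemma in_Lp_diff: "1 \<le> p \<Longrightarrow> in_Lp p u \<Longrightarrow> in_Lp p v \<Longrightarrow> in_Lp p (u - v)"
  using in_Lp_add[of p u "- v"] in_Lp_uminus[of p v] by simp

lemma in_Lp_sum: "1 \<le> p \<Longrightarrow> (\<And>i. i \<in> I \<Longrightarrow> in_Lp p (u i)) \<Longrightarrow> in_Lp p (\<Sum>i\<in>I. u i)"
  by (induction I rule: infinite_finite_induct) (auto intro: in_Lp_add)

lemma Lp_norm_sum:
  "1 \<le> p \<Longrightarrow> (\<And>i. i \<in> I \<Longrightarrow> in_Lp p (u i)) \<Longrightarrow> Lp_norm p (\<Sum>i\<in>I. u i) \<le> (\<Sum>i\<in>I. Lp_norm p (u i))"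
proof (induction I rule: infinite_finite_induct)
  case (insert i I)
  then show ?case using Lp_norm_add[of p "u i" "\<Sum>i\<in>I. u i"] in_Lp_sum[of p I u] by fastforce
qed auto

lemma Lp_complete:
  fixes F :: "nat \<Rightarrow> 'n::finite ae_fun"
  assumes p: "p \<ge> 1" and F: "\<And>n. in_Lp p (F n)"
    and Cau: "\<And>e. e > 0 \<Longrightarrow> \<exists>M. \<forall>m\<ge>M. \<forall>n\<ge>M. Lp_norm p (F m - F n) < e"
  shows "\<exists>f. in_Lp p f \<and> (\<lambda>n. Lp_norm p (F n - f)) \<longlonglongrightarrow> 0"
proof -
  define G where "G n = rep_ae_fun (F n)" for n
  have FG: "F n = abs_ae_fun (G n)" for n
    unfolding G_def by (rule Quotient3_abs_rep[OF Quotient3_ae_fun, symmetric])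
  have 1: "in_Lp_fun p (G n)" for n using F[of n] by (simp add: FG in_Lp.abs_eq)
  have 2: "Lp_norm p (F m - F n) = Lp_norm_fun p (\<lambda>x. G m x - G n x)" for m n
    by (simp add: FG minus_ae_fun.abs_eq Lp_norm.abs_eq)
  have "\<exists>f. in_Lp_fun p f \<and> (\<lambda>n. Lp_norm_fun p (\<lambda>x. G n x - f x)) \<longlonglongrightarrow> 0"
    by (rule Lp_complete_fun[OF p 1]) (use Cau in \<open>simp add: 2\<close>)
  then obtain f where f: "in_Lp_fun p f" "(\<lambda>n. Lp_norm_fun p (\<lambda>x. G n x - f x)) \<longlonglongrightarrow> 0" by blast
  have "in_Lp p (abs_ae_fun f)" using f(1) by (simp add: in_Lp.abs_eq)
  moreover have "Lp_norm p (F n - abs_ae_fun f) = Lp_norm_fun p (\<lambda>x. G n x - f x)" for n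
    by (simp add: FG minus_ae_fun.abs_eq Lp_norm.abs_eq)
  ultimately show ?thesis using f(2) by (intro exI[of _ "abs_ae_fun f"]) simp
qed

lemma Lp_truncate:
  assumes "p \<ge> 1" "in_Lp p u" "e > 0"
  shows "\<exists>g. cutoff_fun g \<and> Lp_norm p (u - abs_ae_fun g) < e"
proof -
  obtain f where u: "u = abs_ae_fun f" by (rule ae_fun_cases)
  have "in_Lp_fun p f" using assms(2) by (simp add: u in_Lp.abs_eq)
  from Lp_truncation[OF assms(1) this assms(3)] obtain g where g: "cutoff_fun g"
    "Lp_norm_fun p (\<lambda>x. f x - g x) < e" by blast
  moreover have "Lp_norm p (u - abs_ae_fun g) = Lp_norm_fun p (\<lambda>x. f x - g x)"
    by (simp add: u minus_ae_fun.abs_eq Lp_norm.abs_eq)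
  ultimately show ?thesis by auto
qed

lemma in_Lp_cutoff: "p > 0 \<Longrightarrow> cutoff_fun g \<Longrightarrow> in_Lp p (abs_ae_fun g)"
  by (simp add: in_Lp.abs_eq cutoff_fun_Lp)

lift_definition loc_int :: "'n::finite ae_fun \<Rightarrow> bool" is locally_integrable
  by (rule locally_integrable_cong_AE)

text \<open>The bilinear pairing \<open>\<integral> u h\<close>, where \<open>h\<close> is a function and not a class of functions.\<close>

lift_definition pairing :: "'n::finite ae_fun \<Rightarrow> (real ^ 'n \<Rightarrow> complex) \<Rightarrow> complex"
  is "\<lambda>f h. \<integral>x. f x * h x \<partial>lebesgue"
proof -
  fix f g :: "real ^ 'n \<Rightarrow> complex"
  assume "AE x in lebesgue. f x = g x"
  then have "AE x in lebesgue. f x * h x = g x * h x" for h by eventually_elim simp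
  then show "(\<lambda>h. \<integral>x. f x * h x \<partial>lebesgue) = (\<lambda>h. \<integral>x. g x * h x \<partial>lebesgue)"
    by (intro ext lebesgue_integral_cong_AE(2))
qed

lemma weak_deriv_pairing:
  "weak_deriv \<alpha> u v \<longleftrightarrow> loc_int u \<and> loc_int v \<and>
     (\<forall>\<phi>. test_function \<phi> \<longrightarrow> pairing u (mdiff \<alpha> \<phi>) = (- 1) ^ mdeg \<alpha> * pairing v \<phi>)"
  by transfer (simp add: weak_deriv_fun_def)

lemma pairing_fmult: "pairing (fmult a u) h = pairing u (\<lambda>x. a x * h x)"
  by transfer (simp add: mult_ac)

lemma locally_integrable_mult_cutoff:
  fixes f :: "real ^ 'n::finite \<Rightarrow> complex"
  assumes f: "locally_integrable f" and h: "cutoff_fun h"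
  shows "integrable lebesgue (\<lambda>x. f x * h x)"
proof -
  obtain C R where CR: "C \<ge> 0" "\<And>x. norm (h x) \<le> C * indicator (cball 0 R) x"
    and m: "h \<in> borel_measurable lebesgue"
    using h unfolding cutoff_fun_def by blast
  have i: "integrable lebesgue (\<lambda>x. indicator (cball 0 R) x *\<^sub>R f x)"
    using f unfolding locally_integrable_def set_integrable_def by auto
  have eq: "f x * h x = (indicator (cball 0 R) x *\<^sub>R f x) * h x" for x
    using CR(2)[of x] by (cases "norm x \<le> R") (auto simp: indicator_def)
  have "(\<lambda>x. (indicator (cball 0 R) x *\<^sub>R f x) * h x) \<in> borel_measurable lebesgue"
    using m borel_measurable_integrable[OF i] by (intro borel_measurable_times)
  also have "(\<lambda>x. (indicator (cball 0 R) x *\<^sub>R f x) * h x) = (\<lambda>x. f x * h x)"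
    by (rule ext) (rule eq[symmetric])
  finally have "(\<lambda>x. f x * h x) \<in> borel_measurable lebesgue" .
  then show ?thesis
  proof (rule Bochner_Integration.integrable_bound[OF integrable_mult_right[OF integrable_norm[OF i], of C]], intro AE_I2)
    fix x
    show "norm (f x * h x) \<le> norm (C * norm (indicator (cball 0 R) x *\<^sub>R f x))"
      using CR(1) mult_left_mono[OF CR(2)[of x], of "norm (f x)"]
      by (cases "norm x \<le> R") (auto simp: indicator_def norm_mult abs_mult mult_ac)
  qed
qed

lemma pairing_add_left:
  "loc_int u \<Longrightarrow> loc_int v \<Longrightarrow> cutoff_fun h \<Longrightarrow> pairing (u + v) h = pairing u h + pairing v h"
  by transfer (simp add: locally_integrable_mult_cutoff distrib_right)

lemma pairing_diff_left:
  "loc_int u \<Longrightarrow> loc_int v \<Longrightarrow> cutoff_fun h \<Longrightarrow> pairing (u - v) h = pairing u h - pairing v h"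
  by transfer (simp add: locally_integrable_mult_cutoff left_diff_distrib)

lemma pairing_add_right:
  "loc_int u \<Longrightarrow> cutoff_fun h \<Longrightarrow> cutoff_fun k \<Longrightarrow> pairing u (\<lambda>x. h x + k x) = pairing u h + pairing u k"
  by transfer (simp add: locally_integrable_mult_cutoff distrib_left)

lemma pairing_scale: "pairing (fmult (\<lambda>x. c) u) h = c * pairing u h"
  by transfer (simp add: mult.assoc)

lemma loc_int_add: "loc_int u \<Longrightarrow> loc_int v \<Longrightarrow> loc_int (u + v)"
proof transfer
  fix u v :: "real ^ 'a \<Rightarrow> complex"
  assume "locally_integrable u" "locally_integrable v"
  then show "locally_integrable (\<lambda>x. u x + v x)"
    unfolding locally_integrable_def by (blast intro: set_integral_add(1))
qed

lemma loc_int_fmult_continuous: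
  assumes "loc_int u" "continuous_on UNIV w"
  shows "loc_int (fmult w u)"
proof -
  obtain f where f: "u = abs_ae_fun f" by (rule ae_fun_cases)
  have u: "locally_integrable f" using assms(1) by (simp add: f loc_int.abs_eq)
  note w = assms(2)
  have "set_integrable lebesgue K (\<lambda>x. w x * f x)" if K: "compact K" for K
  proof -
    have "cutoff_fun (indicator K :: _ \<Rightarrow> complex)"
    proof -
      obtain R where "\<forall>x\<in>K. norm x \<le> R" using compact_imp_bounded[OF K] unfolding bounded_iff by blast
      then have "K \<subseteq> cball 0 R" by auto
      moreover have "(indicator K :: _ \<Rightarrow> complex) \<in> borel_measurable lebesgue"
        using lmeasurable_compact[OF K] by (intro borel_measurable_indicator) (auto dest: fmeasurableD)
      ultimately show ?thesis unfolding cutoff_fun_def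
        by (intro conjI exI[of _ 1] exI[of _ R]) (auto simp: indicator_def)
    qed
    from locally_integrable_mult_cutoff[OF u cutoff_fun_mult_continuous[OF this w]]
    have "integrable lebesgue (\<lambda>x. f x * (w x * indicator K x))" .
    moreover have "(\<lambda>x. indicator K x *\<^sub>R (w x * f x)) = (\<lambda>x. f x * (w x * indicator K x))"
      by (auto simp: indicator_def)
    ultimately show ?thesis unfolding set_integrable_def by simp
  qed
  then have "locally_integrable (\<lambda>x. w x * f x)" unfolding locally_integrable_def by blast
  then show ?thesis by (simp add: f fmult.abs_eq loc_int.abs_eq)
qed

lemma loc_int_scale: "loc_int u \<Longrightarrow> loc_int (fmult (\<lambda>x. c) u)"
  by (rule loc_int_fmult_continuous) auto

lemma loc_int_zero [simp]: "loc_int 0"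
  by transfer (simp add: locally_integrable_def set_integrable_def)

lemma loc_int_uminus: "loc_int u \<Longrightarrow> loc_int (- u)"
  using loc_int_scale[of u "- 1"] by (simp add: fmult_minus_one)

lemma loc_int_diff: "loc_int u \<Longrightarrow> loc_int v \<Longrightarrow> loc_int (u - v)"
  using loc_int_add[OF _ loc_int_uminus, of u v] by simp

lemma in_Lp_loc_int: "1 \<le> p \<Longrightarrow> in_Lp p u \<Longrightarrow> loc_int u"
  by transfer (rule in_Lp_fun_locally_integrable)

lemma pairing_Lp_bound:
  fixes h :: "real ^ 'n::finite \<Rightarrow> complex"
  assumes "1 \<le> p" "cutoff_fun h"
  shows "\<exists>C\<ge>0. \<forall>u. in_Lp p u \<longrightarrow> norm (pairing u h) \<le> C * Lp_norm p u"
proof -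
  obtain C R where CR: "C \<ge> 0" "\<And>x. norm (h x) \<le> C * indicator (cball 0 R) x"
    and m: "h \<in> borel_measurable lebesgue"
    using assms(2) unfolding cutoff_fun_def by blast
  let ?D = "C * (measure lebesgue (cball (0 :: real ^ 'n) R) + 1)"
  have "norm (pairing u h) \<le> ?D * Lp_norm p u" if "in_Lp p u" for u
  proof -
    obtain f where f: "u = abs_ae_fun f" by (rule ae_fun_cases)
    have "norm (\<integral>x. f x * h x \<partial>lebesgue) \<le> ?D * Lp_norm_fun p f"
      using that by (intro Lp_local_bound(2)[OF assms(1) _ m _ CR]) (auto simp: f in_Lp.abs_eq intro: lmeasurable_compact)
    then show ?thesis by (simp add: f pairing.abs_eq Lp_norm.abs_eq)
  qed
  then show ?thesis using CR(1) by (intro exI[of _ ?D]) auto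
qed

section \<open>Bump functions\<close>

fun bump_poly :: "nat \<Rightarrow> real poly" where
  "bump_poly 0 = 1"
| "bump_poly (Suc k) = [:0, 0, 1:] * (bump_poly k - pderiv (bump_poly k))"

text \<open>The \<open>k\<close>-th derivative of the function which is \<open>exp (- 1 / x)\<close> for \<open>x > 0\<close> and vanishes
  elsewhere.\<close>

definition bump :: "nat \<Rightarrow> real \<Rightarrow> real" where
  "bump k x = (if x > 0 then poly (bump_poly k) (1 / x) * exp (- (1 / x)) else 0)"

lemma poly_times_exp_minus_tendsto_0:
  fixes q :: "real poly"
  shows "((\<lambda>y. poly q y * exp (- y)) \<longlongrightarrow> 0) at_top"
proof -
  have "((\<lambda>y. \<Sum>i\<le>degree q. coeff q i * (y ^ i / exp y)) \<longlongrightarrow> (\<Sum>i\<le>degree q. coeff q i * 0)) at_top"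
    by (intro tendsto_sum tendsto_mult tendsto_const tendsto_power_div_exp_0)
  moreover have "(\<lambda>y. poly q y * exp (- y)) = (\<lambda>y. \<Sum>i\<le>degree q. coeff q i * (y ^ i / exp y))"
    by (simp add: poly_altdef sum_distrib_right exp_minus divide_inverse mult.assoc)
  ultimately show ?thesis by simp
qed

lemma bump_has_derivative: "(bump k has_real_derivative bump (Suc k) x) (at x)"
proof -
  consider "x > 0" | "x < 0" | "x = 0" by linarith
  then show ?thesis
  proof cases
    case 1
    have "((\<lambda>x. poly (bump_poly k) (1 / x) * exp (- (1 / x))) has_real_derivative bump (Suc k) x) (at x)"
      using 1 by (auto intro!: derivative_eq_intros simp: bump_def power2_eq_square field_simps)
    then show ?thesis
      by (rule has_field_derivative_transform_within_open[of _ _ _ "{0<..}"]) (use 1 in \<open>auto simp: bump_def\<close>)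
  next
    case 2
    have "((\<lambda>x. 0) has_real_derivative bump (Suc k) x) (at x)"
      using 2 by (simp add: bump_def)
    then show ?thesis
      by (rule has_field_derivative_transform_within_open[of _ _ _ "{..<0}"]) (use 2 in \<open>auto simp: bump_def\<close>)
  next
    case 3
    have r: "((\<lambda>h. bump k h / h) \<longlongrightarrow> 0) (at_right 0)"
    proof -
      have "((\<lambda>y. poly ([:0, 1:] * bump_poly k) y * exp (- y)) \<longlongrightarrow> 0) at_top"
        by (rule poly_times_exp_minus_tendsto_0)
      then have "((\<lambda>h. poly ([:0, 1:] * bump_poly k) (inverse h) * exp (- inverse h)) \<longlongrightarrow> 0) (at_right 0)"
        by (rule filterlim_compose[OF _ filterlim_inverse_at_top_right])
      moreover have "\<forall>\<^sub>F h in at_right (0::real). poly ([:0, 1:] * bump_poly k) (inverse h) * exp (- inverse h) = bump k h / h"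
        by (rule eventually_at_right_less[THEN eventually_mono]) (simp add: bump_def divide_simps)
      ultimately show ?thesis by (rule Lim_transform_eventually)
    qed
    have l: "((\<lambda>h. bump k h / h) \<longlongrightarrow> 0) (at_left 0)"
    proof (rule tendsto_eventually)
      have "\<forall>\<^sub>F h in at_left (0::real). h < 0" by (simp add: eventually_at_filter)
      then show "\<forall>\<^sub>F h in at_left (0::real). bump k h / h = 0"
        by eventually_elim (simp add: bump_def)
    qed
    have "((\<lambda>h. bump k h / h) \<longlongrightarrow> 0) (at 0)"
      using l r by (simp add: filterlim_split_at)
    then show ?thesis
      unfolding DERIV_def 3 by (simp add: bump_def)
  qed
qed

lemma smooth_compose_coordinate:
  fixes G :: "nat \<Rightarrow> real \<Rightarrow> real"
  assumes G: "\<And>k x. (G k has_real_derivative G (Suc k) x) (at x)"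
  shows "smooth (\<lambda>x :: real ^ 'n::finite. complex_of_real (G k (c * x $ i + d)))"
proof -
  have "C_class l (\<lambda>x :: real ^ 'n. complex_of_real (G k (c * x $ i + d)))" for l
  proof (induction l arbitrary: k)
    case 0
    have "continuous_on UNIV (G k)"
      using G by (meson DERIV_isCont continuous_at_imp_continuous_on)
    then show ?case
      by (auto intro!: continuous_intros continuous_on_compose2[of UNIV "G k"])
  next
    case (Suc l)
    show ?case
    proof (rule C_class_SucI)
      have "continuous_on UNIV (G k)"
        using G by (meson DERIV_isCont continuous_at_imp_continuous_on)
      then show "continuous_on UNIV (\<lambda>x :: real ^ 'n. complex_of_real (G k (c * x $ i + d)))"
        by (auto intro!: continuous_intros continuous_on_compose2[of UNIV "G k"])
    next
      fix j and x :: "real ^ 'n"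
      let ?e = "(axis j 1 :: real ^ 'n) $ i"
      have "((\<lambda>h. G k (c * (x + h *\<^sub>R axis j 1) $ i + d)) has_real_derivative
          G (Suc k) (c * x $ i + d) * (c * ?e)) (at 0)"
      proof (rule DERIV_chain2[where f = "G k" and g = "\<lambda>h. c * (x + h *\<^sub>R axis j 1) $ i + d"])
        show "(G k has_real_derivative G (Suc k) (c * x $ i + d)) (at (c * (x + 0 *\<^sub>R axis j 1) $ i + d))"
          using G by simp
        show "((\<lambda>h. c * (x + h *\<^sub>R axis j 1) $ i + d) has_real_derivative c * ?e) (at 0)"
          by (auto intro!: derivative_eq_intros)
      qed
      then show "((\<lambda>h. complex_of_real (G k (c * (x + h *\<^sub>R axis j 1) $ i + d))) has_vector_derivative
          complex_of_real (c * ?e) * complex_of_real (G (Suc k) (c * x $ i + d))) (at 0)"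
        using bounded_linear.has_vector_derivative[OF bounded_linear_of_real[where 'a = complex],
            of "\<lambda>h. G k (c * (x + h *\<^sub>R axis j 1) $ i + d)" "G (Suc k) (c * x $ i + d) * (c * ?e)" "at 0"]
        by (simp add: has_real_derivative_iff_has_vector_derivative mult_ac)
    next
      show "C_class l (\<lambda>x. complex_of_real (c * (axis j 1 :: real ^ 'n) $ i) * complex_of_real (G (Suc k) (c * x $ i + d)))" for j
        by (intro C_class_mult C_class_const Suc.IH)
    qed
  qed
  then show ?thesis by (simp add: smooth_def)
qed

lemma test_function_cutoff:
  fixes \<phi> :: "real ^ 'n::finite \<Rightarrow> complex"
  assumes "test_function \<phi>"
  shows "cutoff_fun \<phi>"
proof -
  obtain K where K: "compact K" "\<And>x. x \<notin> K \<Longrightarrow> \<phi> x = 0" and s: "smooth \<phi>"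
    using assms unfolding test_function_alt by blast
  obtain R where "\<forall>x\<in>K. norm x \<le> R" using compact_imp_bounded[OF K(1)] unfolding bounded_iff by blast
  then have R: "K \<subseteq> cball 0 R" by auto
  have c: "continuous_on UNIV \<phi>" using s by (rule smooth_continuous)
  have "cutoff_fun (indicator (cball 0 R) :: real ^ 'n \<Rightarrow> complex)"
    unfolding cutoff_fun_def
    by (intro conjI exI[of _ 1] exI[of _ R] borel_measurable_indicator) (auto simp: indicator_def)
  from cutoff_fun_mult_continuous[OF this c]
  have "cutoff_fun (\<lambda>x. \<phi> x * indicator (cball 0 R) x)" .
  moreover have "(\<lambda>x. \<phi> x * indicator (cball 0 R) x) = \<phi>"
  proof
    fix x
    show "\<phi> x * indicator (cball 0 R) x = \<phi> x"
      using K(2)[of x] R by (cases "x \<in> K") auto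
  qed
  ultimately show ?thesis by simp
qed

text \<open>A test function of the shape \<open>\<Prod>i. f (k (x i - a i)) f (k (b i - x i))\<close> with
  \<open>f x = exp (- 1 / x)\<close> for \<open>x > 0\<close> takes values in \<open>[0, 1]\<close> and vanishes outside the open box
  \<open>(a, b)\<close>; as \<open>k \<rightarrow> \<infinity>\<close> these functions increase to the indicator function of the box.\<close>

definition box_test :: "nat \<Rightarrow> real ^ 'n::finite \<Rightarrow> real ^ 'n \<Rightarrow> real ^ 'n \<Rightarrow> complex" where
  "box_test k a b x = (\<Prod>i\<in>UNIV. complex_of_real (bump 0 (real k * x $ i + (- (real k * a $ i)))) *
     complex_of_real (bump 0 (- real k * x $ i + real k * b $ i)))"

lemma bump_0_bounds: "0 \<le> bump 0 x" "bump 0 x \<le> 1"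
  by (auto simp: bump_def)

lemma box_test_outside:
  assumes "x \<notin> box a b"
  shows "box_test k a b x = 0"
proof -
  obtain i where "x $ i \<le> a $ i \<or> b $ i \<le> x $ i"
    using assms by (auto simp: mem_box_cart not_less)
  then have "real k * x $ i + (- (real k * a $ i)) \<le> 0 \<or> - real k * x $ i + real k * b $ i \<le> 0"
    by (auto simp: mult_left_mono)
  then have "bump 0 (real k * x $ i + (- (real k * a $ i))) = 0 \<or> bump 0 (- real k * x $ i + real k * b $ i) = 0"
    by (auto simp: bump_def)
  then show ?thesis unfolding box_test_def by (intro prod_zero bexI[of _ i]) auto
qed

lemma norm_box_test_le: "norm (box_test k a b x) \<le> indicator (box a b) x"
proof (cases "x \<in> box a b")
  case True
  have "norm (box_test k a b x) \<le> 1"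
    unfolding box_test_def prod_norm[symmetric] norm_mult norm_of_real
    by (rule prod_le_1) (auto intro!: mult_le_one simp: bump_0_bounds)
  then show ?thesis using True by simp
qed (simp add: box_test_outside)

lemma test_function_box_test: "test_function (box_test k a b)"
proof -
  have "smooth (box_test k a b)"
    unfolding box_test_def
    by (intro smooth_prod smooth_mult smooth_compose_coordinate bump_has_derivative) auto
  moreover have "\<forall>x. x \<notin> cbox a b \<longrightarrow> box_test k a b x = 0"
    using box_test_outside box_subset_cbox[of a b] by (metis subsetD)
  ultimately show ?thesis unfolding test_function_alt by (blast intro: compact_cbox)
qed

lemma bump_0_tendsto_1:
  assumes "y > 0"
  shows "(\<lambda>k. bump 0 (real k * y)) \<longlonglongrightarrow> 1"
proof -
  have "(\<lambda>k. exp (- ((1 / y) * (1 / real k)))) \<longlonglongrightarrow> exp (- ((1 / y) * 0))"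
    by (intro tendsto_intros lim_1_over_n)
  then have lim: "(\<lambda>k. exp (- (1 / (real k * y)))) \<longlonglongrightarrow> 1" by (simp add: mult.commute)
  have "\<forall>\<^sub>F k in sequentially. exp (- (1 / (real k * y))) = bump 0 (real k * y)"
    using assms by (auto simp: eventually_sequentially bump_def intro!: exI[of _ 1])
  then show ?thesis by (rule Lim_transform_eventually[OF lim])
qed

lemma box_test_tendsto: "(\<lambda>k. box_test k a b x) \<longlonglongrightarrow> indicator (box a b) x"
proof (cases "x \<in> box a b")
  case True
  have "(\<lambda>k. \<Prod>i\<in>UNIV. complex_of_real (bump 0 (real k * (x $ i - a $ i))) *
      complex_of_real (bump 0 (real k * (b $ i - x $ i)))) \<longlonglongrightarrow> (\<Prod>i\<in>(UNIV :: 'a set). complex_of_real 1 * complex_of_real 1)"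
    using True by (intro tendsto_prod tendsto_mult tendsto_of_real bump_0_tendsto_1) (auto simp: mem_box_cart)
  then show ?thesis using True by (simp add: box_test_def algebra_simps)
qed (simp add: box_test_outside)

section \<open>Weak derivatives\<close>

text \<open>Testing against the box functions shows that the integral of \<open>f\<close> over every box vanishes;
  boxes generate the Borel sets and form an intersection-stable family.\<close>

lemma sigma_finite_lebesgue: "sigma_finite_measure (lebesgue :: (real ^ 'n::finite) measure)"
proof
  obtain A :: "(real ^ 'n) set set" where A: "countable A" "A \<subseteq> sets lborel" "\<Union>A = space lborel"
    "\<forall>a\<in>A. emeasure lborel a \<noteq> \<infinity>"
    using lborel.sigma_finite_countable by blast
  have "A \<subseteq> sets lebesgue" using A(2) by (auto intro: sets_completionI_sets)
  moreover have "\<forall>a\<in>A. emeasure lebesgue a \<noteq> \<infinity>" using A(2,4) by (auto simp: subset_eq)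
  ultimately show "\<exists>A. countable A \<and> A \<subseteq> sets lebesgue \<and> \<Union>A = space (lebesgue :: (real ^ 'n) measure) \<and>
      (\<forall>a\<in>A. emeasure lebesgue a \<noteq> \<infinity>)"
    using A(1,3) by (intro exI[of _ A]) simp
qed

lemma fundamental_lemma_fun:
  fixes f :: "real ^ 'n::finite \<Rightarrow> complex"
  assumes f: "locally_integrable f" and z: "\<And>\<phi>. test_function \<phi> \<Longrightarrow> (\<integral>x. f x * \<phi> x \<partial>lebesgue) = 0"
  shows "AE x in lebesgue. f x = 0"
proof -
  have int_box: "integrable lebesgue (\<lambda>x. indicator (box a b) x *\<^sub>R f x)" for a b :: "real ^ 'n"
  proof -
    have "set_integrable lebesgue (cbox a b) f"
      using f compact_cbox unfolding locally_integrable_def by blast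
    then have "set_integrable lebesgue (box a b) f"
      by (rule set_integrable_subset) (use box_subset_cbox in auto)
    then show ?thesis unfolding set_integrable_def .
  qed
  have box0: "(\<integral>x. indicator (box a b) x *\<^sub>R f x \<partial>lebesgue) = 0" for a b :: "real ^ 'n"
  proof -
    have ib: "integrable lebesgue (\<lambda>x. indicator (box a b) x *\<^sub>R f x)"
      by (rule int_box)
    have "(\<lambda>k. \<integral>x. f x * box_test k a b x \<partial>lebesgue) \<longlonglongrightarrow> (\<integral>x. f x * indicator (box a b) x \<partial>lebesgue)"
    proof (rule integral_dominated_convergence[where w = "\<lambda>x. norm (indicator (box a b) x *\<^sub>R f x)"])
      have "(\<lambda>x. f x * indicator (box a b) x) = (\<lambda>x. indicator (box a b) x *\<^sub>R f x)"
        by (auto simp: indicator_def)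
      then show "(\<lambda>x. f x * indicator (box a b) x) \<in> borel_measurable lebesgue"
        using borel_measurable_integrable[OF ib] by simp
      show "(\<lambda>x. f x * box_test k a b x) \<in> borel_measurable lebesgue" for k
        by (rule borel_measurable_integrable[OF locally_integrable_mult_cutoff[OF f]])
          (intro test_function_cutoff test_function_box_test)
      show "AE x in lebesgue. (\<lambda>k. f x * box_test k a b x) \<longlonglongrightarrow> f x * indicator (box a b) x"
        by (intro AE_I2 tendsto_mult tendsto_const box_test_tendsto)
      show "AE x in lebesgue. norm (f x * box_test k a b x) \<le> norm (indicator (box a b) x *\<^sub>R f x)" for k
        using mult_left_mono[OF norm_box_test_le[of k a b], of "norm (f _)"]
        by (intro AE_I2) (auto simp: norm_mult mult_ac)
    qed (use ib in \<open>intro integrable_norm\<close>)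
    then have "(\<integral>x. f x * indicator (box a b) x \<partial>lebesgue) = 0"
      using z[OF test_function_box_test] LIMSEQ_unique[OF _ tendsto_const[of 0]] by simp
    moreover have "(\<lambda>x. f x * indicator (box a b) x) = (\<lambda>x. indicator (box a b) x *\<^sub>R f x)"
      by (auto simp: indicator_def)
    ultimately show ?thesis by simp
  qed
  have loc: "AE x in lebesgue. indicator (box c d) x *\<^sub>R f x = 0" for c d :: "real ^ 'n"
  proof (rule sigma_finite_measure.density_zero[OF sigma_finite_lebesgue])
    let ?g = "\<lambda>x. indicator (box c d) x *\<^sub>R f x"
    show ig: "integrable lebesgue ?g"
      by (rule int_box)
    have total: "(\<integral>x. ?g x \<partial>lebesgue) = 0" by (rule box0)
    have borel: "B \<in> sets borel \<and> set_lebesgue_integral lebesgue B ?g = 0"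
      if B: "B \<in> sigma_sets UNIV (range (\<lambda>(a, b). box a b :: (real ^ 'n) set))" for B
      using _ _ B
    proof (rule sigma_sets_induct_disjoint)
      show "Int_stable (range (\<lambda>(a, b). box a b :: (real ^ 'n) set))"
      proof (rule Int_stableI)
        fix A B :: "(real ^ 'n) set"
        assume "A \<in> range (\<lambda>(a, b). box a b)" "B \<in> range (\<lambda>(a, b). box a b)"
        then obtain a b a' b' where AB: "A = box a b" "B = box a' b'" by auto
        have "\<exists>s t. A \<inter> B = box s t" unfolding AB box_Int_box by blast
        then show "A \<inter> B \<in> range (\<lambda>(a, b). box a b)"
          by auto
      qed
      show "B \<in> sets borel \<and> set_lebesgue_integral lebesgue B ?g = 0"
        if B': "B \<in> range (\<lambda>(a, b). box a b :: (real ^ 'n) set)" for B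
      proof -
        obtain a b where B: "B = box a b" using B' by auto
        have "\<exists>a' b'. box a b \<inter> box c d = box a' b'" unfolding box_Int_box by blast
        then obtain a' b' where "box a b \<inter> box c d = box a' b'" by blast
        then have "(\<lambda>x. indicator B x *\<^sub>R ?g x) = (\<lambda>x. indicator (box a' b') x *\<^sub>R f x)"
          unfolding B by (auto simp: indicator_def fun_eq_iff)
        then show ?thesis using box0 B by (simp add: set_lebesgue_integral_def)
      qed
      show "{} \<in> sets borel \<and> set_lebesgue_integral lebesgue {} ?g = 0"
        by (simp add: set_lebesgue_integral_def)
      show "UNIV - B \<in> sets borel \<and> set_lebesgue_integral lebesgue (UNIV - B) ?g = 0"
        if B: "B \<in> sets borel \<and> set_lebesgue_integral lebesgue B ?g = 0" for B
      proof -
        have iB: "integrable lebesgue (\<lambda>x. indicator B x *\<^sub>R ?g x)"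
          using B by (intro integrable_mult_indicator[OF _ ig]) auto
        have "set_lebesgue_integral lebesgue (UNIV - B) ?g = (\<integral>x. ?g x - indicator B x *\<^sub>R ?g x \<partial>lebesgue)"
          unfolding set_lebesgue_integral_def by (rule Bochner_Integration.integral_cong) (auto simp: indicator_def)
        also have "\<dots> = 0"
          using ig iB total B by (simp add: set_lebesgue_integral_def)
        finally show ?thesis using B by auto
      qed
      show "(\<Union>i. A i) \<in> sets borel \<and> set_lebesgue_integral lebesgue (\<Union>i. A i) ?g = 0"
        if disj: "disjoint_family A" and A: "\<And>i. A i \<in> sets borel \<and> set_lebesgue_integral lebesgue (A i) ?g = 0" for A :: "nat \<Rightarrow> (real ^ 'n) set"
      proof -
        have "set_integrable lebesgue (\<Union>i. A i) ?g"
          unfolding set_integrable_def using A by (intro integrable_mult_indicator ig) auto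
        then have "set_lebesgue_integral lebesgue (\<Union>i. A i) ?g = (\<Sum>i. set_lebesgue_integral lebesgue (A i) ?g)"
          using A disj by (intro lebesgue_integral_countable_add) (auto simp: disjoint_family_on_def)
        then show ?thesis using A by auto
      qed
    qed auto
    fix B :: "(real ^ 'n) set" assume "B \<in> sets lebesgue"
    then obtain S N N' where S: "B = S \<union> N" "N \<subseteq> N'" "N' \<in> null_sets lborel" "S \<in> sets lborel"
      by (auto elim: sets_completionE)
    have "S \<in> sigma_sets UNIV (range (\<lambda>(a, b). box a b :: (real ^ 'n) set))"
      using S(4) by (simp add: borel_eq_box sets_measure_of_conv)
    then have S0: "set_lebesgue_integral lebesgue S ?g = 0" using borel by blast
    have "AE x in lebesgue. x \<notin> N'"
      using S(3) by (intro AE_not_in) (simp add: null_sets_completionI)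
    then have ae: "AE x in lebesgue. indicator B x *\<^sub>R ?g x = indicator S x *\<^sub>R ?g x"
      by eventually_elim (use S in \<open>auto simp: indicator_def\<close>)
    then show "set_lebesgue_integral lebesgue B ?g = 0"
      using S0 lebesgue_integral_cong_AE(2)[OF ae] unfolding set_lebesgue_integral_def by simp
  qed
  have "AE x in lebesgue. \<forall>k::nat. indicator (box (- (real k *\<^sub>R 1)) (real k *\<^sub>R 1)) x *\<^sub>R f x = 0"
    unfolding AE_all_countable using loc by blast
  then show ?thesis
  proof eventually_elim
    case (elim x)
    obtain k :: nat where k: "norm x < real k" using reals_Archimedean2 by blast
    have "x \<in> box (- (real k *\<^sub>R 1)) (real k *\<^sub>R 1)"
      unfolding mem_box_cart
    proof
      fix i
      have "\<bar>x $ i\<bar> < real k" using component_le_norm_cart[of x i] k by linarith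
      then show "(- (real k *\<^sub>R 1)) $ i < x $ i \<and> x $ i < (real k *\<^sub>R 1) $ i" by auto
    qed
    then show ?case using elim[rule_format, of k] by (simp add: indicator_def)
  qed
qed



lemma fundamental_lemma:
  assumes "loc_int u" "\<And>\<phi>. test_function \<phi> \<Longrightarrow> pairing u \<phi> = 0"
  shows "u = 0"
  using assms by transfer (rule fundamental_lemma_fun)

lemma weak_deriv_unique:
  assumes "weak_deriv \<alpha> u v" "weak_deriv \<alpha> u w"
  shows "v = w"
proof -
  have "v - w = 0"
  proof (rule fundamental_lemma)
    show "loc_int (v - w)" using assms by (auto simp: weak_deriv_pairing intro: loc_int_diff)
    fix \<phi> :: "real ^ 'a \<Rightarrow> complex" assume \<phi>: "test_function \<phi>"
    then have "(- 1) ^ mdeg \<alpha> * pairing v \<phi> = (- 1) ^ mdeg \<alpha> * pairing w \<phi>"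
      using assms by (auto simp: weak_deriv_pairing)
    then show "pairing (v - w) \<phi> = 0"
      using assms \<phi> test_function_cutoff[OF \<phi>] by (auto simp: weak_deriv_pairing pairing_diff_left)
  qed
  then show ?thesis by simp
qed

lemma weak_diff_eq: "weak_deriv \<alpha> u v \<Longrightarrow> weak_diff \<alpha> u = v"
  unfolding weak_diff_def by (rule the_equality) (auto intro: weak_deriv_unique)

lemma test_function_mdiff: "test_function \<phi> \<Longrightarrow> test_function (mdiff \<alpha> \<phi>)"
proof -
  assume "test_function \<phi>"
  then have "test_function (foldr pdiff is \<phi>)" for "is"
    by (induction "is") (auto intro: test_function_pdiff)
  then show ?thesis unfolding mdiff_def .
qed

lemma weak_deriv_zero_iff: "weak_deriv (\<lambda>_. 0) u v \<longleftrightarrow> loc_int u \<and> u = v"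
proof
  assume "loc_int u \<and> u = v"
  then show "weak_deriv (\<lambda>_. 0) u v" by (auto simp: weak_deriv_pairing mdiff_zero)
next
  assume *: "weak_deriv (\<lambda>_. 0) u v"
  then have "loc_int u" by (simp add: weak_deriv_pairing)
  then have "weak_deriv (\<lambda>_. 0) u u" by (simp add: weak_deriv_pairing mdiff_zero)
  then have "u = v" using * by (rule weak_deriv_unique)
  with * show "loc_int u \<and> u = v" by (simp add: weak_deriv_pairing)
qed

lemma weak_deriv_add:
  "weak_deriv \<alpha> u v \<Longrightarrow> weak_deriv \<alpha> u' v' \<Longrightarrow> weak_deriv \<alpha> (u + u') (v + v')"
  unfolding weak_deriv_pairing
  by (auto simp: pairing_add_left loc_int_add test_function_cutoff test_function_mdiff distrib_left)

lemma weak_deriv_scale: "weak_deriv \<alpha> u v \<Longrightarrow> weak_deriv \<alpha> (fmult (\<lambda>x. c) u) (fmult (\<lambda>x. c) v)"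
  unfolding weak_deriv_pairing by (auto simp: pairing_scale loc_int_scale)

definition weak_pdiff :: "'n \<Rightarrow> 'n::finite ae_fun \<Rightarrow> 'n ae_fun \<Rightarrow> bool" where
  "weak_pdiff i u v \<longleftrightarrow> loc_int u \<and> loc_int v \<and>
     (\<forall>\<phi>. test_function \<phi> \<longrightarrow> pairing u (pdiff i \<phi>) = - pairing v \<phi>)"

lemma weak_deriv_upd_mdiff:
  assumes "test_function \<phi>"
  shows "mdiff (\<alpha>(i := Suc (\<alpha> i))) \<phi> = mdiff \<alpha> (pdiff i \<phi>)"
  using assms by (intro mdiff_upd) (simp add: test_function_alt)

lemma weak_deriv_weak_pdiff:
  assumes "weak_deriv \<alpha> u v" "weak_pdiff i v w"
  shows "weak_deriv (\<alpha>(i := Suc (\<alpha> i))) u w"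
  using assms by (auto simp: weak_deriv_pairing weak_pdiff_def weak_deriv_upd_mdiff test_function_pdiff)

lemma weak_pdiff_weak_deriv:
  assumes "weak_deriv \<alpha> u v" "weak_deriv (\<alpha>(i := Suc (\<alpha> i))) u w"
  shows "weak_pdiff i v w"
  unfolding weak_pdiff_def
proof (intro conjI allI impI)
  fix \<phi> :: "real ^ 'a \<Rightarrow> complex" assume \<phi>: "test_function \<phi>"
  have "(- 1) ^ mdeg \<alpha> * pairing v (pdiff i \<phi>) = pairing u (mdiff \<alpha> (pdiff i \<phi>))"
    using assms(1) test_function_pdiff[OF \<phi>] by (simp add: weak_deriv_pairing)
  also have "\<dots> = (- 1) ^ Suc (mdeg \<alpha>) * pairing w \<phi>"
    using assms(2) \<phi> by (simp add: weak_deriv_pairing weak_deriv_upd_mdiff)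
  finally have "(- 1) ^ mdeg \<alpha> * pairing v (pdiff i \<phi>) = (- 1) ^ mdeg \<alpha> * (- pairing w \<phi>)" by simp
  then show "pairing v (pdiff i \<phi>) = - pairing w \<phi>" by (subst (asm) mult_cancel_left) auto
qed (use assms in \<open>auto simp: weak_deriv_pairing\<close>)

lemma weak_pdiff_add: "weak_pdiff i u v \<Longrightarrow> weak_pdiff i u' v' \<Longrightarrow> weak_pdiff i (u + u') (v + v')"
  unfolding weak_pdiff_def
  by (auto simp: pairing_add_left loc_int_add test_function_cutoff test_function_pdiff)

lemma weak_pdiff_zero: "weak_pdiff i 0 0"
proof -
  have "pairing 0 h = 0" for h :: "real ^ 'a \<Rightarrow> complex" by transfer simp
  then show ?thesis by (simp add: weak_pdiff_def)
qed

lemma weak_pdiff_scale: "weak_pdiff i u v \<Longrightarrow> weak_pdiff i (fmult (\<lambda>x. c) u) (fmult (\<lambda>x. c) v)"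
  unfolding weak_pdiff_def by (auto simp: pairing_scale loc_int_scale)

text \<open>Testing \<open>u\<close> against \<open>g \<phi>\<close> gives the product rule.\<close>

lemma weak_pdiff_mult:
  assumes u: "weak_pdiff i u v" and g: "smooth g"
  shows "weak_pdiff i (fmult g u) (fmult g v + fmult (pdiff i g) u)"
  unfolding weak_pdiff_def
proof (intro conjI allI impI)
  have uv: "loc_int u" "loc_int v" using u by (auto simp: weak_pdiff_def)
  note c = smooth_continuous[OF g] smooth_continuous[OF smooth_pdiff[OF g]]
  show "loc_int (fmult g u)" "loc_int (fmult g v + fmult (pdiff i g) u)"
    using uv c by (auto intro!: loc_int_add loc_int_fmult_continuous)
  fix \<phi> :: "real ^ 'a \<Rightarrow> complex" assume \<phi>: "test_function \<phi>"
  have s\<phi>: "smooth \<phi>" using \<phi> by (simp add: test_function_alt)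
  have t: "test_function (\<lambda>x. g x * \<phi> x)" by (rule test_function_mult[OF g \<phi>])
  have t1: "test_function (\<lambda>x. g x * pdiff i \<phi> x)" by (rule test_function_mult[OF g test_function_pdiff[OF \<phi>]])
  have t2: "test_function (\<lambda>x. pdiff i g x * \<phi> x)" by (rule test_function_mult[OF smooth_pdiff[OF g] \<phi>])
  have "pairing u (pdiff i (\<lambda>x. g x * \<phi> x)) = - pairing v (\<lambda>x. g x * \<phi> x)"
    using u t by (simp add: weak_pdiff_def)
  moreover have "pairing u (pdiff i (\<lambda>x. g x * \<phi> x)) = pairing u (\<lambda>x. g x * pdiff i \<phi> x) + pairing u (\<lambda>x. pdiff i g x * \<phi> x)"
    unfolding pdiff_mult[OF g s\<phi>]
    by (rule pairing_add_right[OF uv(1) test_function_cutoff[OF t1] test_function_cutoff[OF t2]])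
  moreover have "pairing (fmult g v + fmult (pdiff i g) u) \<phi> = pairing v (\<lambda>x. g x * \<phi> x) + pairing u (\<lambda>x. pdiff i g x * \<phi> x)"
    using uv c \<phi> by (simp add: pairing_add_left loc_int_fmult_continuous test_function_cutoff pairing_fmult)
  ultimately show "pairing (fmult g u) (pdiff i \<phi>) = - pairing (fmult g v + fmult (pdiff i g) u) \<phi>"
    by (simp add: pairing_fmult algebra_simps eq_neg_iff_add_eq_0)
qed

text \<open>Pairings with cut-off functions are continuous on \<open>L\<^sub>p\<close>, so weak derivatives pass to limits; this is
  what makes the Sobolev spaces complete.\<close>

lemma pairing_Lp_limit:
  assumes p: "1 \<le> p" and h: "cutoff_fun h" and F: "\<And>n. in_Lp p (F n)" "in_Lp p u"
    and lim: "(\<lambda>n. Lp_norm p (F n - u)) \<longlonglongrightarrow> 0"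
  shows "(\<lambda>n. pairing (F n) h) \<longlonglongrightarrow> pairing u h"
proof -
  obtain C where C: "\<And>u. in_Lp p u \<Longrightarrow> norm (pairing u h) \<le> C * Lp_norm p u"
    using pairing_Lp_bound[OF p h] by blast
  have le: "norm (pairing (F n) h - pairing u h) \<le> C * Lp_norm p (F n - u)" for n
    using C[OF in_Lp_diff[OF p F(1)[of n] F(2)]] in_Lp_loc_int[OF p F(1)[of n]] in_Lp_loc_int[OF p F(2)] h
    by (simp add: pairing_diff_left)
  have "(\<lambda>n. C * Lp_norm p (F n - u)) \<longlonglongrightarrow> C * 0"
    by (intro tendsto_mult tendsto_const lim)
  then have 0: "(\<lambda>n. C * Lp_norm p (F n - u)) \<longlonglongrightarrow> 0" by simp
  have "\<forall>\<^sub>F n in sequentially. norm (pairing (F n) h - pairing u h) \<le> C * Lp_norm p (F n - u)"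
    by (rule always_eventually) (use le in blast)
  then have "(\<lambda>n. pairing (F n) h - pairing u h) \<longlonglongrightarrow> 0"
    by (rule Lim_null_comparison[OF _ 0])
  then show ?thesis by (rule LIM_zero_cancel)
qed

lemma weak_deriv_Lp_limit:
  assumes p: "1 \<le> p" and F: "\<And>n. in_Lp p (F n)" "in_Lp p u" "(\<lambda>n. Lp_norm p (F n - u)) \<longlonglongrightarrow> 0"
    and G: "\<And>n. in_Lp p (G n)" "in_Lp p v" "(\<lambda>n. Lp_norm p (G n - v)) \<longlonglongrightarrow> 0"
    and w: "\<And>n. weak_deriv \<alpha> (F n) (G n)"
  shows "weak_deriv \<alpha> u v"
  unfolding weak_deriv_pairing
proof (intro conjI allI impI)
  fix \<phi> :: "real ^ 'a \<Rightarrow> complex" assume \<phi>: "test_function \<phi>"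
  have 1: "(\<lambda>n. pairing (F n) (mdiff \<alpha> \<phi>)) \<longlonglongrightarrow> pairing u (mdiff \<alpha> \<phi>)"
    using \<phi> by (intro pairing_Lp_limit[OF p _ F] test_function_cutoff test_function_mdiff)
  have 2: "(\<lambda>n. (- 1) ^ mdeg \<alpha> * pairing (G n) \<phi>) \<longlonglongrightarrow> (- 1) ^ mdeg \<alpha> * pairing v \<phi>"
    using \<phi> by (intro tendsto_mult tendsto_const pairing_Lp_limit[OF p _ G] test_function_cutoff)
  have 3: "pairing (F n) (mdiff \<alpha> \<phi>) = (- 1) ^ mdeg \<alpha> * pairing (G n) \<phi>" for n
    using w[of n] \<phi> by (simp add: weak_deriv_pairing)
  show "pairing u (mdiff \<alpha> \<phi>) = (- 1) ^ mdeg \<alpha> * pairing v \<phi>"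
    by (rule LIMSEQ_unique[OF 1[unfolded 3] 2])
qed (use F G in_Lp_loc_int[OF p] in auto)

section \<open>Finite-rank perturbations\<close>

(* The locale vector_space has its own *s. *)
no_notation vector_scalar_mult (infixl \<open>*s\<close> 70)

definition linear_on :: "('a::field \<Rightarrow> 'b::ab_group_add \<Rightarrow> 'b) \<Rightarrow> 'b set \<Rightarrow> ('b \<Rightarrow> 'b) \<Rightarrow> bool" where
  "linear_on s X T \<longleftrightarrow> module.subspace s X \<and> (\<forall>u\<in>X. \<forall>v\<in>X. T (u + v) = T u + T v) \<and>
     (\<forall>c. \<forall>u\<in>X. T (s c u) = s c (T u))"

context vector_space
begin

lemma linear_on_zero: "linear_on scale X T \<Longrightarrow> T 0 = 0"
  unfolding linear_on_def by (metis scale_zero_left subspace_0)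

lemma linear_on_diff: "linear_on scale X T \<Longrightarrow> u \<in> X \<Longrightarrow> v \<in> X \<Longrightarrow> T (u - v) = T u - T v"
proof -
  assume T: "linear_on scale X T" and uv: "u \<in> X" "v \<in> X"
  have X: "subspace X" using T by (simp add: linear_on_def)
  have "u - v \<in> X" using uv subspace_diff[OF X] by blast
  then have "T ((u - v) + v) = T (u - v) + T v"
    using T uv(2) unfolding linear_on_def by blast
  then show ?thesis by simp
qed

lemma linear_on_sum:
  assumes T: "linear_on scale X T" and B: "\<And>b. b \<in> B \<Longrightarrow> g b \<in> X"
  shows "T (\<Sum>b\<in>B. c b *s g b) = (\<Sum>b\<in>B. c b *s T (g b))"
  using B
proof (induction B rule: infinite_finite_induct)
  case (insert x F)
  have X: "subspace X" using T by (simp add: linear_on_def)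
  have "(\<Sum>b\<in>F. c b *s g b) \<in> X" "c x *s g x \<in> X"
    using insert.prems by (auto intro!: subspace_sum[OF X] subspace_scale[OF X])
  then have "T (c x *s g x + (\<Sum>b\<in>F. c b *s g b)) = T (c x *s g x) + T (\<Sum>b\<in>F. c b *s g b)"
    using T unfolding linear_on_def by blast
  moreover have "T (c x *s g x) = c x *s T (g x)"
    using T insert.prems unfolding linear_on_def by blast
  ultimately show ?case using insert by simp
qed (auto simp: linear_on_zero[OF T])

lemma linear_on_add:
  "linear_on scale X T \<Longrightarrow> linear_on scale X F \<Longrightarrow> linear_on scale X (\<lambda>u. T u + F u)"
  unfolding linear_on_def by (simp add: scale_right_distrib algebra_simps)

lemma linear_on_image_subspace: "linear_on scale X T \<Longrightarrow> subspace (T ` X)"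
proof (rule subspaceI)
  assume T: "linear_on scale X T"
  then have X: "subspace X" by (simp add: linear_on_def)
  show "0 \<in> T ` X" using linear_on_zero[OF T] subspace_0[OF X] by (metis imageI)
  show "x + y \<in> T ` X" if xy: "x \<in> T ` X" "y \<in> T ` X" for x y
  proof -
    obtain u v where "u \<in> X" "v \<in> X" "x = T u" "y = T v" using xy by blast
    then have "x + y = T (u + v)"
      using T unfolding linear_on_def by simp
    moreover have "u + v \<in> X" using \<open>u \<in> X\<close> \<open>v \<in> X\<close> by (rule subspace_add[OF X])
    ultimately show ?thesis by blast
  qed
  show "c *s x \<in> T ` X" if x: "x \<in> T ` X" for c x
  proof -
    obtain u where "u \<in> X" "x = T u" using x by blast
    then have "c *s x = T (c *s u)"
      using T unfolding linear_on_def by simp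
    moreover have "c *s u \<in> X" using \<open>u \<in> X\<close> by (rule subspace_scale[OF X])
    ultimately show ?thesis by blast
  qed
qed

lemma finite_basis_exists:
  assumes "finite W" "V \<subseteq> span W"
  shows "\<exists>B. finite B \<and> B \<subseteq> V \<and> independent B \<and> V \<subseteq> span B \<and> card B = dim V"
proof -
  obtain B where B: "B \<subseteq> V" "independent B" "V \<subseteq> span B" "card B = dim V"
    using basis_exists by blast
  have "finite B" using independent_span_bound[OF assms(1) B(2)] B(1) assms(2) by auto
  then show ?thesis using B by blast
qed

text \<open>Let \<open>T\<close> have index \<open>0\<close>, let \<open>C\<close> be a complement of its range, and let \<open>V\<close> be a finite-dimensional
  space containing \<open>C\<close> and the range of \<open>F\<close>. Both \<open>T\<close> and \<open>T + F\<close> map the preimage \<open>U\<close> of \<open>V\<close> under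
  \<open>T\<close> into \<open>V\<close>, and rank-nullity for \<open>T\<close> gives \<open>dim U = dim V\<close>. Therefore an injective \<open>T + F\<close> maps
  \<open>U\<close> onto \<open>V\<close>, and \<open>V\<close> contains what is needed to correct \<open>T x + c\<close> to a value of \<open>T + F\<close>.\<close>

lemma finite_rank_perturbation_surj:
  assumes T: "linear_on scale X T" and F: "linear_on scale X F"
    and K: "finite BK" "{u \<in> X. T u = 0} \<subseteq> span BK"
    and C: "subspace C" "finite BC" "C \<subseteq> span BC" "C \<inter> T ` X = {0}"
    and Y: "subspace Y" "Y = {f + g |f g. f \<in> T ` X \<and> g \<in> C}"
    and dim: "dim {u \<in> X. T u = 0} = dim C"
    and G: "finite G" "G \<subseteq> Y" "F ` X \<subseteq> span G"
    and inj: "\<And>u. u \<in> X \<Longrightarrow> T u + F u = 0 \<Longrightarrow> u = 0"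
    and y: "y \<in> Y"
  shows "\<exists>u\<in>X. T u + F u = y"
proof -
  let ?K = "{u \<in> X. T u = 0}" and ?S = "\<lambda>u. T u + F u"
  have X: "subspace X" using T by (simp add: linear_on_def)
  have S: "linear_on scale X ?S" by (rule linear_on_add[OF T F])
  have TX: "subspace (T ` X)" by (rule linear_on_image_subspace[OF T])
  define V where "V = {c + g |c g. c \<in> C \<and> g \<in> span G}"
  have V: "subspace V" unfolding V_def by (rule subspace_sums[OF C(1) subspace_span])
  have CV: "C \<subseteq> V"
  proof
    fix c assume "c \<in> C"
    then show "c \<in> V" unfolding V_def using span_zero[of G]
      by (intro CollectI exI[of _ c] exI[of _ 0]) simp
  qed
  have GV: "span G \<subseteq> V"
  proof
    fix g assume "g \<in> span G"
    then show "g \<in> V" unfolding V_def using subspace_0[OF C(1)]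
      by (intro CollectI exI[of _ 0] exI[of _ g]) simp
  qed
  have CY: "C \<subseteq> Y"
  proof
    fix c assume "c \<in> C"
    then show "c \<in> Y" unfolding Y(2) using subspace_0[OF TX]
      by (intro CollectI exI[of _ 0] exI[of _ c]) simp
  qed
  have VY: "V \<subseteq> Y"
    unfolding V_def using CY span_minimal[OF G(2) Y(1)] subspace_add[OF Y(1)] by auto
  have Vfin: "V \<subseteq> span (BC \<union> G)"
  proof
    fix v assume "v \<in> V"
    then obtain c g where "v = c + g" "c \<in> C" "g \<in> span G" unfolding V_def by blast
    then show "v \<in> span (BC \<union> G)"
      using C(3) span_mono[of BC "BC \<union> G"] span_mono[of G "BC \<union> G"] by (auto intro!: span_add)
  qed
  obtain A where A: "finite A" "A \<subseteq> ?K" "independent A" "?K \<subseteq> span A" "card A = dim ?K"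
    using finite_basis_exists[OF K] by blast
  obtain D where D: "finite D" "D \<subseteq> C" "independent D" "C \<subseteq> span D" "card D = dim C"
    using finite_basis_exists[OF C(2,3)] by blast
  have VT: "V \<inter> T ` X \<subseteq> span (BC \<union> G)" using Vfin by blast
  have fin: "finite (BC \<union> G)" using C(2) G(1) by simp
  obtain W where W: "finite W" "W \<subseteq> V \<inter> T ` X" "independent W" "V \<inter> T ` X \<subseteq> span W"
    using finite_basis_exists[OF fin VT] by blast
  have "\<forall>w\<in>W. \<exists>u. u \<in> X \<and> T u = w" using W(2) by auto
  then obtain r where r: "\<And>w. w \<in> W \<Longrightarrow> r w \<in> X \<and> T (r w) = w"
    using bchoice[of W "\<lambda>w u. u \<in> X \<and> T u = w"] by blast
  have rinj: "inj_on r W" by (rule inj_onI) (metis r)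
  have W0: "0 \<notin> W" using W(3) dependent_zero[of W] by blast
  define U where "U = A \<union> r ` W"
  have disj: "A \<inter> r ` W = {}" using A(2) r W0 by auto
  have finU: "finite U" using A(1) W(1) by (simp add: U_def)
  have UX: "U \<subseteq> X" using A(2) r by (auto simp: U_def)
  have cardU: "card U = card A + card W"
    unfolding U_def using A(1) W(1) disj by (subst card_Un_disjoint) (auto simp: card_image rinj)
  have indU: "f x = 0" if z: "(\<Sum>u\<in>U. f u *s u) = 0" and x: "x \<in> U" for f x
  proof -
    have split: "(\<Sum>u\<in>U. f u *s u) = (\<Sum>u\<in>A. f u *s u) + (\<Sum>w\<in>W. f (r w) *s r w)"
      unfolding U_def using A(1) W(1) disj
      by (subst sum.union_disjoint) (auto simp: sum.reindex[OF rinj])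
    have "T (\<Sum>u\<in>U. f u *s u) = (\<Sum>u\<in>U. f u *s T u)"
      using linear_on_sum[OF T, of U "\<lambda>u. u" f] UX by auto
    also have "\<dots> = (\<Sum>u\<in>A. f u *s T u) + (\<Sum>w\<in>W. f (r w) *s T (r w))"
      unfolding U_def using A(1) W(1) disj
      by (subst sum.union_disjoint) (auto simp: sum.reindex[OF rinj])
    also have "(\<Sum>u\<in>A. f u *s T u) = 0"
      using A(2) by (intro sum.neutral) auto
    also have "(\<Sum>w\<in>W. f (r w) *s T (r w)) = (\<Sum>w\<in>W. f (r w) *s w)"
      using r by (intro sum.cong) auto
    finally have "(\<Sum>w\<in>W. f (r w) *s w) = 0" using z linear_on_zero[OF T] by simp
    then have fr: "f (r w) = 0" if "w \<in> W" for w
      using independentD[OF W(3,1), of "\<lambda>w. f (r w)"] that by blast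
    then have "(\<Sum>u\<in>A. f u *s u) = 0" using z split by simp
    then have "f u = 0" if "u \<in> A" for u
      using independentD[OF A(3,1), of f] that by blast
    then show ?thesis using fr x by (auto simp: U_def)
  qed
  have Sinj: "inj_on ?S U"
  proof (rule inj_onI)
    fix u v assume uv: "u \<in> U" "v \<in> U" "?S u = ?S v"
    then have X': "u \<in> X" "v \<in> X" using UX by auto
    have "?S (u - v) = 0" using linear_on_diff[OF S X'] uv(3) by simp
    then have "u - v = 0" by (rule inj[OF subspace_diff[OF X X']])
    then show "u = v" by simp
  qed
  have indS: "independent (?S ` U)"
  proof (rule independent_if_scalars_zero)
    fix f x assume z: "(\<Sum>y\<in>?S ` U. f y *s y) = 0" and x: "x \<in> ?S ` U"
    have "?S (\<Sum>u\<in>U. f (?S u) *s u) = (\<Sum>u\<in>U. f (?S u) *s ?S u)"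
      using linear_on_sum[OF S, of U "\<lambda>u. u" "\<lambda>u. f (?S u)"] UX by auto
    also have "\<dots> = 0" using z by (simp add: sum.reindex[OF Sinj])
    finally have S0: "?S (\<Sum>u\<in>U. f (?S u) *s u) = 0" .
    have "(\<Sum>u\<in>U. f (?S u) *s u) \<in> X"
      using UX by (intro subspace_sum[OF X] subspace_scale[OF X]) auto
    then have "(\<Sum>u\<in>U. f (?S u) *s u) = 0" using S0 by (rule inj)
    then show "f x = 0" using indU[of "\<lambda>u. f (?S u)"] x by auto
  qed (use finU in simp)
  have cardS: "card (?S ` U) = card D + card W"
    using card_image[OF Sinj] cardU A(5) D(5) dim by simp
  have SUV: "?S ` U \<subseteq> V"
  proof
    fix z assume "z \<in> ?S ` U"
    then obtain u where u: "u \<in> U" "z = T u + F u" by blast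
    have "T u \<in> V"
      using u(1) A(2) r W(2) subspace_0[OF V] by (auto simp: U_def)
    moreover have "F u \<in> V" using G(3) GV UX u(1) by blast
    ultimately show "z \<in> V" using u(2) subspace_add[OF V] by blast
  qed
  have Vspan: "V \<subseteq> span (D \<union> W)"
  proof
    fix v assume v: "v \<in> V"
    then obtain x c where xc: "v = T x + c" "x \<in> X" "c \<in> C" using VY Y(2) by blast
    then have Tx: "T x = v - c" by simp
    have "v - c \<in> V" using v CV xc(3) by (intro subspace_diff[OF V]) auto
    then have "T x \<in> V" unfolding Tx .
    then have "T x \<in> V \<inter> T ` X" using xc(2) by blast
    then have "T x \<in> span W" using W(4) by blast
    then have "T x \<in> span (D \<union> W)" using span_mono[of W "D \<union> W"] by blast
    moreover have "c \<in> span (D \<union> W)" using D(4) xc(3) span_mono[of D "D \<union> W"] by blast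
    ultimately show "v \<in> span (D \<union> W)" unfolding xc(1) by (rule span_add)
  qed
  have VS: "V \<subseteq> span (?S ` U)"
  proof
    fix v assume v: "v \<in> V"
    show "v \<in> span (?S ` U)"
    proof (rule ccontr)
      assume nv: "v \<notin> span (?S ` U)"
      then have "independent (insert v (?S ` U))" using indS by (simp add: independent_insertI)
      moreover have "insert v (?S ` U) \<subseteq> span (D \<union> W)" using v SUV Vspan by blast
      moreover have "finite (D \<union> W)" using D(1) W(1) by simp
      ultimately have "card (insert v (?S ` U)) \<le> card (D \<union> W)"
        using independent_span_bound by blast
      moreover have "card (insert v (?S ` U)) = Suc (card (?S ` U))"
        using nv finU span_base[of v "?S ` U"] by (subst card_insert_disjoint) auto
      ultimately show False using cardS card_Un_le[of D W] by linarith
    qed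
  qed
  have "span (?S ` U) \<subseteq> ?S ` X"
    by (rule span_minimal) (use UX linear_on_image_subspace[OF S] in auto)
  then have VSX: "V \<subseteq> ?S ` X" using VS by blast
  obtain x c where xc: "y = T x + c" "x \<in> X" "c \<in> C" using y Y(2) by blast
  have "F x \<in> V" using G(3) GV xc(2) by blast
  moreover have "c \<in> V" using CV xc(3) by blast
  ultimately have "c - F x \<in> V" by (intro subspace_diff[OF V])
  then obtain u where u: "u \<in> X" "c - F x = ?S u" using VSX by blast
  have "?S (x + u) = ?S x + ?S u"
    using S xc(2) u(1) unfolding linear_on_def by blast
  also have "\<dots> = y" using u(2) xc(1) by (simp add: algebra_simps)
  finally show ?thesis using xc(2) u(1) subspace_add[OF X] by blast
qed

text \<open>Each functional which does not vanish on \<open>K\<close> lowers the dimension of the common kernel, so \<open>dim K\<close>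
  functionals suffice.\<close>

lemma separating_functionals:
  fixes L :: "('b \<Rightarrow> 'a) set"
  assumes "subspace K" "finite W" "K \<subseteq> span W" "dim K \<le> m"
    and lin: "\<forall>l\<in>L. (\<forall>u\<in>K. \<forall>v\<in>K. l (u + v) = l u + l v) \<and> (\<forall>c. \<forall>u\<in>K. l (c *s u) = c * l u)"
    and sep: "\<forall>u\<in>K. u \<noteq> 0 \<longrightarrow> (\<exists>l\<in>L. l u \<noteq> 0)" and "L \<noteq> {}"
  shows "\<exists>ls :: nat \<Rightarrow> 'b \<Rightarrow> 'a. (\<forall>i<m. ls i \<in> L) \<and> (\<forall>u\<in>K. (\<forall>i<m. ls i u = 0) \<longrightarrow> u = 0)"
  using assms(1,3,4) lin sep
proof (induction m arbitrary: K)
  case 0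
  obtain B where B: "finite B" "B \<subseteq> K" "K \<subseteq> span B" "card B = dim K"
    using finite_basis_exists[OF assms(2) 0(2)] by blast
  then have "B = {}" using 0(3) by auto
  then have "K \<subseteq> {0}" using B(3) by simp
  then show ?case by auto
next
  case (Suc m)
  note sub = Suc.prems(1) and spn = Suc.prems(2) and dm = Suc.prems(3) and lin = Suc.prems(4) and sep = Suc.prems(5)
  show ?case
  proof (cases "K \<subseteq> {0}")
    case True
    obtain l where "l \<in> L" using \<open>L \<noteq> {}\<close> by blast
    then show ?thesis using True by (intro exI[of _ "\<lambda>_. l"]) auto
  next
    case False
    then obtain u where u: "u \<in> K" "u \<noteq> 0" by blast
    then obtain l where l: "l \<in> L" "l u \<noteq> 0" using sep by blast
    define K' where "K' = {v \<in> K. l v = 0}"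
    have lK: "\<And>u v. u \<in> K \<Longrightarrow> v \<in> K \<Longrightarrow> l (u + v) = l u + l v" "\<And>c u. u \<in> K \<Longrightarrow> l (c *s u) = c * l u"
      using lin l(1) by blast+
    have K': "subspace K'"
      unfolding K'_def
      by (rule subspaceI) (use sub lK lK(2)[of 0 0] in \<open>auto intro: subspace_0 subspace_add subspace_scale\<close>)
    have sK': "K' \<subseteq> K" by (auto simp: K'_def)
    obtain B where B: "finite B" "B \<subseteq> K'" "independent B" "K' \<subseteq> span B" "card B = dim K'"
      using finite_basis_exists[OF assms(2) order_trans[OF sK' spn]] by blast
    obtain B2 where B2: "finite B2" "B2 \<subseteq> K" "K \<subseteq> span B2" "card B2 = dim K"
      using finite_basis_exists[OF assms(2) spn] by blast
    have nu: "u \<notin> span B" using span_minimal[OF B(2) K'] l(2) by (auto simp: K'_def)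
    then have "independent (insert u B)" using B(3) by (simp add: independent_insertI)
    moreover have "insert u B \<subseteq> span B2" using u(1) B(2) sK' B2(3) by blast
    ultimately have "card (insert u B) \<le> card B2" using independent_span_bound[OF B2(1)] by blast
    moreover have "card (insert u B) = Suc (card B)"
      using nu B(1) span_base[of u B] by (subst card_insert_disjoint) auto
    ultimately have dK': "dim K' \<le> m" using B(5) B2(4) dm by simp
    have spK': "K' \<subseteq> span W" using sK' spn by blast
    have linK': "\<forall>l\<in>L. (\<forall>u\<in>K'. \<forall>v\<in>K'. l (u + v) = l u + l v) \<and> (\<forall>c. \<forall>u\<in>K'. l (c *s u) = c * l u)"
      using lin unfolding K'_def by simp
    have sepK': "\<forall>u\<in>K'. u \<noteq> 0 \<longrightarrow> (\<exists>l\<in>L. l u \<noteq> 0)"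
      using sep unfolding K'_def by simp
    obtain ls where ls: "\<forall>i<m. ls i \<in> L" "\<forall>u\<in>K'. (\<forall>i<m. ls i u = 0) \<longrightarrow> u = 0"
      using Suc.IH[OF K' spK' dK' linK' sepK'] by (elim exE conjE)
    define ls' where "ls' = (\<lambda>i. if i < m then ls i else l)"
    have "ls' i \<in> L" for i using ls(1) l(1) by (auto simp: ls'_def)
    moreover have "v = 0" if v: "v \<in> K" "\<forall>i<Suc m. ls' i v = 0" for v
    proof -
      have "l v = 0" using v(2)[rule_format, of m] by (simp add: ls'_def)
      moreover have "ls i v = 0" if "i < m" for i using v(2)[rule_format, of i] that by (simp add: ls'_def)
      ultimately show ?thesis using ls(2) v(1) by (auto simp: K'_def)
    qed
    ultimately show ?thesis by blast
  qed
qed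

end

section \<open>The bounded inverse theorem\<close>

definition norm_on :: "('n::finite) sys set \<Rightarrow> ('n sys \<Rightarrow> real) \<Rightarrow> bool" where
  "norm_on X n \<longleftrightarrow> sys.subspace X \<and> (\<forall>u\<in>X. 0 \<le> n u) \<and> (\<forall>u\<in>X. n u = 0 \<longrightarrow> u = 0) \<and>
     (\<forall>u\<in>X. \<forall>v\<in>X. n (u + v) \<le> n u + n v) \<and> (\<forall>c. \<forall>u\<in>X. n (sscale c u) = norm c * n u)"

definition complete_on :: "('n::finite) sys set \<Rightarrow> ('n sys \<Rightarrow> real) \<Rightarrow> bool" where
  "complete_on X n \<longleftrightarrow> (\<forall>F. (\<forall>i::nat. F i \<in> X) \<and> (\<forall>e>0. \<exists>M. \<forall>i\<ge>M. \<forall>j\<ge>M. n (F i - F j) < e) \<longrightarrow>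
     (\<exists>u\<in>X. (\<lambda>i. n (F i - u)) \<longlonglongrightarrow> 0))"

context
  fixes X :: "('n::finite) sys set" and n :: "'n sys \<Rightarrow> real"
  assumes n: "norm_on X n"
begin

lemma norm_on_subspace: "sys.subspace X"
  using n by (simp add: norm_on_def)

lemma norm_on_nonneg: "u \<in> X \<Longrightarrow> 0 \<le> n u"
  using n by (simp add: norm_on_def)

lemma norm_on_eq_0: "u \<in> X \<Longrightarrow> n u = 0 \<Longrightarrow> u = 0"
  using n by (simp add: norm_on_def)

lemma norm_on_triangle: "u \<in> X \<Longrightarrow> v \<in> X \<Longrightarrow> n (u + v) \<le> n u + n v"
  using n by (simp add: norm_on_def)

lemma norm_on_scale: "u \<in> X \<Longrightarrow> n (sscale c u) = norm c * n u"
  using n by (simp add: norm_on_def)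

lemma norm_on_zero: "n 0 = 0"
  using norm_on_scale[of 0 0] sys.subspace_0[OF norm_on_subspace] by simp

lemma norm_on_minus: "u \<in> X \<Longrightarrow> n (- u) = n u"
  using norm_on_scale[of u "- 1"] by simp

lemma norm_on_minus_commute: "u \<in> X \<Longrightarrow> v \<in> X \<Longrightarrow> n (u - v) = n (v - u)"
  using norm_on_minus[of "u - v"] sys.subspace_diff[OF norm_on_subspace] by simp

lemma norm_on_triangle_diff: "u \<in> X \<Longrightarrow> v \<in> X \<Longrightarrow> w \<in> X \<Longrightarrow> n (u - w) \<le> n (u - v) + n (v - w)"
  using norm_on_triangle[of "u - v" "v - w"] sys.subspace_diff[OF norm_on_subspace] by simp

end

text \<open>Otherwise the closures of the sets \<open>A k\<close> would be countably many nowhere dense sets covering \<open>Y\<close>,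
  contrary to Baire's theorem.\<close>

lemma baire_dense_ball:
  fixes A :: "nat \<Rightarrow> ('n::finite) sys set"
  assumes Y: "norm_on Y n" "complete_on Y n" and A: "\<And>k. A k \<subseteq> Y" "(\<Union>k. A k) = Y"
  shows "\<exists>k. \<exists>y\<in>Y. \<exists>r>0. \<forall>z\<in>Y. n (z - y) < r \<longrightarrow> (\<forall>e>0. \<exists>a\<in>A k. n (z - a) < e)"
proof -
  note sub = norm_on_subspace[OF Y(1)]
  have dif: "u - v \<in> Y" if "u \<in> Y" "v \<in> Y" for u v
    using that sys.subspace_diff[OF sub] by blast
  define d where "d u v = (if u \<in> Y \<and> v \<in> Y then n (u - v) else 0)" for u v
  interpret M: Metric_space Y d
  proof
    show "0 \<le> d x y" for x y using norm_on_nonneg[OF Y(1)] dif by (simp add: d_def)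
    show "d x y = d y x" for x y using norm_on_minus_commute[OF Y(1)] by (simp add: d_def)
    show "(d x y = 0) = (x = y)" if "x \<in> Y" "y \<in> Y" for x y
      using that norm_on_eq_0[OF Y(1) dif[OF that]] norm_on_zero[OF Y(1)] by (auto simp: d_def)
    show "d x z \<le> d x y + d y z" if "x \<in> Y" "y \<in> Y" "z \<in> Y" for x y z
      using that norm_on_triangle_diff[OF Y(1)] by (simp add: d_def)
  qed
  have comp: "M.mcomplete"
    unfolding M.mcomplete_def
  proof (intro allI impI)
    fix F :: "nat \<Rightarrow> 'n sys" assume F: "M.MCauchy F"
    have FY: "F i \<in> Y" for i using F unfolding M.MCauchy_def by blast
    have "\<exists>N. \<forall>i\<ge>N. \<forall>j\<ge>N. n (F i - F j) < e" if e: "e > 0" for e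
    proof -
      obtain N where N: "\<And>i j. N \<le> i \<Longrightarrow> N \<le> j \<Longrightarrow> d (F i) (F j) < e"
        using F e unfolding M.MCauchy_def by blast
      have "n (F i - F j) < e" if "i \<ge> N" "j \<ge> N" for i j
        using N[OF that] FY[of i] FY[of j] by (simp add: d_def)
      then show ?thesis by blast
    qed
    then obtain u where u: "u \<in> Y" "(\<lambda>i. n (F i - u)) \<longlonglongrightarrow> 0"
      using Y(2) FY unfolding complete_on_def by blast
    have "(\<lambda>i. d (F i) u) \<longlonglongrightarrow> 0" using u FY by (simp add: d_def)
    then show "\<exists>x. limitin M.mtopology F x sequentially"
      using u FY by (intro exI[of _ u]) (simp add: M.limitin_metric_dist_null)
  qed
  let ?cl = "\<lambda>k. M.mtopology closure_of A k"
  have "(\<Union>k. ?cl k) = Y"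
  proof
    show "(\<Union>k. ?cl k) \<subseteq> Y"
    proof (rule UN_least)
      fix k show "?cl k \<subseteq> Y"
        using closure_of_subset_topspace[of M.mtopology "A k"] by simp
    qed
    show "Y \<subseteq> (\<Union>k. ?cl k)"
    proof
      fix y assume "y \<in> Y"
      then obtain k where "y \<in> A k" using A(2) by blast
      moreover have "A k \<subseteq> ?cl k" using A(1)[of k] by (intro closure_of_subset) simp
      ultimately show "y \<in> (\<Union>k. ?cl k)" by blast
    qed
  qed
  moreover have "Y \<noteq> {}" using sys.subspace_0[OF sub] by blast
  moreover have "M.mtopology interior_of Y = Y"
    using interior_of_topspace[of M.mtopology] by simp
  ultimately have nonempty: "M.mtopology interior_of (\<Union>(range ?cl)) \<noteq> {}"
    by simp
  have "\<exists>k. M.mtopology interior_of ?cl k \<noteq> {}"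
  proof (rule ccontr)
    assume "\<not> ?thesis"
    then have "M.mtopology interior_of (\<Union>(range ?cl)) = {}"
      by (intro M.metric_Baire_category_alt[OF comp]) auto
    then show False using nonempty by contradiction
  qed
  then obtain k where k: "M.mtopology interior_of ?cl k \<noteq> {}" by blast
  then obtain y where y: "y \<in> M.mtopology interior_of ?cl k" by blast
  then obtain U where U: "openin M.mtopology U" "U \<subseteq> ?cl k" "y \<in> U"
    unfolding interior_of_def by blast
  then obtain r where r: "r > 0" "M.mball y r \<subseteq> U" and yY: "y \<in> Y"
    unfolding M.openin_mtopology by blast
  have "\<exists>a\<in>A k. n (z - a) < e" if z: "z \<in> Y" "n (z - y) < r" and e: "e > 0" for z e
  proof -
    have "z \<in> M.mball y r"
      using z yY norm_on_minus_commute[OF Y(1)] by (simp add: M.mball_def d_def)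
    then have "z \<in> ?cl k" using r U by blast
    then obtain a where "a \<in> A k" "a \<in> M.mball z e"
      using e unfolding M.metric_closure_of by blast
    then show ?thesis using A(1) z by (auto simp: M.mball_def d_def split: if_splits)
  qed
  then show ?thesis using yY r(1) by blast
qed

lemma bounded_inverse:
  fixes X Y :: "('n::finite) sys set"
  assumes X: "norm_on X nX" "complete_on X nX" and Y: "norm_on Y nY" "complete_on Y nY"
    and T: "linear_on sscale X T" "T ` X = Y"
    and bd: "\<And>u. u \<in> X \<Longrightarrow> nY (T u) \<le> C * nX u"
    and inj: "\<And>u. u \<in> X \<Longrightarrow> T u = 0 \<Longrightarrow> u = 0"
  shows "\<exists>M>0. \<forall>u\<in>X. nX u \<le> M * nY (T u)"
proof -
  note sX = norm_on_subspace[OF X(1)] and sY = norm_on_subspace[OF Y(1)]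
  note dX = sys.subspace_diff[OF sX] sys.subspace_add[OF sX] sys.subspace_scale[OF sX]
  note dY = sys.subspace_diff[OF sY] sys.subspace_add[OF sY] sys.subspace_scale[OF sY]
  have TY: "T u \<in> Y" if "u \<in> X" for u using that T(2) by blast
  have Td: "T (u - v) = T u - T v" if "u \<in> X" "v \<in> X" for u v
    using sys.linear_on_diff[OF T(1) that] .
  have Ta: "T (u + v) = T u + T v" if "u \<in> X" "v \<in> X" for u v
    using T(1) that by (simp add: linear_on_def)
  have Ts: "T (sscale c u) = sscale c (T u)" if "u \<in> X" for u c
    using T(1) that by (simp add: linear_on_def)
  have z: "0 \<in> X" using sys.subspace_0[OF sX] .
  \<comment> \<open>Images of balls are dense in a ball about \<open>0\<close>: Baire's theorem gives a ball about some \<open>y0\<close>,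
    and differences of two of its points fill one about \<open>0\<close>.\<close>
  have "\<exists>L>0. \<forall>y\<in>Y. \<forall>e>0. \<exists>u\<in>X. nX u \<le> L * nY y \<and> nY (y - T u) < e"
  proof -
    define A where "A k = T ` {u \<in> X. nX u \<le> real k}" for k
    have "(\<Union>k. A k) = Y"
    proof
      show "(\<Union>k. A k) \<subseteq> Y" using TY by (auto simp: A_def)
      show "Y \<subseteq> (\<Union>k. A k)"
      proof
        fix y assume "y \<in> Y"
        then obtain u where u: "u \<in> X" "y = T u" using T(2) by blast
        obtain k :: nat where "nX u \<le> real k" using real_arch_simple by blast
        then show "y \<in> (\<Union>k. A k)" using u by (auto simp: A_def)
      qed
    qed
    moreover have "A k \<subseteq> Y" for k using TY by (auto simp: A_def)
    ultimately obtain k y0 r where k: "y0 \<in> Y" "r > 0"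
      and dense: "\<And>z e. z \<in> Y \<Longrightarrow> nY (z - y0) < r \<Longrightarrow> e > 0 \<Longrightarrow> \<exists>a\<in>A k. nY (z - a) < e"
      using baire_dense_ball[OF Y, of A] by blast
    have small: "\<exists>u\<in>X. nX u \<le> 2 * real k \<and> nY (y - T u) < e" if y: "y \<in> Y" "nY y < r" and e: "e > 0" for y e
    proof -
      obtain u where u: "u \<in> X" "nX u \<le> real k" "nY (y0 + y - T u) < e / 2"
        using dense[OF dY(2)[OF k(1) y(1)], of "e / 2"] y(2) e by (auto simp: A_def)
      obtain v where v: "v \<in> X" "nX v \<le> real k" "nY (y0 - T v) < e / 2"
        using dense[OF k(1), of "e / 2"] e k(2) norm_on_zero[OF Y(1)] by (auto simp: A_def)
      have "nX (u - v) \<le> nX u + nX v"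
        using norm_on_triangle[OF X(1) u(1), of "- v"] norm_on_minus[OF X(1) v(1)] sys.subspace_neg[OF sX v(1)] by simp
      then have 1: "nX (u - v) \<le> 2 * real k" using u v by simp
      have eq: "y - T (u - v) = (y0 + y - T u) + - (y0 - T v)"
        using Td[OF u(1) v(1)] by simp
      have m: "y0 + y - T u \<in> Y" "y0 - T v \<in> Y" "- (y0 - T v) \<in> Y"
        by (intro dY(1,2) sys.subspace_neg[OF sY] k(1) y(1) TY u(1) v(1))+
      have "nY (y - T (u - v)) \<le> nY (y0 + y - T u) + nY (y0 - T v)"
        using norm_on_triangle[OF Y(1) m(1) m(3)] unfolding norm_on_minus[OF Y(1) m(2)] eq .
      then have "nY (y - T (u - v)) < e" using u v by simp
      then show ?thesis using 1 dX(1)[OF u(1) v(1)] by blast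
    qed
    define L where "L = 4 * (real k + 1) / r"
    have L: "L > 0" using k(2) by (simp add: L_def)
    have "\<exists>u\<in>X. nX u \<le> L * nY y \<and> nY (y - T u) < e" if y: "y \<in> Y" and e: "e > 0" for y e
    proof (cases "nY y = 0")
      case True
      then have "y = 0" using norm_on_eq_0[OF Y(1) y] by blast
      then show ?thesis
        using z e norm_on_zero[OF X(1)] norm_on_zero[OF Y(1)] sys.linear_on_zero[OF T(1)]
        by (intro bexI[of _ 0]) auto
    next
      case False
      then have pos: "nY y > 0" using norm_on_nonneg[OF Y(1) y] by simp
      define c where "c = r / (2 * nY y)"
      have c: "c > 0" using pos k(2) by (simp add: c_def)
      have cy: "sscale (of_real c) y \<in> Y" using y by (rule dY(3))
      have "nY (sscale (of_real c) y) < r"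
      proof -
        have "nY (sscale (of_real c) y) = c * nY y"
          using norm_on_scale[OF Y(1) y, of "of_real c"] c by simp
        also have "\<dots> = r / 2" using pos by (simp add: c_def)
        finally show ?thesis using k(2) by simp
      qed
      then obtain u where u: "u \<in> X" "nX u \<le> 2 * real k" "nY (sscale (of_real c) y - T u) < c * e"
        using small[OF cy, of "c * e"] c e by auto
      let ?u = "sscale (of_real (1 / c)) u"
      have "nX ?u = nX u / c" using norm_on_scale[OF X(1) u(1), of "of_real (1 / c)"] c by (simp add: norm_divide)
      also have "\<dots> \<le> 2 * real k / c" using u(2) c by (simp add: divide_right_mono)
      also have "\<dots> = 4 * real k / r * nY y" using pos k(2) by (simp add: c_def field_simps)
      also have "\<dots> \<le> L * nY y"
        unfolding L_def using pos k(2) by (intro mult_right_mono divide_right_mono) auto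
      finally have 1: "nX ?u \<le> L * nY y" .
      have "y - T ?u = sscale (of_real (1 / c)) (sscale (of_real c) y - T u)"
        using Ts[OF u(1)] c by (simp add: sys.scale_right_diff_distrib)
      then have "nY (y - T ?u) = nY (sscale (of_real c) y - T u) / c"
        using norm_on_scale[OF Y(1), of "sscale (of_real c) y - T u" "of_real (1 / c)"] c dY(1)[OF cy TY[OF u(1)]] by (simp add: norm_divide)
      also have "\<dots> < e" using u(3) c by (simp add: divide_less_eq mult.commute)
      finally show ?thesis using 1 dX(3)[OF u(1)] by blast
    qed
    then show ?thesis using L by blast
  qed
  then obtain L where L: "L > 0" and app: "\<And>y e. y \<in> Y \<Longrightarrow> e > 0 \<Longrightarrow> \<exists>u\<in>X. nX u \<le> L * nY y \<and> nY (y - T u) < e"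
    by blast
  have "nX u \<le> 2 * L * nY (T u)" if u: "u \<in> X" for u
  proof (cases "nY (T u) = 0")
    case True
    then have "u = 0" using norm_on_eq_0[OF Y(1) TY[OF u]] inj[OF u] by blast
    then show ?thesis using True norm_on_zero[OF X(1)] by simp
  next
    case False
    define y where "y = T u"
    define \<delta> where "\<delta> = nY y"
    have y: "y \<in> Y" using TY[OF u] by (simp add: y_def)
    have \<delta>: "\<delta> > 0" using False norm_on_nonneg[OF Y(1) y] by (simp add: \<delta>_def y_def)
    \<comment> \<open>Approximating the remainder again and again, each time halving it, produces a Cauchy
      sequence in \<open>X\<close> whose limit is a preimage of \<open>y\<close>.\<close>
    have "\<exists>s. \<forall>k. (s k \<in> X \<and> nY (y - T (s k)) \<le> \<delta> / 2 ^ k \<and> (k = 0 \<longrightarrow> s k = 0)) \<and> nX (s (Suc k) - s k) \<le> L * \<delta> / 2 ^ k"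
    proof (rule dependent_nat_choice)
      show "\<exists>x. x \<in> X \<and> nY (y - T x) \<le> \<delta> / 2 ^ 0 \<and> ((0::nat) = 0 \<longrightarrow> x = 0)"
        using z sys.linear_on_zero[OF T(1)] by (simp add: \<delta>_def)
      show "\<exists>x'. (x' \<in> X \<and> nY (y - T x') \<le> \<delta> / 2 ^ Suc k \<and> (Suc k = 0 \<longrightarrow> x' = 0)) \<and> nX (x' - x) \<le> L * \<delta> / 2 ^ k"
        if x: "x \<in> X \<and> nY (y - T x) \<le> \<delta> / 2 ^ k \<and> (k = 0 \<longrightarrow> x = 0)" for x k
      proof -
        have yx: "y - T x \<in> Y" using x by (intro dY(1) y TY) simp
        obtain v where v: "v \<in> X" "nX v \<le> L * nY (y - T x)" "nY (y - T x - T v) < \<delta> / 2 ^ Suc k"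
          using app[OF yx, of "\<delta> / 2 ^ Suc k"] \<delta> by auto
        have "L * nY (y - T x) \<le> L * (\<delta> / 2 ^ k)" using x L by (intro mult_left_mono) auto
        then have "nX v \<le> L * \<delta> / 2 ^ k" using v(2) by simp
        moreover have "nY (y - T (x + v)) \<le> \<delta> / 2 ^ Suc k"
        proof -
          have "y - T (x + v) = y - T x - T v" using Ta x v(1) by (simp add: diff_diff_add)
          then have "nY (y - T (x + v)) = nY (y - T x - T v)" by (rule arg_cong)
          then show ?thesis by (rule ord_eq_le_trans[OF _ less_imp_le[OF v(3)]])
        qed
        ultimately show ?thesis
          using v(1) x dX(2)[of x v] by (intro exI[of _ "x + v"]) auto
      qed
    qed
    then obtain s where s: "\<And>k. s k \<in> X" "\<And>k. nY (y - T (s k)) \<le> \<delta> / 2 ^ k" "s 0 = 0"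
      "\<And>k. nX (s (Suc k) - s k) \<le> L * \<delta> / 2 ^ k" by blast
    have tel: "nX (s (k + m) - s k) \<le> 2 * L * \<delta> * (1 / 2 ^ k - 1 / 2 ^ (k + m))" for k m
    proof (induction m)
      case 0
      show ?case unfolding add_0_right diff_self norm_on_zero[OF X(1)] by simp
    next
      case (Suc m)
      have "nX (s (k + Suc m) - s k) \<le> nX (s (Suc (k + m)) - s (k + m)) + nX (s (k + m) - s k)"
        using norm_on_triangle_diff[OF X(1) s(1) s(1) s(1)] by simp
      also have "\<dots> \<le> L * \<delta> / 2 ^ (k + m) + 2 * L * \<delta> * (1 / 2 ^ k - 1 / 2 ^ (k + m))"
        by (intro add_mono s(4) Suc.IH)
      also have "\<dots> = 2 * L * \<delta> * (1 / 2 ^ k - 1 / 2 ^ (k + Suc m))"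
        by (simp add: field_simps)
      finally show ?case .
    qed
    have L\<delta>: "2 * L * \<delta> > 0" using L \<delta> by simp
    have tel': "nX (s j - s i) \<le> 2 * L * \<delta> / 2 ^ i" if "i \<le> j" for i j
    proof -
      have "nX (s j - s i) \<le> 2 * L * \<delta> * (1 / 2 ^ i - 1 / 2 ^ j)"
        using tel[of i "j - i"] unfolding le_add_diff_inverse[OF that] .
      also have "\<dots> \<le> 2 * L * \<delta> * (1 / 2 ^ i)" using L\<delta> by (intro mult_left_mono) auto
      finally show ?thesis by simp
    qed
    have geo: "(\<lambda>k. c / 2 ^ k) \<longlonglongrightarrow> 0" for c :: real
      using tendsto_mult[OF tendsto_const[of c] LIMSEQ_power_zero[of "1 / 2 :: real"]] by (simp add: power_one_over field_simps)
    have "\<exists>M. \<forall>i\<ge>M. \<forall>j\<ge>M. nX (s i - s j) < e" if e: "e > 0" for e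
    proof -
      have "\<forall>\<^sub>F k in sequentially. 2 * L * \<delta> / 2 ^ k < e" using order_tendstoD(2)[OF geo e] .
      then obtain M where M: "\<And>k. k \<ge> M \<Longrightarrow> 2 * L * \<delta> / 2 ^ k < e" by (auto simp: eventually_sequentially)
      have "nX (s i - s j) < e" if "i \<ge> M" "j \<ge> M" for i j
      proof (cases "i \<le> j")
        case True
        then show ?thesis using tel'[OF True] M[OF that(1)] norm_on_minus_commute[OF X(1) s(1)[of i] s(1)[of j]] by simp
      next
        case False
        then show ?thesis using tel'[of j i] M[OF that(2)] by simp
      qed
      then show ?thesis by blast
    qed
    then obtain w where w: "w \<in> X" "(\<lambda>i. nX (s i - w)) \<longlonglongrightarrow> 0"
      using X(2) s(1) unfolding complete_on_def by blast
    have "nY (y - T w) \<le> 0"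
    proof (rule LIMSEQ_le_const)
      show "(\<lambda>i. \<delta> / 2 ^ i + C * nX (s i - w)) \<longlonglongrightarrow> 0"
        using tendsto_add[OF geo[of \<delta>] tendsto_mult[OF tendsto_const[of C] w(2)]] by simp
      have "nY (y - T w) \<le> \<delta> / 2 ^ i + C * nX (s i - w)" for i
      proof -
        have "nY (y - T w) \<le> nY (y - T (s i)) + nY (T (s i) - T w)"
          using norm_on_triangle_diff[OF Y(1) y TY[OF s(1)] TY[OF w(1)]] .
        then show ?thesis using s(2)[of i] bd[of "s i - w"] dX(1)[OF s(1) w(1)] Td[OF s(1) w(1)] by fastforce
      qed
      then show "\<exists>N. \<forall>i\<ge>N. nY (y - T w) \<le> \<delta> / 2 ^ i + C * nX (s i - w)" by blast
    qed
    moreover have yw: "y - T w \<in> Y" using dY(1)[OF y TY[OF w(1)]] .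
    ultimately have "y - T w = 0" using norm_on_nonneg[OF Y(1) yw] norm_on_eq_0[OF Y(1) yw] by simp
    then have "T (u - w) = 0" using Td[OF u w(1)] by (simp add: y_def)
    then have uw: "u = w" using inj[OF dX(1)[OF u w(1)]] by simp
    have "nX w \<le> 2 * L * \<delta>"
    proof (rule LIMSEQ_le_const)
      show "(\<lambda>i. 2 * L * \<delta> + nX (s i - w)) \<longlonglongrightarrow> 2 * L * \<delta>"
        using tendsto_add[OF tendsto_const w(2)] by simp
      have "nX w \<le> 2 * L * \<delta> + nX (s i - w)" for i
      proof -
        have "nX (w - s 0) \<le> nX (w - s i) + nX (s i - s 0)"
          using norm_on_triangle_diff[OF X(1) w(1) s(1) s(1)] .
        then show ?thesis using tel'[of 0 i] s(3) norm_on_minus_commute[OF X(1) w(1) s(1)[of i]] by simp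
      qed
      then show "\<exists>N. \<forall>i\<ge>N. nX w \<le> 2 * L * \<delta> + nX (s i - w)" by blast
    qed
    then show ?thesis using uw by (simp add: \<delta>_def y_def)
  qed
  then show ?thesis using L by (intro exI[of _ "2 * L"]) auto
qed

section \<open>Sobolev spaces\<close>

text \<open>The existence of weak derivatives up to order \<open>l\<close>, without integrability conditions, is what makes
  \<open>A_op\<close> meaningful; it holds for sums of functions from Sobolev spaces with different exponents.\<close>

definition weakly_diff :: "nat \<Rightarrow> 'n::finite ae_fun \<Rightarrow> bool" where
  "weakly_diff l u \<longleftrightarrow> (\<forall>\<alpha>. mdeg \<alpha> \<le> l \<longrightarrow> weak_deriv \<alpha> u (weak_diff \<alpha> u))"

lemma weakly_diffD: "weakly_diff l u \<Longrightarrow> mdeg \<alpha> \<le> l \<Longrightarrow> weak_deriv \<alpha> u (weak_diff \<alpha> u)"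
  by (simp add: weakly_diff_def)

lemma weakly_diffI: "(\<And>\<alpha>. mdeg \<alpha> \<le> l \<Longrightarrow> \<exists>v. weak_deriv \<alpha> u v) \<Longrightarrow> weakly_diff l u"
  unfolding weakly_diff_def using weak_diff_eq by metis

lemma weakly_diff_loc_int: "weakly_diff l u \<Longrightarrow> loc_int u"
  using weakly_diffD[of l u "\<lambda>_. 0"] by (simp add: weak_deriv_pairing)

lemma weak_diff_zero_midx: "loc_int u \<Longrightarrow> weak_diff (\<lambda>_. 0) u = u"
  by (rule weak_diff_eq) (simp add: weak_deriv_zero_iff)

lemma weakly_diff_add:
  assumes "weakly_diff l u" "weakly_diff l v"
  shows "weakly_diff l (u + v)"
    and "mdeg \<alpha> \<le> l \<Longrightarrow> weak_diff \<alpha> (u + v) = weak_diff \<alpha> u + weak_diff \<alpha> v"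
proof -
  have *: "weak_deriv \<alpha> (u + v) (weak_diff \<alpha> u + weak_diff \<alpha> v)" if "mdeg \<alpha> \<le> l" for \<alpha>
    using assms that by (intro weak_deriv_add weakly_diffD)
  show "weakly_diff l (u + v)" using * by (blast intro: weakly_diffI)
  show "weak_diff \<alpha> (u + v) = weak_diff \<alpha> u + weak_diff \<alpha> v" if "mdeg \<alpha> \<le> l"
    using *[OF that] by (rule weak_diff_eq)
qed

lemma weakly_diff_scale:
  assumes "weakly_diff l u"
  shows "weakly_diff l (fmult (\<lambda>x. c) u)"
    and "mdeg \<alpha> \<le> l \<Longrightarrow> weak_diff \<alpha> (fmult (\<lambda>x. c) u) = fmult (\<lambda>x. c) (weak_diff \<alpha> u)"
proof -
  have *: "weak_deriv \<alpha> (fmult (\<lambda>x. c) u) (fmult (\<lambda>x. c) (weak_diff \<alpha> u))" if "mdeg \<alpha> \<le> l" for \<alpha>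
    using assms that by (intro weak_deriv_scale weakly_diffD)
  show "weakly_diff l (fmult (\<lambda>x. c) u)" using * by (blast intro: weakly_diffI)
  show "weak_diff \<alpha> (fmult (\<lambda>x. c) u) = fmult (\<lambda>x. c) (weak_diff \<alpha> u)" if "mdeg \<alpha> \<le> l"
    using *[OF that] by (rule weak_diff_eq)
qed

lemma weakly_diff_diff:
  assumes "weakly_diff l u" "weakly_diff l v"
  shows "weakly_diff l (u - v)"
    and "mdeg \<alpha> \<le> l \<Longrightarrow> weak_diff \<alpha> (u - v) = weak_diff \<alpha> u - weak_diff \<alpha> v"
proof -
  have m: "weakly_diff l (- v)" "mdeg \<alpha> \<le> l \<Longrightarrow> weak_diff \<alpha> (- v) = - weak_diff \<alpha> v" for \<alpha>
    using weakly_diff_scale[OF assms(2), where c = "- 1"] by (simp_all add: fmult_minus_one)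
  show "weakly_diff l (u - v)" using weakly_diff_add(1)[OF assms(1) m(1)] by simp
  show "weak_diff \<alpha> (u - v) = weak_diff \<alpha> u - weak_diff \<alpha> v" if "mdeg \<alpha> \<le> l"
    using weakly_diff_add(2)[OF assms(1) m(1) that] m(2)[OF that] by simp
qed

lemma weakly_diff_zero:
  shows "weakly_diff l (0 :: 'n::finite ae_fun)" and "weak_diff \<alpha> (0 :: 'n ae_fun) = 0"
proof -
  have *: "weak_deriv \<alpha> (0 :: 'n ae_fun) 0" for \<alpha>
  proof -
    have "pairing 0 h = 0" for h :: "real ^ 'n \<Rightarrow> complex" by transfer simp
    then show ?thesis by (simp add: weak_deriv_pairing)
  qed
  show "weakly_diff l (0 :: 'n ae_fun)" using * by (blast intro: weakly_diffI)
  show "weak_diff \<alpha> (0 :: 'n ae_fun) = 0" using * by (rule weak_diff_eq)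
qed

lemma sobolev_iff:
  assumes "1 \<le> p"
  shows "u \<in> sobolev p l \<longleftrightarrow> weakly_diff l u \<and> (\<forall>\<alpha>. mdeg \<alpha> \<le> l \<longrightarrow> in_Lp p (weak_diff \<alpha> u))"
proof
  assume u: "u \<in> sobolev p l"
  have "weakly_diff l u" using u by (intro weakly_diffI) (auto simp: sobolev_def)
  moreover have "in_Lp p (weak_diff \<alpha> u)" if "mdeg \<alpha> \<le> l" for \<alpha>
    using u that weak_diff_eq unfolding sobolev_def by blast
  ultimately show "weakly_diff l u \<and> (\<forall>\<alpha>. mdeg \<alpha> \<le> l \<longrightarrow> in_Lp p (weak_diff \<alpha> u))" by blast
next
  assume u: "weakly_diff l u \<and> (\<forall>\<alpha>. mdeg \<alpha> \<le> l \<longrightarrow> in_Lp p (weak_diff \<alpha> u))"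
  then have "in_Lp p (weak_diff (\<lambda>_. 0) u)" by simp
  then have "in_Lp p u" using u weak_diff_zero_midx[OF weakly_diff_loc_int, of l u] by simp
  then show "u \<in> sobolev p l" using u weakly_diffD unfolding sobolev_def by blast
qed

text \<open>A plain sum dominates \<open>sobolev_sys_norm N t p\<close> and reduces the triangle inequality and completeness
  to statements about single derivatives.\<close>

definition sum_norm :: "nat \<Rightarrow> (nat \<Rightarrow> nat) \<Rightarrow> real \<Rightarrow> 'n::finite sys \<Rightarrow> real" where
  "sum_norm N t p u = (\<Sum>k = 1..N. \<Sum>\<alpha> | mdeg \<alpha> \<le> t k. Lp_norm p (weak_diff \<alpha> (u k)))"

lemma sobolev_sys_iff:
  assumes "1 \<le> p"
  shows "u \<in> sobolev_sys N t p \<longleftrightarrow>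
    (\<forall>k\<in>{1..N}. weakly_diff (t k) (u k) \<and> (\<forall>\<alpha>. mdeg \<alpha> \<le> t k \<longrightarrow> in_Lp p (weak_diff \<alpha> (u k)))) \<and>
    (\<forall>k. k \<notin> {1..N} \<longrightarrow> u k = 0)"
  unfolding sobolev_sys_def mem_Collect_eq sobolev_iff[OF assms] ..

lemma Lp_sys_eq_sobolev_sys:
  assumes "1 \<le> p"
  shows "Lp_sys N p = sobolev_sys N (\<lambda>_. 0) p"
proof -
  have "u \<in> sobolev p 0 \<longleftrightarrow> in_Lp p u" for u :: "'a ae_fun"
    using in_Lp_loc_int[OF assms, of u] unfolding sobolev_def
    by (auto simp: mdeg_eq_0_iff weak_deriv_zero_iff)
  then show ?thesis unfolding Lp_sys_def sobolev_sys_def by simp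
qed

lemma Lp_sys_norm_eq_sum_norm:
  assumes "1 \<le> p" "u \<in> Lp_sys N p"
  shows "Lp_sys_norm N p u = sum_norm N (\<lambda>_. 0) p u"
  unfolding Lp_sys_norm_def sum_norm_def
proof (rule sum.cong)
  fix k assume "k \<in> {1..N}"
  then have "loc_int (u k)" using assms in_Lp_loc_int unfolding Lp_sys_def by blast
  moreover have "{\<alpha> :: 'a midx. mdeg \<alpha> \<le> 0} = {\<lambda>_. 0}" by (auto simp: mdeg_eq_0_iff)
  ultimately show "Lp_norm p (u k) = (\<Sum>\<alpha> | mdeg \<alpha> \<le> 0. Lp_norm p (weak_diff \<alpha> (u k)))"
    by (simp add: weak_diff_zero_midx)
qed simp

lemma sys_apply [simp]:
  "(u + v) k = u k + (v k :: 'n::finite ae_fun)" "(u - v) k = u k - v k"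
  "sscale c u k = fmult (\<lambda>x. c) (u k)" "(0 :: 'n sys) k = 0"
  by (auto simp: sscale_def)

lemma sobolev_sys_subspace:
  assumes "1 \<le> p"
  shows "sys.subspace (sobolev_sys N t p :: 'n::finite sys set)"
proof (rule sys.subspaceI)
  show "0 \<in> sobolev_sys N t p"
    unfolding sobolev_sys_iff[OF assms] by (auto simp: weakly_diff_zero)
  show "u + v \<in> sobolev_sys N t p" if "u \<in> sobolev_sys N t p" "v \<in> sobolev_sys N t p" for u v :: "'n sys"
    using that unfolding sobolev_sys_iff[OF assms] sys_apply
    by (auto simp: weakly_diff_add in_Lp_add[OF assms])
  show "sscale c u \<in> sobolev_sys N t p" if "u \<in> sobolev_sys N t p" for c and u :: "'n sys"
    using that assms unfolding sobolev_sys_iff[OF assms] sys_apply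
    by (auto simp: weakly_diff_scale in_Lp_scale)
qed

lemma Lp_norm_le_sum_norm:
  assumes "k \<in> {1..N}" "mdeg \<alpha> \<le> t k"
  shows "Lp_norm p (weak_diff \<alpha> (u k)) \<le> sum_norm N t p u"
proof -
  have "Lp_norm p (weak_diff \<alpha> (u k)) \<le> (\<Sum>\<alpha> | mdeg \<alpha> \<le> t k. Lp_norm p (weak_diff \<alpha> (u k)))"
    using assms(2) by (intro member_le_sum) (auto simp: finite_mdeg_le)
  also have "\<dots> \<le> sum_norm N t p u"
    unfolding sum_norm_def using assms(1)
    by (intro member_le_sum[where f = "\<lambda>k. \<Sum>\<alpha> | mdeg \<alpha> \<le> t k. Lp_norm p (weak_diff \<alpha> (u k))"]) (auto intro: sum_nonneg)
  finally show ?thesis .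
qed

lemma sum_norm_nonneg: "0 \<le> sum_norm N t p u"
  unfolding sum_norm_def by (intro sum_nonneg) auto

lemma norm_on_sobolev_sys:
  assumes p: "1 \<le> p"
  shows "norm_on (sobolev_sys N t p :: 'n::finite sys set) (sum_norm N t p)"
  unfolding norm_on_def
proof (intro conjI ballI allI impI)
  show "sys.subspace (sobolev_sys N t p :: 'n sys set)" by (rule sobolev_sys_subspace[OF p])
  show "0 \<le> sum_norm N t p u" for u :: "'n sys" by (rule sum_norm_nonneg)
  show "u = 0" if u: "u \<in> sobolev_sys N t p" and z: "sum_norm N t p u = 0" for u :: "'n sys"
  proof
    fix k
    show "u k = 0 k"
    proof (cases "k \<in> {1..N}")
      case True
      have "Lp_norm p (weak_diff (\<lambda>_. 0) (u k)) \<le> 0"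
        using Lp_norm_le_sum_norm[OF True, of "\<lambda>_. 0" t p u] z by simp
      moreover have "weak_diff (\<lambda>_. 0) (u k) = u k"
        using u True weak_diff_zero_midx weakly_diff_loc_int unfolding sobolev_sys_iff[OF p] by blast
      moreover have "in_Lp p (u k)" using u True unfolding sobolev_sys_def sobolev_def by blast
      ultimately show ?thesis using p Lp_norm_eq_0[of p "u k"] Lp_norm_nonneg[of p "u k"] by simp
    qed (use u in \<open>simp add: sobolev_sys_iff[OF p]\<close>)
  qed
  show "sum_norm N t p (u + v) \<le> sum_norm N t p u + sum_norm N t p v"
    if u: "u \<in> sobolev_sys N t p" and v: "v \<in> sobolev_sys N t p" for u v :: "'n sys"
  proof -
    have "Lp_norm p (weak_diff \<alpha> ((u + v) k)) \<le> Lp_norm p (weak_diff \<alpha> (u k)) + Lp_norm p (weak_diff \<alpha> (v k))"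
      if "k \<in> {1..N}" "mdeg \<alpha> \<le> t k" for k \<alpha>
    proof -
      have "weak_diff \<alpha> ((u + v) k) = weak_diff \<alpha> (u k) + weak_diff \<alpha> (v k)"
        using u v that unfolding sobolev_sys_iff[OF p] sys_apply by (intro weakly_diff_add(2)[where l = "t k"]) auto
      then show ?thesis
        using u v that Lp_norm_add[OF p, of "weak_diff \<alpha> (u k)" "weak_diff \<alpha> (v k)"] unfolding sobolev_sys_iff[OF p] by simp
    qed
    then show ?thesis unfolding sum_norm_def sum.distrib[symmetric] by (intro sum_mono) auto
  qed
  show "sum_norm N t p (sscale c u) = norm c * sum_norm N t p u" if u: "u \<in> sobolev_sys N t p" for c and u :: "'n sys"
  proof -
    have "Lp_norm p (weak_diff \<alpha> (sscale c u k)) = norm c * Lp_norm p (weak_diff \<alpha> (u k))"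
      if "k \<in> {1..N}" "mdeg \<alpha> \<le> t k" for k \<alpha>
    proof -
      have "weak_diff \<alpha> (sscale c u k) = fmult (\<lambda>x. c) (weak_diff \<alpha> (u k))"
        using u that unfolding sobolev_sys_iff[OF p] sys_apply by (intro weakly_diff_scale(2)[where l = "t k"]) auto
      then show ?thesis using p by (simp add: Lp_norm_scale)
    qed
    then show ?thesis unfolding sum_norm_def sum_distrib_left by (intro sum.cong) auto
  qed
qed

lemma complete_on_sobolev_sys:
  assumes p: "1 \<le> p"
  shows "complete_on (sobolev_sys N t p :: 'n::finite sys set) (sum_norm N t p)"
  unfolding complete_on_def
proof (intro allI impI, elim conjE)
  fix F :: "nat \<Rightarrow> 'n sys"
  assume F: "\<forall>i. F i \<in> sobolev_sys N t p" and Cau: "\<forall>e>0. \<exists>M. \<forall>i\<ge>M. \<forall>j\<ge>M. sum_norm N t p (F i - F j) < e"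
  have dif: "weak_diff \<alpha> ((F i - F j) k) = weak_diff \<alpha> (F i k) - weak_diff \<alpha> (F j k)"
    if "k \<in> {1..N}" "mdeg \<alpha> \<le> t k" for k \<alpha> i j
    using F that unfolding sobolev_sys_iff[OF p] sys_apply by (intro weakly_diff_diff(2)[where l = "t k"]) auto
  have lim: "\<exists>v. in_Lp p v \<and> (\<lambda>i. Lp_norm p (weak_diff \<alpha> (F i k) - v)) \<longlonglongrightarrow> 0"
    if k: "k \<in> {1..N}" "mdeg \<alpha> \<le> t k" for k \<alpha>
  proof (rule Lp_complete[OF p])
    show "in_Lp p (weak_diff \<alpha> (F i k))" for i using F k unfolding sobolev_sys_iff[OF p] by blast
    show "\<exists>M. \<forall>i\<ge>M. \<forall>j\<ge>M. Lp_norm p (weak_diff \<alpha> (F i k) - weak_diff \<alpha> (F j k)) < e" if e: "e > 0" for e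
    proof -
      obtain M where M: "\<And>i j. i \<ge> M \<Longrightarrow> j \<ge> M \<Longrightarrow> sum_norm N t p (F i - F j) < e" using Cau e by blast
      have "Lp_norm p (weak_diff \<alpha> (F i k) - weak_diff \<alpha> (F j k)) < e" if "i \<ge> M" "j \<ge> M" for i j
        using Lp_norm_le_sum_norm[where u = "F i - F j" and t = t and p = p, OF k] M[OF that] unfolding dif[OF k] by linarith
      then show ?thesis by blast
    qed
  qed
  define v where "v k \<alpha> = (SOME v. in_Lp p v \<and> (\<lambda>i. Lp_norm p (weak_diff \<alpha> (F i k) - v)) \<longlonglongrightarrow> 0)" for k \<alpha>
  have v: "in_Lp p (v k \<alpha>)" "(\<lambda>i. Lp_norm p (weak_diff \<alpha> (F i k) - v k \<alpha>)) \<longlonglongrightarrow> 0"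
    if "k \<in> {1..N}" "mdeg \<alpha> \<le> t k" for k \<alpha>
    using someI_ex[OF lim[OF that]] unfolding v_def by blast+
  define u where "u k = (if k \<in> {1..N} then v k (\<lambda>_. 0) else 0)" for k
  have w: "weak_deriv \<alpha> (u k) (v k \<alpha>)" if k: "k \<in> {1..N}" "mdeg \<alpha> \<le> t k" for k \<alpha>
  proof (rule weak_deriv_Lp_limit[OF p])
    have z: "mdeg (\<lambda>_::'n. 0) \<le> t k" by simp
    have Fk: "weakly_diff (t k) (F i k)" for i using F k unfolding sobolev_sys_iff[OF p] by blast
    show "in_Lp p (F i k)" for i using F k unfolding sobolev_sys_def sobolev_def by blast
    show "in_Lp p (u k)" using v(1)[OF k(1) z] k(1) by (simp add: u_def)
    show "(\<lambda>i. Lp_norm p (F i k - u k)) \<longlonglongrightarrow> 0"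
      using v(2)[OF k(1) z] k(1) weak_diff_zero_midx[OF weakly_diff_loc_int[OF Fk]] by (simp add: u_def)
    show "in_Lp p (weak_diff \<alpha> (F i k))" for i using F k unfolding sobolev_sys_iff[OF p] by blast
    show "weak_deriv \<alpha> (F i k) (weak_diff \<alpha> (F i k))" for i by (rule weakly_diffD[OF Fk k(2)])
  qed (rule v[OF k])+
  have wd: "weak_diff \<alpha> (u k) = v k \<alpha>" if "k \<in> {1..N}" "mdeg \<alpha> \<le> t k" for k \<alpha>
    using w[OF that] by (rule weak_diff_eq)
  have uX: "u \<in> sobolev_sys N t p"
    unfolding sobolev_sys_iff[OF p]
  proof (intro conjI ballI allI impI)
    show "weakly_diff (t k) (u k)" if "k \<in> {1..N}" for k using w[OF that] by (blast intro: weakly_diffI)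
    show "in_Lp p (weak_diff \<alpha> (u k))" if "k \<in> {1..N}" "mdeg \<alpha> \<le> t k" for k \<alpha>
      using v(1)[OF that] wd[OF that] by simp
    show "u k = 0" if "k \<notin> {1..N}" for k using that unfolding u_def by (rule if_not_P)
  qed
  have "(\<lambda>i. sum_norm N t p (F i - u)) \<longlonglongrightarrow> (\<Sum>k = 1..N. \<Sum>\<alpha> :: 'n midx | mdeg \<alpha> \<le> t k. 0)"
    unfolding sum_norm_def
  proof (intro tendsto_sum)
    fix k and \<alpha> :: "'n midx" assume k: "k \<in> {1..N}" "\<alpha> \<in> {\<alpha>. mdeg \<alpha> \<le> t k}"
    then have k': "k \<in> {1..N}" "mdeg \<alpha> \<le> t k" by auto
    have "weak_diff \<alpha> ((F i - u) k) = weak_diff \<alpha> (F i k) - v k \<alpha>" for i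
      using F uX k' unfolding sobolev_sys_iff[OF p] sys_apply wd[OF k', symmetric]
      by (intro weakly_diff_diff(2)[where l = "t k"]) auto
    then show "(\<lambda>i. Lp_norm p (weak_diff \<alpha> ((F i - u) k))) \<longlonglongrightarrow> 0"
      using v(2)[OF k'] by simp
  qed
  then show "\<exists>u\<in>sobolev_sys N t p. (\<lambda>i. sum_norm N t p (F i - u)) \<longlonglongrightarrow> 0"
    using uX by auto
qed

lemma norm_on_Lp_sys: "1 \<le> p \<Longrightarrow> norm_on (Lp_sys N p :: 'n::finite sys set) (sum_norm N (\<lambda>_. 0) p)"
  using norm_on_sobolev_sys[of p N "\<lambda>_. 0"] by (simp add: Lp_sys_eq_sobolev_sys)

lemma complete_on_Lp_sys: "1 \<le> p \<Longrightarrow> complete_on (Lp_sys N p :: 'n::finite sys set) (sum_norm N (\<lambda>_. 0) p)"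
  using complete_on_sobolev_sys[of p N "\<lambda>_. 0"] by (simp add: Lp_sys_eq_sobolev_sys)

lemma sum_powr_le_powr_sum:
  fixes f :: "'i \<Rightarrow> real"
  assumes "finite I" "\<And>i. i \<in> I \<Longrightarrow> 0 \<le> f i" "1 \<le> p"
  shows "(\<Sum>i\<in>I. f i powr p) \<le> (\<Sum>i\<in>I. f i) powr p"
proof -
  let ?S = "\<Sum>i\<in>I. f i"
  have S: "0 \<le> ?S" using assms(2) by (rule sum_nonneg)
  have powr_split: "x powr p = x * x powr (p - 1)" if "0 \<le> x" for x :: real
    using that powr_add[of x 1 "p - 1"] by (cases "x = 0") auto
  have "(\<Sum>i\<in>I. f i powr p) \<le> (\<Sum>i\<in>I. f i * ?S powr (p - 1))"
  proof (rule sum_mono)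
    fix i assume i: "i \<in> I"
    have "f i \<le> ?S" using i assms(1,2) by (intro member_le_sum) auto
    then have "f i powr (p - 1) \<le> ?S powr (p - 1)" using assms(2)[OF i] assms(3) by (intro powr_mono2) auto
    then show "f i powr p \<le> f i * ?S powr (p - 1)"
      using assms(2)[OF i] powr_split[OF assms(2)[OF i]] by (simp add: mult_left_mono)
  qed
  also have "\<dots> = ?S powr p" using powr_split[OF S] by (simp add: sum_distrib_right)
  finally show ?thesis .
qed

lemma sobolev_sys_norm_le_sum_norm:
  assumes "1 \<le> p"
  shows "sobolev_sys_norm N t p u \<le> sum_norm N t p u"
  unfolding sobolev_sys_norm_def sum_norm_def
proof (rule sum_mono)
  fix k
  let ?f = "\<lambda>\<alpha>. Lp_norm p (weak_diff \<alpha> (u k))"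
  have "(\<Sum>\<alpha> | mdeg \<alpha> \<le> t k. ?f \<alpha> powr p) powr (1 / p) \<le> ((\<Sum>\<alpha> | mdeg \<alpha> \<le> t k. ?f \<alpha>) powr p) powr (1 / p)"
    using assms by (intro powr_mono2 sum_powr_le_powr_sum) (auto simp: finite_mdeg_le intro: sum_nonneg)
  also have "\<dots> = (\<Sum>\<alpha> | mdeg \<alpha> \<le> t k. ?f \<alpha>)"
    using assms by (simp add: powr_powr sum_nonneg)
  finally show "sobolev_norm p (t k) (u k) \<le> (\<Sum>\<alpha> | mdeg \<alpha> \<le> t k. ?f \<alpha>)"
    unfolding sobolev_norm_def .
qed

section \<open>The differential operator on weakly differentiable systems\<close>

definition weakly_diff_sys :: "nat \<Rightarrow> (nat \<Rightarrow> nat) \<Rightarrow> 'n::finite sys set" where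
  "weakly_diff_sys N t = {u. (\<forall>k\<in>{1..N}. weakly_diff (t k) (u k)) \<and> (\<forall>k. k \<notin> {1..N} \<longrightarrow> u k = 0)}"

lemma sobolev_sys_weakly_diff: "1 \<le> p \<Longrightarrow> sobolev_sys N t p \<subseteq> weakly_diff_sys N t"
  unfolding weakly_diff_sys_def by (auto simp: sobolev_sys_iff)

lemma weakly_diff_sys_subspace: "sys.subspace (weakly_diff_sys N t :: 'n::finite sys set)"
  unfolding weakly_diff_sys_def
  by (rule sys.subspaceI) (auto simp: weakly_diff_zero weakly_diff_add weakly_diff_scale)

lemma linear_on_shifted_A_op:
  fixes a :: "'n::finite coeffs"
  assumes s: "\<And>j. j \<in> {1..N} \<Longrightarrow> s j = 0"
  shows "linear_on sscale (weakly_diff_sys N t) (shifted (A_op N s t a) z)"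
  unfolding linear_on_def
proof (intro conjI ballI allI)
  show "sys.subspace (weakly_diff_sys N t :: 'n sys set)" by (rule weakly_diff_sys_subspace)
  fix u :: "'n sys" assume u: "u \<in> weakly_diff_sys N t"
  show "shifted (A_op N s t a) z (u + v) = shifted (A_op N s t a) z u + shifted (A_op N s t a) z v"
    if v: "v \<in> weakly_diff_sys N t" for v
  proof
    fix j
    have "A_op N s t a (u + v) j = A_op N s t a u j + A_op N s t a v j"
    proof (cases "j \<in> {1..N}")
      case True
      have "fmult (a j k \<alpha>) (D_op \<alpha> ((u + v) k)) = fmult (a j k \<alpha>) (D_op \<alpha> (u k)) + fmult (a j k \<alpha>) (D_op \<alpha> (v k))"
        if "k \<in> {1..N}" "mdeg \<alpha> \<le> s j + t k" for k \<alpha>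
        using u v that s[OF True] weakly_diff_add(2)[of "t k" "u k" "v k" \<alpha>]
        by (simp add: weakly_diff_sys_def D_op_def fmult_add)
      then have "A_op N s t a (u + v) j = (\<Sum>k = 1..N. \<Sum>\<alpha> | mdeg \<alpha> \<le> s j + t k.
          fmult (a j k \<alpha>) (D_op \<alpha> (u k)) + fmult (a j k \<alpha>) (D_op \<alpha> (v k)))"
        using True unfolding A_op_def by (simp only: if_True) (intro sum.cong refl, simp)
      then show ?thesis using True by (simp add: A_op_def sum.distrib)
    qed (auto simp: A_op_def)
    then show "shifted (A_op N s t a) z (u + v) j = (shifted (A_op N s t a) z u + shifted (A_op N s t a) z v) j"
      by (simp add: shifted_def fmult_add)
  qed
  show "shifted (A_op N s t a) z (sscale c u) = sscale c (shifted (A_op N s t a) z u)" for c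
  proof
    fix j
    have "A_op N s t a (sscale c u) j = fmult (\<lambda>x. c) (A_op N s t a u j)"
    proof (cases "j \<in> {1..N}")
      case True
      have "fmult (a j k \<alpha>) (D_op \<alpha> (sscale c u k)) = fmult (\<lambda>x. c) (fmult (a j k \<alpha>) (D_op \<alpha> (u k)))"
        if "k \<in> {1..N}" "mdeg \<alpha> \<le> s j + t k" for k \<alpha>
        using u that s[OF True] weakly_diff_scale(2)[of "t k" "u k" \<alpha> c]
        by (simp add: weakly_diff_sys_def D_op_def fmult_fmult mult_ac)
      then have "A_op N s t a (sscale c u) j = (\<Sum>k = 1..N. \<Sum>\<alpha> | mdeg \<alpha> \<le> s j + t k.
          fmult (\<lambda>x. c) (fmult (a j k \<alpha>) (D_op \<alpha> (u k))))"
        using True unfolding A_op_def by (simp only: if_True) (intro sum.cong refl, simp)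
      then show ?thesis using True by (simp add: A_op_def fmult_sum)
    qed (auto simp: A_op_def)
    then show "shifted (A_op N s t a) z (sscale c u) j = sscale c (shifted (A_op N s t a) z u) j"
      by (simp add: shifted_def fmult_diff fmult_fmult mult_ac)
  qed
qed

lemma linear_on_subset:
  "linear_on sscale X T \<Longrightarrow> sys.subspace Z \<Longrightarrow> Z \<subseteq> X \<Longrightarrow> linear_on sscale Z T"
  unfolding linear_on_def by blast

section \<open>Injective finite-rank perturbations\<close>

lemma linear_on_rank_op:
  assumes X: "sys.subspace X" "X \<subseteq> weakly_diff_sys N t"
    and l: "\<And>i. i < m \<Longrightarrow> ks i \<in> {1..N} \<and> cutoff_fun (hs i)"
  shows "linear_on sscale X (\<lambda>u. \<Sum>i<m::nat. sscale (pairing (u (ks i)) (hs i)) (c i))"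
  unfolding linear_on_def
proof (intro conjI ballI allI)
  have loc: "loc_int (u (ks i))" if "u \<in> X" "i < m" for u i
    using that X(2) l weakly_diff_loc_int unfolding weakly_diff_sys_def by blast
  show "(\<Sum>i<m. sscale (pairing ((u + v) (ks i)) (hs i)) (c i)) =
      (\<Sum>i<m. sscale (pairing (u (ks i)) (hs i)) (c i)) + (\<Sum>i<m. sscale (pairing (v (ks i)) (hs i)) (c i))"
    if "u \<in> X" "v \<in> X" for u v
    unfolding sum.distrib[symmetric]
  proof (rule sum.cong)
    fix i assume "i \<in> {..<m}"
    then have i: "i < m" by simp
    have "pairing ((u + v) (ks i)) (hs i) = pairing (u (ks i)) (hs i) + pairing (v (ks i)) (hs i)"
      unfolding sys_apply using l[OF i] by (intro pairing_add_left loc that i) auto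
    then show "sscale (pairing ((u + v) (ks i)) (hs i)) (c i) =
        sscale (pairing (u (ks i)) (hs i)) (c i) + sscale (pairing (v (ks i)) (hs i)) (c i)"
      by (simp only: sys.scale_left_distrib)
  qed simp
  show "(\<Sum>i<m. sscale (pairing (sscale b u (ks i)) (hs i)) (c i)) =
      sscale b (\<Sum>i<m. sscale (pairing (u (ks i)) (hs i)) (c i))" for b u
  proof -
    have "pairing (sscale b u (ks i)) (hs i) = b * pairing (u (ks i)) (hs i)" for i
      by (simp add: pairing_scale)
    then show ?thesis by (simp only: sys.scale_sum_right sys.scale_scale)
  qed
qed (rule X(1))

lemma rank_op_in_span: "(\<Sum>i<m::nat. sscale (l i) (c i)) \<in> sys.span (c ` {..<m})"
  by (intro sys.span_sum sys.span_scale sys.span_base) auto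

lemma fredholm_index_0E:
  assumes fr: "fredholm_with_index X Y nY T 0"
  obtains BK C BC where "finite BK" "{u \<in> X. T u = 0} \<subseteq> sys.span BK"
    "sys.subspace C" "C \<subseteq> Y" "finite BC" "C \<subseteq> sys.span BC" "C \<inter> T ` X = {0}"
    "Y = {f + g |f g. f \<in> T ` X \<and> g \<in> C}" "sys.dim {u \<in> X. T u = 0} = sys.dim C"
proof -
  have ker: "kernel_on X T = {u \<in> X. T u = 0}" by (simp add: kernel_on_def)
  obtain BK where BK: "finite BK" "{u \<in> X. T u = 0} \<subseteq> sys.span BK"
    using fr unfolding fredholm_with_index_def finite_dim_def ker by blast
  obtain C where C: "sys.subspace C" "C \<subseteq> Y" "finite_dim C" "C \<inter> T ` X = {0}"
      "Y = {f + g |f g. f \<in> T ` X \<and> g \<in> C}" and "int (sys.dim (kernel_on X T)) - int (sys.dim C) = 0"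
    using fr unfolding fredholm_with_index_def by blast
  then have dim: "sys.dim {u \<in> X. T u = 0} = sys.dim C" by (simp add: ker)
  obtain BC where BC: "finite BC" "C \<subseteq> sys.span BC" using C(3) unfolding finite_dim_def by blast
  show ?thesis by (rule that[OF BK C(1,2) BC C(4,5) dim])
qed

lemma fredholm_rank_perturbation_surj:
  assumes fr: "fredholm_with_index X Y nY T 0" and T: "linear_on sscale X T" and Y: "sys.subspace Y"
    and F: "linear_on sscale X F" "finite G" "G \<subseteq> Y" "F ` X \<subseteq> sys.span G"
    and inj: "\<And>u. u \<in> X \<Longrightarrow> T u + F u = 0 \<Longrightarrow> u = 0" and y: "y \<in> Y"
  shows "\<exists>u\<in>X. T u + F u = y"
proof -
  obtain BK C BC where BK: "finite BK" "{u \<in> X. T u = 0} \<subseteq> sys.span BK"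
    and C: "sys.subspace C" "C \<subseteq> Y" and BC: "finite BC" "C \<subseteq> sys.span BC" and C2: "C \<inter> T ` X = {0}"
    "Y = {f + g |f g. f \<in> T ` X \<and> g \<in> C}" and dim: "sys.dim {u \<in> X. T u = 0} = sys.dim C"
    by (rule fredholm_index_0E[OF fr])
  show ?thesis
    by (rule sys.finite_rank_perturbation_surj[OF T F(1) BK C(1) BC C2(1) Y C2(2) dim F(2,3,4) inj y])
qed

text \<open>Elements of \<open>L\<^sub>p\<close>, for every \<open>p\<close> at once, which are dense in each of these spaces.\<close>

definition cutoff_sys :: "nat \<Rightarrow> (nat \<Rightarrow> real ^ 'n::finite \<Rightarrow> complex) \<Rightarrow> 'n sys" where
  "cutoff_sys N \<gamma> = (\<lambda>k. if k \<in> {1..N} then abs_ae_fun (\<gamma> k) else 0)"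

lemma cutoff_sys_Lp: "0 < p \<Longrightarrow> (\<And>k. cutoff_fun (\<gamma> k)) \<Longrightarrow> cutoff_sys N \<gamma> \<in> Lp_sys N p"
  by (simp add: cutoff_sys_def Lp_sys_def in_Lp_cutoff)

lemma cutoff_sys_dense:
  fixes f :: "'n::finite sys"
  assumes p: "1 \<le> p" and f: "f \<in> Lp_sys N p" and e: "0 < e"
  shows "\<exists>\<gamma>. (\<forall>k. cutoff_fun (\<gamma> k)) \<and> Lp_sys_norm N p (f - cutoff_sys N \<gamma>) < e"
proof -
  define d where "d = e / (real N + 1)"
  have d: "d > 0" using e by (simp add: d_def)
  have "\<exists>g. cutoff_fun g \<and> (k \<in> {1..N} \<longrightarrow> Lp_norm p (f k - abs_ae_fun g) < d)" for k
  proof (cases "k \<in> {1..N}")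
    case True
    then have "in_Lp p (f k)" using f by (simp add: Lp_sys_def)
    from Lp_truncate[OF p this d] show ?thesis by blast
  next
    case False
    have "cutoff_fun (\<lambda>x :: real ^ 'n. 0)"
      unfolding cutoff_fun_def by (intro conjI exI[of _ 0] exI[of _ 0]) auto
    then show ?thesis using False by blast
  qed
  then obtain \<gamma> where \<gamma>: "\<And>k. cutoff_fun (\<gamma> k)" "\<And>k. k \<in> {1..N} \<Longrightarrow> Lp_norm p (f k - abs_ae_fun (\<gamma> k)) < d"
    by metis
  have "Lp_sys_norm N p (f - cutoff_sys N \<gamma>) \<le> (\<Sum>k = 1..N. d)"
    unfolding Lp_sys_norm_def using \<gamma>(2) by (intro sum_mono) (simp add: cutoff_sys_def less_imp_le)
  also have "\<dots> < e" using e d by (simp add: d_def field_simps)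
  finally show ?thesis using \<gamma>(1) by blast
qed

text \<open>The functionals are integrals against cut-off functions, so that they make sense on all locally
  integrable systems; finitely many of them separate the kernel of \<open>T\<close>. Pairing them with a basis of
  a complement of the range gives an invertible operator. As invertibility survives small
  perturbations, the basis may be replaced by nearby cut-off functions.\<close>

lemma injective_cutoff_perturbation:
  fixes T :: "'n::finite sys \<Rightarrow> 'n sys"
  assumes X_eq: "X = sobolev_sys N t q" and Y_eq: "Y = Lp_sys N q"
    and q: "1 \<le> q" and N: "1 \<le> N"
    and T: "linear_on sscale X T"
    and TY: "T ` X \<subseteq> Y"
    and bd: "\<And>u. u \<in> X \<Longrightarrow> Lp_sys_norm N q (T u) \<le> C0 * sum_norm N t q u"
    and fr: "fredholm_with_index X Y nY T 0"
  shows "\<exists>m ks hs \<gamma> M. 0 < M \<and> (\<forall>i<m::nat. ks i \<in> {1..N} \<and> cutoff_fun (hs i) \<and> (\<forall>k. cutoff_fun (\<gamma> i k))) \<and>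
    (\<forall>u\<in>X. sum_norm N t q u \<le>
       M * Lp_sys_norm N q (T u + (\<Sum>i<m. sscale (pairing (u (ks i)) (hs i)) (cutoff_sys N (\<gamma> i)))))"
proof -
  let ?nX = "sum_norm N t q" and ?nY = "sum_norm N (\<lambda>_. 0) q"
  have X: "norm_on X ?nX" "complete_on X ?nX" unfolding X_eq by (rule norm_on_sobolev_sys[OF q] complete_on_sobolev_sys[OF q])+
  have Y: "norm_on Y ?nY" "complete_on Y ?nY" unfolding Y_eq by (rule norm_on_Lp_sys[OF q] complete_on_Lp_sys[OF q])+
  have sX: "sys.subspace X" and sY: "sys.subspace Y" by (rule norm_on_subspace[OF X(1)] norm_on_subspace[OF Y(1)])+
  have XW: "X \<subseteq> weakly_diff_sys N t" unfolding X_eq by (rule sobolev_sys_weakly_diff[OF q])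
  let ?K = "{u \<in> X. T u = 0}"
  obtain BK C BC where BK: "finite BK" "?K \<subseteq> sys.span BK"
    and C: "sys.subspace C" "C \<subseteq> Y" and BC: "finite BC" "C \<subseteq> sys.span BC" and CT: "C \<inter> T ` X = {0}"
    and "Y = {f + g |f g. f \<in> T ` X \<and> g \<in> C}" and dim: "sys.dim ?K = sys.dim C"
    by (rule fredholm_index_0E[OF fr])
  obtain D where D: "finite D" "D \<subseteq> C" "\<not> sys.dependent D" "card D = sys.dim C"
    using sys.finite_basis_exists[OF BC] by blast
  define m where "m = card D"
  obtain c where c: "bij_betw c {..<m} D"
    using ex_bij_betw_nat_finite[OF D(1)] unfolding m_def atLeast0LessThan by blast
  have cinv: "the_inv_into {..<m} c (c i) = i" if "i < m" for i
    using c that by (intro the_inv_into_f_f) (auto simp: bij_betw_def)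
  have cC: "c i \<in> C" if "i < m" for i using c that D(2) by (auto simp: bij_betw_def)
  have sK: "sys.subspace ?K"
  proof (rule sys.subspaceI)
    show "0 \<in> ?K" using sys.subspace_0[OF sX] sys.linear_on_zero[OF T] by simp
    show "u + v \<in> ?K" if "u \<in> ?K" "v \<in> ?K" for u v
      using that T sys.subspace_add[OF sX] unfolding linear_on_def by simp
    show "sscale b u \<in> ?K" if "u \<in> ?K" for b u
      using that T sys.subspace_scale[OF sX] unfolding linear_on_def by simp
  qed
  define L where "L = {\<lambda>u :: 'n sys. pairing (u k) h |k h. k \<in> {1..N} \<and> cutoff_fun h}"
  have "\<exists>ls :: nat \<Rightarrow> 'n sys \<Rightarrow> complex. (\<forall>i<m. ls i \<in> L) \<and> (\<forall>u\<in>?K. (\<forall>i<m. ls i u = 0) \<longrightarrow> u = 0)"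
  proof (rule sys.separating_functionals[OF sK BK])
    show "sys.dim ?K \<le> m" using dim D(4) by (simp add: m_def)
    have loc: "loc_int (u k)" if "u \<in> X" "k \<in> {1..N}" for u k
      using that XW weakly_diff_loc_int unfolding weakly_diff_sys_def by blast
    show "\<forall>l\<in>L. (\<forall>u\<in>?K. \<forall>v\<in>?K. l (u + v) = l u + l v) \<and> (\<forall>b. \<forall>u\<in>?K. l (sscale b u) = b * l u)"
      unfolding L_def using loc by (auto simp: pairing_add_left pairing_scale)
    show "\<forall>u\<in>?K. u \<noteq> 0 \<longrightarrow> (\<exists>l\<in>L. l u \<noteq> 0)"
    proof (intro ballI impI)
      fix u assume u: "u \<in> ?K" "u \<noteq> 0"
      then obtain k where k: "u k \<noteq> 0" by (metis ext sys_apply(4))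
      have kN: "k \<in> {1..N}" using k u(1) unfolding X_eq sobolev_sys_def by blast
      have "u \<in> X" using u(1) by simp
      then have "loc_int (u k)" using kN by (rule loc)
      then have "\<not> (\<forall>\<phi>. test_function \<phi> \<longrightarrow> pairing (u k) \<phi> = 0)"
        using fundamental_lemma[of "u k"] k by metis
      then obtain \<phi> where \<phi>: "test_function \<phi>" "pairing (u k) \<phi> \<noteq> 0" by auto
      have "(\<lambda>u. pairing (u k) \<phi>) \<in> L"
        unfolding L_def using kN test_function_cutoff[OF \<phi>(1)] by (intro CollectI exI[of _ k] exI[of _ \<phi>]) simp
      then show "\<exists>l\<in>L. l u \<noteq> 0" by (rule rev_bexI) (rule \<phi>(2))
    qed
    have "cutoff_fun (\<lambda>x :: real ^ 'n. 0)"
      unfolding cutoff_fun_def by (intro conjI exI[of _ 0] exI[of _ 0]) auto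
    then have "(\<lambda>u. pairing (u 1) (\<lambda>x. 0)) \<in> L"
      unfolding L_def using N by (intro CollectI exI[of _ 1] exI[of _ "\<lambda>x. 0"]) simp
    then show "L \<noteq> {}" by (metis empty_iff)
  qed
  then obtain ls :: "nat \<Rightarrow> 'n sys \<Rightarrow> complex" where ls: "\<And>i. i < m \<Longrightarrow> ls i \<in> L"
    and lsep: "\<And>u. u \<in> ?K \<Longrightarrow> (\<And>i. i < m \<Longrightarrow> ls i u = 0) \<Longrightarrow> u = 0" by blast
  have "\<forall>i. \<exists>k h. i < m \<longrightarrow> ls i = (\<lambda>u. pairing (u k) h) \<and> k \<in> {1..N} \<and> cutoff_fun h"
    using ls unfolding L_def by blast
  then obtain ks hs where kh: "\<And>i. i < m \<Longrightarrow> ls i = (\<lambda>u. pairing (u (ks i)) (hs i)) \<and> ks i \<in> {1..N} \<and> cutoff_fun (hs i)"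
    by metis
  let ?l = "\<lambda>i u. pairing (u (ks i)) (hs i)"
  define F where "F c u = (\<Sum>i<m. sscale (?l i u) (c i))" for c :: "nat \<Rightarrow> 'n sys" and u
  have linF: "linear_on sscale X (F c')" for c'
    unfolding F_def by (rule linear_on_rank_op[OF sX XW]) (use kh in blast)
  have FY: "F c' u \<in> Y" if "\<And>i. i < m \<Longrightarrow> c' i \<in> Y" for c' u
    unfolding F_def using that by (intro sys.subspace_sum[OF sY] sys.subspace_scale[OF sY]) auto
  have surj: "\<exists>u\<in>X. T u + F c' u = y"
    if "\<And>i. i < m \<Longrightarrow> c' i \<in> Y" "\<And>u. u \<in> X \<Longrightarrow> T u + F c' u = 0 \<Longrightarrow> u = 0" "y \<in> Y" for c' y
  proof (rule fredholm_rank_perturbation_surj[OF fr T sY linF])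
    show "finite (c' ` {..<m})" by simp
    show "c' ` {..<m} \<subseteq> Y" using that(1) by auto
    show "F c' ` X \<subseteq> sys.span (c' ` {..<m})" unfolding F_def by (intro image_subsetI rank_op_in_span)
  qed (use that in auto)
  have inj: "u = 0" if u: "u \<in> X" "T u + F c u = 0" for u
  proof -
    have "F c u \<in> C" unfolding F_def using cC by (intro sys.subspace_sum[OF C(1)] sys.subspace_scale[OF C(1)]) auto
    then have "- F c u \<in> C" by (rule sys.subspace_neg[OF C(1)])
    moreover have "T u = - F c u" using u(2) by (simp only: eq_neg_iff_add_eq_0)
    ultimately have "T u \<in> C" by simp
    then have "T u \<in> C \<inter> T ` X" using u(1) by blast
    then have Tu: "T u = 0" using CT by blast
    have Fz: "(\<Sum>i<m. sscale (?l i u) (c i)) = 0" using u(2) Tu unfolding F_def by (simp only: add_0_left)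
    have dsum: "(\<Sum>d\<in>D. sscale (?l (the_inv_into {..<m} c d) u) d) = 0"
    proof -
      have "(\<Sum>d\<in>D. sscale (?l (the_inv_into {..<m} c d) u) d) =
          (\<Sum>i<m. sscale (?l (the_inv_into {..<m} c (c i)) u) (c i))"
        by (rule sum.reindex_bij_betw[OF c, symmetric])
      also have "\<dots> = (\<Sum>i<m. sscale (?l i u) (c i))"
        by (rule sum.cong[OF refl]) (simp only: cinv lessThan_iff)
      also note Fz
      finally show ?thesis .
    qed
    have z: "?l (the_inv_into {..<m} c d) u = 0" if "d \<in> D" for d
      by (rule sys.independentD[OF D(3,1) subset_refl, of "\<lambda>d. ?l (the_inv_into {..<m} c d) u"]) (rule dsum, rule that)
    have "ls i u = 0" if "i < m" for i
    proof -
      have "c i \<in> D" using bij_betw_apply[OF c, of i] that by simp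
      from z[OF this] show ?thesis using kh[OF that] by (simp only: cinv[OF that])
    qed
    then show "u = 0" using lsep[of u] u(1) Tu by blast
  qed
  have cY: "c i \<in> Y" if "i < m" for i using cC[OF that] C(2) by blast
  have lin0: "linear_on sscale X (\<lambda>u. T u + F c u)" by (rule sys.linear_on_add[OF T linF])
  have im0: "(\<lambda>u. T u + F c u) ` X = Y"
  proof
    show "(\<lambda>u. T u + F c u) ` X \<subseteq> Y"
    proof
      fix y assume "y \<in> (\<lambda>u. T u + F c u) ` X"
      then obtain u where u: "u \<in> X" "y = T u + F c u" by blast
      have "T u \<in> Y" using u(1) TY by blast
      then show "y \<in> Y" unfolding u(2) using FY[of c u, OF cY] by (rule sys.subspace_add[OF sY])
    qed
    show "Y \<subseteq> (\<lambda>u. T u + F c u) ` X"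
    proof
      fix y assume "y \<in> Y"
      from surj[of c, OF cY inj this] obtain u where "u \<in> X" "T u + F c u = y" by blast
      then show "y \<in> (\<lambda>u. T u + F c u) ` X" by blast
    qed
  qed
    have "\<exists>B\<ge>0. i < m \<longrightarrow> (\<forall>u\<in>X. norm (?l i u) \<le> B * ?nX u)" for i
  proof (cases "i < m")
    case True
    obtain B where B: "B \<ge> 0" "\<And>v. in_Lp q v \<Longrightarrow> norm (pairing v (hs i)) \<le> B * Lp_norm q v"
      using pairing_Lp_bound[OF q, of "hs i"] kh[OF True] by blast
    have "norm (?l i u) \<le> B * ?nX u" if u: "u \<in> X" for u
    proof -
      have k: "ks i \<in> {1..N}" using kh[OF True] by blast
      have "weak_diff (\<lambda>_. 0) (u (ks i)) = u (ks i)"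
        using u k weak_diff_zero_midx weakly_diff_loc_int unfolding X_eq sobolev_sys_iff[OF q] by blast
      then have "Lp_norm q (u (ks i)) \<le> ?nX u"
        using Lp_norm_le_sum_norm[where \<alpha> = "\<lambda>_. 0" and t = t and u = u and p = q, OF k] by simp
      moreover have "in_Lp q (u (ks i))" using u k unfolding X_eq sobolev_sys_def sobolev_def by blast
      ultimately show ?thesis using B(2)[of "u (ks i)"] mult_left_mono[OF _ B(1), of "Lp_norm q (u (ks i))" "?nX u"] by linarith
    qed
    then show ?thesis using B(1) by blast
  qed blast
  then obtain B where B: "\<And>i. B i \<ge> 0" "\<And>i u. i < m \<Longrightarrow> u \<in> X \<Longrightarrow> norm (?l i u) \<le> B i * ?nX u" by metis
  have nF: "?nY (F c' u) \<le> (\<Sum>i<m. B i * ?nY (c' i)) * ?nX u" if c': "\<And>i. i < m \<Longrightarrow> c' i \<in> Y" and u: "u \<in> X" for c' u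
  proof -
    have le: "j \<le> m \<Longrightarrow> ?nY (\<Sum>i<j. sscale (?l i u) (c' i)) \<le> (\<Sum>i<j. B i * ?nY (c' i)) * ?nX u" for j
    proof (induction j)
      case 0
      show ?case unfolding lessThan_0 sum.empty norm_on_zero[OF Y(1)] by simp
    next
      case (Suc j)
      have m1: "(\<Sum>i<j. sscale (?l i u) (c' i)) \<in> Y" "sscale (?l j u) (c' j) \<in> Y"
        using c' Suc.prems by (auto intro!: sys.subspace_sum[OF sY] sys.subspace_scale[OF sY])
      have "?nY (sscale (?l j u) (c' j)) = norm (?l j u) * ?nY (c' j)"
        using c' Suc.prems by (intro norm_on_scale[OF Y(1)]) auto
      also have "\<dots> \<le> (B j * ?nX u) * ?nY (c' j)"
        using B(2)[OF _ u, of j] Suc.prems by (intro mult_right_mono sum_norm_nonneg) auto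
      finally have "?nY (sscale (?l j u) (c' j)) \<le> B j * ?nY (c' j) * ?nX u" by (simp add: mult_ac)
      moreover have "?nY (\<Sum>i<j. sscale (?l i u) (c' i)) \<le> (\<Sum>i<j. B i * ?nY (c' i)) * ?nX u"
        by (rule Suc.IH) (use Suc.prems in simp)
      ultimately show ?case
        using norm_on_triangle[OF Y(1) m1] unfolding sum.lessThan_Suc distrib_right by linarith
    qed
    show ?thesis unfolding F_def by (rule le) simp
  qed
  have TuY: "T u \<in> Y" if "u \<in> X" for u using that TY by blast
  have bd': "?nY (T u) \<le> C0 * ?nX u" if "u \<in> X" for u
    using bd[OF that] Lp_sys_norm_eq_sum_norm[OF q TuY[OF that, unfolded Y_eq]] by simp
  have bd0: "?nY (T u + F c u) \<le> (C0 + (\<Sum>i<m. B i * ?nY (c i))) * ?nX u" if u: "u \<in> X" for u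
    using norm_on_triangle[OF Y(1) TuY[OF u] FY[of c u, OF cY]] bd'[OF u] nF[of c u, OF cY u] unfolding distrib_right by linarith
  obtain M where M: "M > 0" "\<And>u. u \<in> X \<Longrightarrow> ?nX u \<le> M * ?nY (T u + F c u)"
    using bounded_inverse[OF X Y lin0 im0 bd0 inj] by blast
  define e where "e = 1 / (2 * M * ((\<Sum>i<m. B i) + 1))"
  have Bs: "(\<Sum>i<m. B i) \<ge> 0" using B(1) by (simp add: sum_nonneg)
  have e: "e > 0" using M(1) Bs by (simp add: e_def)
  have "\<exists>\<gamma>. i < m \<longrightarrow> (\<forall>k. cutoff_fun (\<gamma> k)) \<and> Lp_sys_norm N q (c i - cutoff_sys N \<gamma>) < e" for i
    using cutoff_sys_dense[OF q cY[unfolded Y_eq] e] by blast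
  then obtain \<gamma> where \<gamma>: "\<And>i. i < m \<Longrightarrow> (\<forall>k. cutoff_fun (\<gamma> i k)) \<and> Lp_sys_norm N q (c i - cutoff_sys N (\<gamma> i)) < e"
    by metis
  let ?g = "\<lambda>i. cutoff_sys N (\<gamma> i)"
  have gY: "?g i \<in> Y" if "i < m" for i using \<gamma>[OF that] q unfolding Y_eq by (intro cutoff_sys_Lp) auto
  have dY: "c i - ?g i \<in> Y" if "i < m" for i using sys.subspace_diff[OF sY cY[OF that] gY[OF that]] .
  have small: "?nY (c i - ?g i) \<le> e" if "i < m" for i
    using \<gamma>[OF that] Lp_sys_norm_eq_sum_norm[OF q dY[OF that, unfolded Y_eq]] by simp
  have "?nX u \<le> 2 * M * Lp_sys_norm N q (T u + F ?g u)" if u: "u \<in> X" for u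
  proof -
    have gu: "T u + F ?g u \<in> Y" by (rule sys.subspace_add[OF sY TuY[OF u] FY[of ?g u, OF gY]])
    have du: "F (\<lambda>i. c i - ?g i) u \<in> Y" by (rule FY[of "\<lambda>i. c i - ?g i" u, OF dY])
    have split: "T u + F c u = (T u + F ?g u) + F (\<lambda>i. c i - ?g i) u"
    proof -
      have "F c u = F ?g u + F (\<lambda>i. c i - ?g i) u"
        unfolding F_def sum.distrib[symmetric] sys.scale_right_distrib[symmetric]
        by (intro sum.cong refl arg_cong2[where f = sscale]) (rule sym, subst add.commute, rule diff_add_cancel)
      then show ?thesis by (simp only: add.assoc)
    qed
    have "?nY (F (\<lambda>i. c i - ?g i) u) \<le> (\<Sum>i<m. B i * ?nY (c i - ?g i)) * ?nX u"
      by (rule nF[of "\<lambda>i. c i - ?g i" u, OF dY u])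
    also have "\<dots> \<le> (\<Sum>i<m. B i * e) * ?nX u"
      using small B(1) by (intro mult_right_mono sum_mono mult_left_mono sum_norm_nonneg) auto
    also have "(\<Sum>i<m. B i * e) = (\<Sum>i<m. B i) * e" by (simp only: sum_distrib_right)
    finally have 1: "?nY (F (\<lambda>i. c i - ?g i) u) \<le> (\<Sum>i<m. B i) * e * ?nX u" .
    have "M * ((\<Sum>i<m. B i) * e) \<le> 1 / 2"
      using M(1) Bs unfolding e_def by (simp add: divide_simps add_nonneg_pos)
    then have 2: "M * ((\<Sum>i<m. B i) * e * ?nX u) \<le> 1 / 2 * ?nX u"
      using mult_right_mono[of "M * ((\<Sum>i<m. B i) * e)" "1 / 2" "?nX u"] sum_norm_nonneg[of N t q u] by (simp add: mult_ac)
    have "?nX u \<le> M * ?nY (T u + F c u)" using M(2)[OF u] .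
    also have "\<dots> \<le> M * (?nY (T u + F ?g u) + (\<Sum>i<m. B i) * e * ?nX u)"
      unfolding split using norm_on_triangle[OF Y(1) gu du] 1 M(1) by (intro mult_left_mono) auto
    also have "\<dots> \<le> M * ?nY (T u + F ?g u) + 1 / 2 * ?nX u" using 2 by (simp add: distrib_left)
    finally have "?nX u \<le> 2 * M * ?nY (T u + F ?g u)" by simp
    then show ?thesis using Lp_sys_norm_eq_sum_norm[OF q gu[unfolded Y_eq]] by simp
  qed
  then show ?thesis
    using M(1) kh \<gamma> unfolding F_def
    by (intro exI[of _ m] exI[of _ ks] exI[of _ hs] exI[of _ \<gamma>] exI[of _ "2 * M"]) auto
qed

section \<open>Decaying weights\<close>

text \<open>The weight \<open>\<Prod>i. sech (s x i)\<close> is integrable, and each of its partial derivatives is \<open>s\<close> times a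
  function which it dominates. Since \<open>sech' = - sech tanh\<close> and \<open>tanh' = 1 - tanh\<^sup>2\<close>, differentiation
  preserves the form \<open>sech y \<cdot> p (tanh y)\<close> with a polynomial \<open>p\<close>, on which it acts as the following
  operator.\<close>

definition sech_deriv_poly :: "real poly \<Rightarrow> real poly" where
  "sech_deriv_poly p = [:0, - 1:] * p + [:1, 0, - 1:] * pderiv p"

definition sech_poly :: "real poly \<Rightarrow> real \<Rightarrow> real" where
  "sech_poly p y = poly p (tanh y) / cosh y"

lemma sech_poly_has_derivative:
  "(sech_poly p has_real_derivative sech_poly (sech_deriv_poly p) y) (at y)"
proof -
  have "((\<lambda>y. poly p (tanh y) / cosh y) has_real_derivative
      (poly (pderiv p) (tanh y) * (1 - tanh y ^ 2) * cosh y - poly p (tanh y) * sinh y) / (cosh y * cosh y)) (at y)"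
    by (auto intro!: derivative_eq_intros DERIV_chain2[OF poly_DERIV])
  also have "(poly (pderiv p) (tanh y) * (1 - tanh y ^ 2) * cosh y - poly p (tanh y) * sinh y) / (cosh y * cosh y)
      = sech_poly (sech_deriv_poly p) y"
    by (simp add: sech_poly_def sech_deriv_poly_def tanh_def divide_simps power2_eq_square) (simp add: algebra_simps)
  finally show ?thesis unfolding sech_poly_def[abs_def] .
qed

definition weight :: "real \<Rightarrow> ('n::finite \<Rightarrow> real poly) \<Rightarrow> real ^ 'n \<Rightarrow> complex" where
  "weight s P x = (\<Prod>i\<in>UNIV. complex_of_real (sech_poly (P i) (s * x $ i)))"

abbreviation base_weight :: "real \<Rightarrow> real ^ 'n::finite \<Rightarrow> complex" where
  "base_weight s \<equiv> weight s (\<lambda>_. 1)"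

lemma smooth_weight_factor:
  "smooth (\<lambda>x :: real ^ 'n::finite. complex_of_real (sech_poly p (s * x $ i)))"
  using smooth_compose_coordinate[of "\<lambda>k. sech_poly ((sech_deriv_poly ^^ k) p)" 0 s i 0]
    sech_poly_has_derivative by simp

lemma smooth_weight: "smooth (weight s P :: real ^ 'n::finite \<Rightarrow> complex)"
  unfolding weight_def[abs_def] by (intro smooth_prod smooth_weight_factor) auto

lemma pdiff_weight:
  "pdiff j (weight s P) = (\<lambda>x. complex_of_real s * weight s (P(j := sech_deriv_poly (P j))) x)"
proof
  fix x :: "real ^ 'a"
  let ?R = "\<Prod>i\<in>UNIV - {j}. complex_of_real (sech_poly (P i) (s * x $ i))"
  have "((\<lambda>h. sech_poly (P j) (s * (x $ j + h))) has_real_derivative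
      sech_poly (sech_deriv_poly (P j)) (s * (x $ j + 0)) * s) (at 0)"
    by (rule DERIV_chain2[where f = "sech_poly (P j)", OF sech_poly_has_derivative])
      (auto intro!: derivative_eq_intros)
  then have "((\<lambda>h. complex_of_real (sech_poly (P j) (s * (x $ j + h)))) has_vector_derivative
      complex_of_real (sech_poly (sech_deriv_poly (P j)) (s * x $ j) * s)) (at 0)"
    using bounded_linear.has_vector_derivative[OF bounded_linear_of_real[where 'a = complex]]
    by (fastforce simp: has_real_derivative_iff_has_vector_derivative)
  from has_vector_derivative_mult_complex[OF this has_vector_derivative_const[of ?R]]
  have der: "((\<lambda>h. complex_of_real (sech_poly (P j) (s * (x $ j + h))) * ?R) has_vector_derivative
      complex_of_real (sech_poly (sech_deriv_poly (P j)) (s * x $ j) * s) * ?R) (at 0)" by simp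
  have shift: "weight s P (x + h *\<^sub>R axis j 1) = complex_of_real (sech_poly (P j) (s * (x $ j + h))) * ?R" for h
    unfolding weight_def
    by (subst prod.remove[of _ j]) (auto simp: axis_def intro!: prod.cong)
  have rhs: "complex_of_real s * weight s (P(j := sech_deriv_poly (P j))) x =
      complex_of_real (sech_poly (sech_deriv_poly (P j)) (s * x $ j) * s) * ?R"
    unfolding weight_def
    by (subst prod.remove[of _ j]) (auto intro!: prod.cong)
  show "pdiff j (weight s P) x = complex_of_real s * weight s (P(j := sech_deriv_poly (P j))) x"
    unfolding rhs by (rule pdiff_eqI) (unfold shift, rule der)
qed

lemma base_weight_eq: "base_weight s x = complex_of_real (\<Prod>i\<in>UNIV. 1 / cosh (s * x $ i))"
  by (simp add: weight_def sech_poly_def)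

lemma base_weight_nonzero: "base_weight s x \<noteq> 0"
  by (simp add: base_weight_eq)

lemma norm_base_weight: "norm (base_weight s x) = (\<Prod>i\<in>UNIV. 1 / cosh (s * x $ i))"
  unfolding base_weight_eq norm_of_real by (intro abs_of_nonneg prod_nonneg) auto

lemma norm_base_weight_le_1: "norm (base_weight s x) \<le> 1"
  unfolding norm_base_weight using cosh_real_ge_1 by (intro prod_le_1) auto

lemma continuous_weight: "continuous_on UNIV (weight s P)"
  by (rule smooth_continuous[OF smooth_weight])

lemma continuous_measurable_lebesgue:
  fixes w :: "real ^ 'n::finite \<Rightarrow> complex"
  assumes "continuous_on UNIV w"
  shows "w \<in> borel_measurable lebesgue"
  using borel_measurable_continuous_onI[OF assms] by (intro measurable_completion) simp

lemma weight_dominated: "\<exists>K\<ge>0. \<forall>s x. norm (weight s P x) \<le> K * norm (base_weight s (x :: real ^ 'n::finite))"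
proof -
  have "\<exists>B\<ge>0. \<forall>y. \<bar>poly (P i) (tanh y)\<bar> \<le> B" for i
  proof -
    have "compact (poly (P i) ` {-1..1})"
      by (intro compact_continuous_image continuous_intros) auto
    then have "bounded (poly (P i) ` {-1..1})" by (rule compact_imp_bounded)
    then obtain B where "\<forall>z\<in>poly (P i) ` {-1..1}. norm z \<le> B" unfolding bounded_iff by blast
    then have B: "\<And>y. y \<in> {-1..1} \<Longrightarrow> \<bar>poly (P i) y\<bar> \<le> B" by simp
    have "tanh y \<in> {-1..1}" for y :: real using tanh_real_bounds[of y] by auto
    then have "\<bar>poly (P i) (tanh y)\<bar> \<le> B" for y using B by blast
    moreover from this[of 0] have "B \<ge> 0" by linarith
    ultimately show ?thesis by blast
  qed
  then obtain B where B: "\<And>i. B i \<ge> 0" "\<And>i y. \<bar>poly (P i) (tanh y)\<bar> \<le> B i" by metis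
  have "norm (weight s P x) \<le> (\<Prod>i\<in>UNIV. B i) * norm (base_weight s x)" for s and x :: "real ^ 'n"
  proof -
    have "norm (weight s P x) = (\<Prod>i\<in>UNIV. \<bar>sech_poly (P i) (s * x $ i)\<bar>)"
      unfolding weight_def by (simp add: prod_norm[symmetric])
    also have "\<dots> \<le> (\<Prod>i\<in>UNIV. B i * (1 / cosh (s * x $ i)))"
      unfolding sech_poly_def using B by (intro prod_mono) (auto simp: divide_right_mono)
    also have "\<dots> = (\<Prod>i\<in>UNIV. B i) * norm (base_weight s x)"
      unfolding norm_base_weight by (rule prod.distrib)
    finally show ?thesis .
  qed
  then show ?thesis using B(1) by (intro exI[of _ "\<Prod>i\<in>UNIV. B i"]) (simp add: prod_nonneg)
qed

subsection \<open>Integrability and the inclusion of Lebesgue spaces\<close>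

text \<open>An antiderivative of \<open>sech\<close> is \<open>arctan \<circ> sinh\<close>.\<close>

lemma nn_integral_sech_finite:
  assumes s: "s > 0"
  shows "(\<integral>\<^sup>+y. ennreal (1 / cosh (s * y)) \<partial>lborel) < \<infinity>"
proof -
  let ?f = "\<lambda>y. 1 / cosh (s * y)"
  have m[measurable]: "(\<lambda>y. 1 / cosh (s * y)) \<in> borel_measurable borel"
    by (intro borel_measurable_continuous_onI continuous_intros) auto
  have "((\<lambda>y. arctan (sinh (s * y)) / s) \<longlongrightarrow> (pi / 2) / s) at_top"
  proof (intro tendsto_divide tendsto_const)
    have "filterlim (\<lambda>y. s * y) at_top at_top"
      using s by (intro filterlim_tendsto_pos_mult_at_top[OF tendsto_const _ filterlim_ident])
    then have "filterlim (\<lambda>y. sinh (s * y)) at_top at_top"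
      by (rule filterlim_compose[OF sinh_real_at_top])
    then show "((\<lambda>y. arctan (sinh (s * y))) \<longlongrightarrow> pi / 2) at_top"
      by (rule filterlim_compose[OF tendsto_arctan_at_top])
  qed (use s in auto)
  moreover have "((\<lambda>y. arctan (sinh (s * y)) / s) has_real_derivative 1 / cosh (s * y)) (at y)" for y
  proof -
    have "1 + (sinh (s * y))\<^sup>2 = cosh (s * y) * cosh (s * y)"
      using cosh_square_eq[of "s * y"] by (simp add: power2_eq_square)
    then show ?thesis using s
      by (auto intro!: derivative_eq_intros simp: divide_simps)
  qed
  ultimately have "(\<integral>\<^sup>+y. ennreal (?f y) * indicator {0..} y \<partial>lborel) = ennreal ((pi / 2) / s - arctan (sinh (s * 0)) / s)"
    by (intro nn_integral_FTC_atLeast m) auto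
  then have pos: "(\<integral>\<^sup>+y. ennreal (?f y) * indicator {0..} y \<partial>lborel) < \<infinity>" by simp
  have "(\<integral>\<^sup>+y. ennreal (?f y) * indicator {..0} y \<partial>lborel) = (\<integral>\<^sup>+y. ennreal (?f (0 + (-1) * y)) * indicator {..0} (0 + (-1) * y) \<partial>lborel)"
    by (subst nn_integral_real_affine[where c = "-1" and t = 0]) auto
  also have "\<dots> = (\<integral>\<^sup>+y. ennreal (?f y) * indicator {0..} y \<partial>lborel)"
    by (intro nn_integral_cong) (auto simp: indicator_def)
  finally have neg: "(\<integral>\<^sup>+y. ennreal (?f y) * indicator {..0} y \<partial>lborel) < \<infinity>" using pos by simp
  have "(\<integral>\<^sup>+y. ennreal (?f y) \<partial>lborel) \<le> (\<integral>\<^sup>+y. ennreal (?f y) * indicator {0..} y + ennreal (?f y) * indicator {..0} y \<partial>lborel)"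
    by (intro nn_integral_mono) (auto simp: indicator_def)
  also have "\<dots> = (\<integral>\<^sup>+y. ennreal (?f y) * indicator {0..} y \<partial>lborel) + (\<integral>\<^sup>+y. ennreal (?f y) * indicator {..0} y \<partial>lborel)"
    by (intro nn_integral_add) auto
  also have "\<dots> < \<infinity>" using pos neg by simp
  finally show ?thesis .
qed

lemma integrable_base_weight:
  assumes s: "s > 0"
  shows "integrable lebesgue (\<lambda>x :: real ^ 'n::finite. norm (base_weight s x))"
proof -
  have m: "(\<lambda>x :: real ^ 'n. norm (base_weight s x)) \<in> borel_measurable borel"
    by (intro borel_measurable_continuous_onI continuous_intros continuous_weight)
  have mf: "(\<lambda>y. 1 / cosh (s * y)) \<in> borel_measurable borel"
    by (intro borel_measurable_continuous_onI continuous_intros) auto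
  have coord: "(\<Prod>b\<in>Basis. 1 / cosh (s * (x \<bullet> b))) = norm (base_weight s x)" for x :: "real ^ 'n"
  proof -
    have "(\<Prod>b\<in>Basis. 1 / cosh (s * (x \<bullet> b))) = (\<Prod>b\<in>range (\<lambda>i :: 'n. axis i (1::real)). 1 / cosh (s * (x \<bullet> b)))"
      by (rule prod.cong) (auto simp: Basis_vec_def)
    also have "\<dots> = (\<Prod>i\<in>UNIV. 1 / cosh (s * x $ i))"
      by (subst prod.reindex) (auto simp: inj_on_def axis_eq_axis inner_axis)
    finally show ?thesis by (simp add: norm_base_weight)
  qed
  have "(\<integral>\<^sup>+x. ennreal (norm (base_weight s (x :: real ^ 'n))) \<partial>lborel) =
      (\<integral>\<^sup>+x. (\<Prod>b\<in>(Basis :: (real ^ 'n) set). ennreal (1 / cosh (s * (x \<bullet> b)))) \<partial>lborel)"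
    by (intro nn_integral_cong) (subst prod_ennreal, auto simp: coord)
  also have "\<dots> = (\<Prod>b\<in>(Basis :: (real ^ 'n) set). \<integral>\<^sup>+y. ennreal (1 / cosh (s * y)) \<partial>lborel)"
    using mf by (intro nn_integral_lborel_prod) auto
  also have "\<dots> < \<infinity>"
    using nn_integral_sech_finite[OF s] by (simp add: power_less_top_ennreal)
  finally have "integrable lborel (\<lambda>x :: real ^ 'n. norm (base_weight s x))"
    using m by (intro integrableI_nonneg) auto
  then show ?thesis by (subst integrable_completion) (use m in auto)
qed

text \<open>For \<open>q \<le> p\<close>, the weight \<open>w\<close> maps \<open>L\<^sub>p\<close> into \<open>L\<^sub>q\<close>, because
  \<open>\<bar>w f\<bar>\<^sup>q \<le> w \<bar>f\<bar>\<^sup>q \<le> w (1 + \<bar>f\<bar>\<^sup>p) \<le> w + \<bar>f\<bar>\<^sup>p\<close>.\<close>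

lemma in_Lp_base_weight:
  assumes s: "s > 0" and q: "1 \<le> q" "q \<le> p" and u: "in_Lp p u"
  shows "in_Lp q (fmult (base_weight s) u)"
proof -
  obtain f where f: "u = abs_ae_fun f" by (rule ae_fun_cases)
  have fp: "in_Lp_fun p f" using u by (simp add: f in_Lp.abs_eq)
  have m: "(\<lambda>x. base_weight s x * f x) \<in> borel_measurable lebesgue"
    using in_Lp_fun_measurable[OF fp] continuous_measurable_lebesgue[OF continuous_weight] by (intro borel_measurable_times)
  have i: "integrable lebesgue (\<lambda>x. norm (base_weight s x) + norm (f x) powr p)"
    using fp integrable_base_weight[OF s] by (auto simp: in_Lp_fun_def)
  have le: "norm (base_weight s x * f x) powr q \<le> norm (base_weight s x) + norm (f x) powr p" for x
  proof -
    let ?w = "norm (base_weight s x)"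
    have w: "0 \<le> ?w" "?w \<le> 1" using norm_base_weight_le_1[of s x] by auto
    have "?w powr q \<le> ?w powr 1"
      using w q(1) by (intro powr_mono') auto
    then have 1: "?w powr q \<le> ?w" using w by simp
    have 2: "norm (f x) powr q \<le> 1 + norm (f x) powr p"
    proof (cases "norm (f x) \<le> 1")
      case True
      then have "norm (f x) powr q \<le> 1" using q by (simp add: powr_le_one_le powr_le1)
      then show ?thesis by (simp add: add_increasing2)
    next
      case False
      then have "norm (f x) powr q \<le> norm (f x) powr p" using q by (intro powr_mono) auto
      then show ?thesis by simp
    qed
    have "norm (base_weight s x * f x) powr q = ?w powr q * norm (f x) powr q"
      by (simp add: norm_mult powr_mult)
    also have "\<dots> \<le> ?w * (1 + norm (f x) powr p)"
      using 1 2 w by (intro mult_mono) auto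
    also have "\<dots> \<le> ?w + norm (f x) powr p"
      using w mult_right_mono[of ?w 1 "norm (f x) powr p"] by (simp add: distrib_left)
    finally show ?thesis .
  qed
  have "integrable lebesgue (\<lambda>x. norm (base_weight s x * f x) powr q)"
    by (rule Bochner_Integration.integrable_bound[OF i])
      (use m le in \<open>auto intro!: AE_I2 order_trans[OF _ abs_ge_self]\<close>)
  then have "in_Lp_fun q (\<lambda>x. base_weight s x * f x)" using m by (simp add: in_Lp_fun_def)
  then show ?thesis by (simp add: f fmult.abs_eq in_Lp.abs_eq)
qed

subsection \<open>The Leibniz rule for the weight\<close>

text \<open>A triple \<open>(j, P, \<beta>)\<close> stands for the term \<open>s\<^sup>j weight s P D\<^sup>\<beta> u\<close>.\<close>

type_synonym 'n wterm = "nat \<times> ('n \<Rightarrow> real poly) \<times> 'n midx"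

definition wterm_val :: "real \<Rightarrow> 'n::finite ae_fun \<Rightarrow> 'n wterm \<Rightarrow> 'n ae_fun" where
  "wterm_val s u = (\<lambda>(j, P, \<beta>). fmult (\<lambda>x. complex_of_real s ^ j) (fmult (weight s P) (weak_diff \<beta> u)))"

definition wterm_diff :: "'n \<Rightarrow> 'n wterm \<Rightarrow> 'n::finite wterm list" where
  "wterm_diff i = (\<lambda>(j, P, \<beta>). [(j, P, \<beta>(i := Suc (\<beta> i))), (Suc j, P(i := sech_deriv_poly (P i)), \<beta>)])"

lemma weak_pdiff_wterm:
  assumes u: "weakly_diff l u" and T: "mdeg (snd (snd T)) < l"
  shows "weak_pdiff i (wterm_val s u T) (sum_list (map (wterm_val s u) (wterm_diff i T)))"
proof -
  obtain j P \<beta> where Teq: "T = (j, P, \<beta>)" by (cases T) auto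
  have \<beta>: "mdeg \<beta> < l" using T Teq by simp
  have "weak_pdiff i (weak_diff \<beta> u) (weak_diff (\<beta>(i := Suc (\<beta> i))) u)"
    using \<beta> by (intro weak_pdiff_weak_deriv[OF weakly_diffD[OF u] weakly_diffD[OF u]]) auto
  from weak_pdiff_scale[OF weak_pdiff_mult[OF this smooth_weight[of s P]], of "complex_of_real s ^ j"]
  have "weak_pdiff i (wterm_val s u T) (fmult (\<lambda>x. complex_of_real s ^ j)
      (fmult (weight s P) (weak_diff (\<beta>(i := Suc (\<beta> i))) u) +
       fmult (\<lambda>x. complex_of_real s * weight s (P(i := sech_deriv_poly (P i))) x) (weak_diff \<beta> u)))"
    by (simp add: Teq wterm_val_def pdiff_weight)
  then show ?thesis
    by (simp add: Teq wterm_val_def wterm_diff_def fmult_add fmult_fmult mult_ac)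
qed

lemma weak_pdiff_wterms:
  assumes u: "weakly_diff l u" and Ts: "\<And>T. T \<in> set Ts \<Longrightarrow> mdeg (snd (snd T)) < l"
  shows "weak_pdiff i (sum_list (map (wterm_val s u) Ts))
    (sum_list (map (wterm_val s u) (concat (map (wterm_diff i) Ts))))"
  using Ts
proof (induction Ts)
  case Nil
  show ?case by (simp add: weak_pdiff_zero)
next
  case (Cons T Ts)
  have "weak_pdiff i (wterm_val s u T) (sum_list (map (wterm_val s u) (wterm_diff i T)))"
    by (rule weak_pdiff_wterm[OF u]) (simp add: Cons.prems)
  moreover have "weak_pdiff i (sum_list (map (wterm_val s u) Ts))
      (sum_list (map (wterm_val s u) (concat (map (wterm_diff i) Ts))))"
    by (rule Cons.IH) (simp add: Cons.prems)
  ultimately show ?case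
    unfolding list.map sum_list.Cons concat.simps map_append sum_list_append by (rule weak_pdiff_add)
qed

lemma wterm_diff_degree:
  "T \<in> set (wterm_diff i T0) \<Longrightarrow> mdeg (snd (snd T)) \<le> Suc (mdeg (snd (snd T0))) \<and> fst T0 \<le> fst T"
  by (cases T0) (auto simp: wterm_diff_def)

text \<open>All terms other than \<open>w D\<^sup>\<alpha> u\<close> carry a factor \<open>s\<close>, because they arise by
  differentiating the weight at least once.\<close>

lemma weight_leibniz_terms:
  fixes \<alpha> :: "'n::finite midx"
  shows "\<exists>Ts. (\<forall>T\<in>set Ts. mdeg (snd (snd T)) < mdeg \<alpha> \<and> 0 < fst T) \<and>
    (\<forall>s u. weakly_diff (mdeg \<alpha>) u \<longrightarrow> weak_deriv \<alpha> (fmult (base_weight s) u)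
       (sum_list (map (wterm_val s u) ((0, (\<lambda>_. 1), \<alpha>) # Ts))))"
proof (induction \<alpha> rule: midx_induct)
  case zero
  have "weak_deriv (\<lambda>_. 0) (fmult (base_weight s) u) (sum_list (map (wterm_val s u) [(0, (\<lambda>_. 1), (\<lambda>_. 0))]))"
    if "weakly_diff (mdeg (\<lambda>_. 0 :: nat)) u" for s and u :: "'n ae_fun"
    using weakly_diff_loc_int[OF that] weak_diff_zero_midx[of u]
    by (auto simp: wterm_val_def weak_deriv_zero_iff loc_int_fmult_continuous continuous_weight)
  then show ?case by (intro exI[of _ "[]"]) auto
next
  case (upd \<alpha> i)
  then obtain Ts where Ts: "\<And>T. T \<in> set Ts \<Longrightarrow> mdeg (snd (snd T)) < mdeg \<alpha> \<and> 0 < fst T"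
    and wd: "\<And>s u. weakly_diff (mdeg \<alpha>) u \<Longrightarrow> weak_deriv \<alpha> (fmult (base_weight s) u)
       (sum_list (map (wterm_val s u) ((0, (\<lambda>_. 1), \<alpha>) # Ts)))" by blast
  let ?\<alpha> = "\<alpha>(i := Suc (\<alpha> i))" and ?Ts = "(0, (\<lambda>_. 1), \<alpha>) # Ts"
  define Us where "Us = (Suc 0, (\<lambda>_. 1)(i := sech_deriv_poly 1), \<alpha>) # concat (map (wterm_diff i) Ts)"
  have eq: "concat (map (wterm_diff i) ?Ts) = (0, (\<lambda>_. 1), ?\<alpha>) # Us"
    by (simp add: Us_def wterm_diff_def)
  have "mdeg (snd (snd T)) < mdeg ?\<alpha> \<and> 0 < fst T" if TU: "T \<in> set Us" for T
  proof (cases "T = (Suc 0, (\<lambda>_. 1)(i := sech_deriv_poly 1), \<alpha>)")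
    case True
    then show ?thesis by simp
  next
    case False
    then obtain T0 where T0: "T0 \<in> set Ts" "T \<in> set (wterm_diff i T0)"
      using TU unfolding Us_def by auto
    show ?thesis using wterm_diff_degree[OF T0(2)] Ts[OF T0(1)] by simp
  qed
  moreover have "weak_deriv ?\<alpha> (fmult (base_weight s) u) (sum_list (map (wterm_val s u) ((0, (\<lambda>_. 1), ?\<alpha>) # Us)))"
    if u: "weakly_diff (mdeg ?\<alpha>) u" for s u
  proof -
    have "weakly_diff (mdeg \<alpha>) u" using u by (simp add: weakly_diff_def)
    from wd[OF this] have "weak_deriv \<alpha> (fmult (base_weight s) u) (sum_list (map (wterm_val s u) ?Ts))" .
    moreover have "mdeg (snd (snd T)) < mdeg ?\<alpha>" if "T \<in> set ?Ts" for T
      using that Ts[of T] by auto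
    then have "weak_pdiff i (sum_list (map (wterm_val s u) ?Ts)) (sum_list (map (wterm_val s u) ((0, (\<lambda>_. 1), ?\<alpha>) # Us)))"
      unfolding eq[symmetric] by (rule weak_pdiff_wterms[OF u])
    ultimately show ?thesis by (rule weak_deriv_weak_pdiff)
  qed
  ultimately show ?case by blast
qed

definition weighted_norm :: "real \<Rightarrow> real \<Rightarrow> nat \<Rightarrow> 'n::finite ae_fun \<Rightarrow> real" where
  "weighted_norm s q l u = (\<Sum>\<beta> | mdeg \<beta> \<le> l. Lp_norm q (fmult (base_weight s) (weak_diff \<beta> u)))"

lemma weighted_norm_nonneg: "0 \<le> weighted_norm s q l u"
  unfolding weighted_norm_def by (intro sum_nonneg) auto

definition weighted_sobolev :: "real \<Rightarrow> real \<Rightarrow> nat \<Rightarrow> 'n::finite ae_fun \<Rightarrow> bool" where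
  "weighted_sobolev s q l u \<longleftrightarrow> weakly_diff l u \<and>
     (\<forall>\<beta>. mdeg \<beta> \<le> l \<longrightarrow> in_Lp q (fmult (base_weight s) (weak_diff \<beta> u)))"

text \<open>A term with \<open>j > 0\<close> is \<open>s\<close> times a bounded function times \<open>w D\<^sup>\<beta> u\<close>, uniformly in \<open>s \<le> 1\<close>.\<close>

lemma wterm_bound:
  "\<exists>K\<ge>0. \<forall>s\<in>{0<..1}. \<forall>q l u. 1 \<le> q \<longrightarrow> mdeg (snd (snd T)) \<le> l \<longrightarrow> weighted_sobolev s q l u \<longrightarrow> 0 < fst T \<longrightarrow>
     (\<exists>r. wterm_val s u T = fmult (\<lambda>x. complex_of_real s) r \<and> in_Lp q r \<and> Lp_norm q r \<le> K * weighted_norm s q l u)"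
proof -
  obtain j P \<beta> where Teq: "T = (j, P, \<beta>)" by (cases T) auto
  obtain K where K: "K \<ge> 0" "\<And>s x. norm (weight s P x) \<le> K * norm (base_weight s x)"
    using weight_dominated[of P] by blast
  have "\<exists>r. wterm_val s u T = fmult (\<lambda>x. complex_of_real s) r \<and> in_Lp q r \<and> Lp_norm q r \<le> K * weighted_norm s q l u"
    if s: "s \<in> {0<..1}" and q: "1 \<le> q" and \<beta>: "mdeg \<beta> \<le> l" and u: "weighted_sobolev s q l u" and j: "0 < j" for s q l u
  proof -
    let ?a = "\<lambda>x. complex_of_real s ^ (j - 1) * (weight s P x / base_weight s x)"
    let ?r = "fmult ?a (fmult (base_weight s) (weak_diff \<beta> u))"
    have in_q: "in_Lp q (fmult (base_weight s) (weak_diff \<beta> u))" using u \<beta> by (simp add: weighted_sobolev_def)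
    have am: "?a \<in> borel_measurable lebesgue"
      by (intro continuous_measurable_lebesgue continuous_intros continuous_weight) (auto simp: base_weight_nonzero)
    have ab: "norm (?a x) \<le> K" for x
    proof -
      have "s ^ (j - 1) \<le> 1" using s by (intro power_le_one) auto
      moreover have "norm (weight s P x) / norm (base_weight s x) \<le> K"
        using K(2)[of s x] base_weight_nonzero[of s x] by (simp add: divide_le_eq)
      ultimately have "s ^ (j - 1) * (norm (weight s P x) / norm (base_weight s x)) \<le> 1 * K"
        using s by (intro mult_mono) auto
      then show ?thesis using s by (simp add: norm_mult norm_divide norm_power)
    qed
    have "wterm_val s u T = fmult (\<lambda>x. complex_of_real s) ?r"
    proof -
      have "complex_of_real s * (?a x * base_weight s x) = complex_of_real s ^ j * weight s P x" for x
        using j base_weight_nonzero[of s x] by (cases j) (auto simp: field_simps)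
      then show ?thesis unfolding Teq wterm_val_def by (simp add: fmult_fmult)
    qed
    moreover have "in_Lp q ?r" "Lp_norm q ?r \<le> K * Lp_norm q (fmult (base_weight s) (weak_diff \<beta> u))"
      using q by (intro fmult_bounded[OF _ in_q am K(1) ab]; simp)+
    moreover have "Lp_norm q (fmult (base_weight s) (weak_diff \<beta> u)) \<le> weighted_norm s q l u"
      unfolding weighted_norm_def using \<beta>
      by (intro member_le_sum[where f = "\<lambda>\<beta>. Lp_norm q (fmult (base_weight s) (weak_diff \<beta> u))"]) (auto simp: finite_mdeg_le)
    ultimately show ?thesis using K(1) by (meson mult_left_mono order_trans)
  qed
  then show ?thesis using K(1) unfolding Teq by auto
qed

lemma wterms_bound:
  "\<exists>K\<ge>0. \<forall>s\<in>{0<..1}. \<forall>q l u. 1 \<le> q \<longrightarrow> (\<forall>T\<in>set Ts. mdeg (snd (snd T)) \<le> l \<and> 0 < fst T) \<longrightarrow> weighted_sobolev s q l u \<longrightarrow>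
     (\<exists>r. sum_list (map (wterm_val s u) Ts) = fmult (\<lambda>x. complex_of_real s) r \<and> in_Lp q r \<and> Lp_norm q r \<le> K * weighted_norm s q l u)"
proof (induction Ts)
  case Nil
  show ?case by (intro exI[of _ 0]) (auto intro!: exI[of _ 0])
next
  case (Cons T Ts)
  obtain K1 where K1: "K1 \<ge> 0" "\<And>s q l u. s \<in> {0<..1} \<Longrightarrow> 1 \<le> q \<Longrightarrow> (\<forall>T\<in>set Ts. mdeg (snd (snd T)) \<le> l \<and> 0 < fst T) \<Longrightarrow>
     weighted_sobolev s q l u \<Longrightarrow>
     (\<exists>r. sum_list (map (wterm_val s u) Ts) = fmult (\<lambda>x. complex_of_real s) r \<and> in_Lp q r \<and> Lp_norm q r \<le> K1 * weighted_norm s q l u)"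
    using Cons.IH by blast
  obtain K2 where K2: "K2 \<ge> 0" "\<And>s q l u. s \<in> {0<..1} \<Longrightarrow> 1 \<le> q \<Longrightarrow> mdeg (snd (snd T)) \<le> l \<Longrightarrow>
     weighted_sobolev s q l u \<Longrightarrow> 0 < fst T \<Longrightarrow>
     (\<exists>r. wterm_val s u T = fmult (\<lambda>x. complex_of_real s) r \<and> in_Lp q r \<and> Lp_norm q r \<le> K2 * weighted_norm s q l u)"
    using wterm_bound[of T] by blast
  have "\<exists>r. sum_list (map (wterm_val s u) (T # Ts)) = fmult (\<lambda>x. complex_of_real s) r \<and> in_Lp q r \<and>
      Lp_norm q r \<le> (K1 + K2) * weighted_norm s q l u"
    if s: "s \<in> {0<..1}" and q: "1 \<le> q" and Ts: "\<forall>T'\<in>set (T # Ts). mdeg (snd (snd T')) \<le> l \<and> 0 < fst T'"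
      and u: "weighted_sobolev s q l u" for s q l u
  proof -
    obtain r1 where r1: "sum_list (map (wterm_val s u) Ts) = fmult (\<lambda>x. complex_of_real s) r1" "in_Lp q r1"
        "Lp_norm q r1 \<le> K1 * weighted_norm s q l u"
      using K1(2)[OF s q _ u] Ts by auto
    obtain r2 where r2: "wterm_val s u T = fmult (\<lambda>x. complex_of_real s) r2" "in_Lp q r2"
        "Lp_norm q r2 \<le> K2 * weighted_norm s q l u"
      using K2(2)[OF s q _ u] Ts by auto
    have "sum_list (map (wterm_val s u) (T # Ts)) = fmult (\<lambda>x. complex_of_real s) (r2 + r1)"
      by (simp add: r1(1) r2(1) fmult_add)
    moreover have "Lp_norm q (r2 + r1) \<le> (K1 + K2) * weighted_norm s q l u"
      using Lp_norm_add[OF q r2(2) r1(2)] r1(3) r2(3) by (simp add: distrib_right)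
    ultimately show ?thesis using in_Lp_add[OF q r2(2) r1(2)] by blast
  qed
  then show ?case using K1(1) K2(1) by (intro exI[of _ "K1 + K2"]) simp
qed

lemma weighted_leibniz:
  fixes \<alpha> :: "'n::finite midx"
  shows "\<exists>K\<ge>0. \<forall>s\<in>{0<..1}. \<forall>q l u. 1 \<le> q \<longrightarrow> mdeg \<alpha> \<le> l \<longrightarrow> weighted_sobolev s q l u \<longrightarrow>
    (\<exists>r. weak_deriv \<alpha> (fmult (base_weight s) u)
           (fmult (base_weight s) (weak_diff \<alpha> u) + fmult (\<lambda>x. complex_of_real s) r) \<and>
       in_Lp q r \<and> Lp_norm q r \<le> K * weighted_norm s q l u)"
proof -
  obtain Ts where Ts: "\<And>T. T \<in> set Ts \<Longrightarrow> mdeg (snd (snd T)) < mdeg \<alpha> \<and> 0 < fst T"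
    and wd: "\<And>s u. weakly_diff (mdeg \<alpha>) u \<Longrightarrow> weak_deriv \<alpha> (fmult (base_weight s) u)
       (sum_list (map (wterm_val s u) ((0, (\<lambda>_. 1), \<alpha>) # Ts)))"
    using weight_leibniz_terms[of \<alpha>] by blast
  obtain K where K: "K \<ge> 0" "\<And>s q l u. s \<in> {0<..1} \<Longrightarrow> 1 \<le> q \<Longrightarrow> (\<forall>T\<in>set Ts. mdeg (snd (snd T)) \<le> l \<and> 0 < fst T) \<Longrightarrow>
     weighted_sobolev s q l u \<Longrightarrow>
     (\<exists>r. sum_list (map (wterm_val s u) Ts) = fmult (\<lambda>x. complex_of_real s) r \<and> in_Lp q r \<and> Lp_norm q r \<le> K * weighted_norm s q l u)"
    using wterms_bound[of Ts] by blast
  have "\<exists>r. weak_deriv \<alpha> (fmult (base_weight s) u)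
           (fmult (base_weight s) (weak_diff \<alpha> u) + fmult (\<lambda>x. complex_of_real s) r) \<and>
       in_Lp q r \<and> Lp_norm q r \<le> K * weighted_norm s q l u"
    if s: "s \<in> {0<..1}" and q: "1 \<le> q" and \<alpha>: "mdeg \<alpha> \<le> l" and u: "weighted_sobolev s q l u" for s q l u
  proof -
    have "\<forall>T\<in>set Ts. mdeg (snd (snd T)) \<le> l \<and> 0 < fst T"
    proof
      fix T assume "T \<in> set Ts"
      from Ts[OF this] show "mdeg (snd (snd T)) \<le> l \<and> 0 < fst T" using \<alpha> by simp
    qed
    then obtain r where r: "sum_list (map (wterm_val s u) Ts) = fmult (\<lambda>x. complex_of_real s) r" "in_Lp q r"
        "Lp_norm q r \<le> K * weighted_norm s q l u"
      using K(2)[OF s q _ u] by blast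
    have "weakly_diff (mdeg \<alpha>) u" using u \<alpha> by (simp add: weighted_sobolev_def weakly_diff_def)
    moreover have "wterm_val s u (0, (\<lambda>_. 1), \<alpha>) = fmult (base_weight s) (weak_diff \<alpha> u)"
      by (simp add: wterm_val_def)
    ultimately have "weak_deriv \<alpha> (fmult (base_weight s) u)
        (fmult (base_weight s) (weak_diff \<alpha> u) + fmult (\<lambda>x. complex_of_real s) r)"
      using wd[of u s] by (simp add: r(1))
    then show ?thesis using r by blast
  qed
  then show ?thesis using K(1) by blast
qed

section \<open>Independence of the exponent\<close>

definition wmult :: "real \<Rightarrow> 'n::finite sys \<Rightarrow> 'n sys" where
  "wmult s u = (\<lambda>k. fmult (base_weight s) (u k))"

lemma wmult_apply [simp]: "wmult s u k = fmult (base_weight s) (u k)"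
  by (simp add: wmult_def)

lemma wmult_add: "wmult s (u + v) = wmult s u + wmult s v"
  by (rule ext) (simp add: fmult_add)

lemma wmult_scale: "wmult s (sscale c u) = sscale c (wmult s u)"
  by (rule ext) (simp add: fmult_fmult mult.commute)

lemma wmult_zero: "wmult s 0 = 0"
  by (rule ext) simp

lemma wmult_sum: "wmult s (\<Sum>i\<in>I. u i) = (\<Sum>i\<in>I. wmult s (u i))"
proof (induction I rule: infinite_finite_induct)
  case (infinite A)
  show ?case unfolding sum.infinite[OF infinite] by (rule wmult_zero)
next
  case empty
  show ?case unfolding sum.empty by (rule wmult_zero)
next
  case (insert x F)
  show ?case unfolding sum.insert[OF insert(1,2)] wmult_add insert(3) ..
qed

lemma wmult_eq_0: "wmult s u = 0 \<Longrightarrow> u = 0"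
proof
  fix k assume "wmult s u = 0"
  then have "fmult (base_weight s) (u k) = 0" by (metis sys_apply(4) wmult_apply)
  then have "fmult (\<lambda>x. inverse (base_weight s x)) (fmult (base_weight s) (u k)) = 0" by simp
  then show "u k = 0 k" by (simp add: fmult_fmult base_weight_nonzero)
qed

definition weighted_sys_norm :: "nat \<Rightarrow> (nat \<Rightarrow> nat) \<Rightarrow> real \<Rightarrow> real \<Rightarrow> 'n::finite sys \<Rightarrow> real" where
  "weighted_sys_norm N t s q u = (\<Sum>k = 1..N. weighted_norm s q (t k) (u k))"

lemma weighted_norm_le_sys_norm:
  "k \<in> {1..N} \<Longrightarrow> weighted_norm s q (t k) (u k) \<le> weighted_sys_norm N t s q u"
  unfolding weighted_sys_norm_def
  by (rule member_le_sum[where f = "\<lambda>k. weighted_norm s q (t k) (u k)"]) (auto simp: weighted_norm_nonneg)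

lemma weighted_sys_norm_nonneg: "0 \<le> weighted_sys_norm N t s q u"
  unfolding weighted_sys_norm_def by (intro sum_nonneg weighted_norm_nonneg)

text \<open>By the Leibniz rule the weight commutes with each \<open>D\<^sup>\<alpha>\<close> up to \<open>s\<close> times terms of the size of the
  \<open>w D\<^sup>\<beta> u\<close>, and multiplication by the bounded coefficients preserves this estimate.\<close>

lemma weighted_commutator:
  fixes a :: "'n::finite coeffs"
  assumes q: "1 \<le> q" and so: "\<And>j. j \<in> {1..N} \<Longrightarrow> so j = 0"
    and am: "\<And>j k \<alpha>. j \<in> {1..N} \<Longrightarrow> k \<in> {1..N} \<Longrightarrow> mdeg \<alpha> \<le> t k \<Longrightarrow> a j k \<alpha> \<in> borel_measurable lebesgue"
    and ab: "\<And>j k \<alpha>. j \<in> {1..N} \<Longrightarrow> k \<in> {1..N} \<Longrightarrow> mdeg \<alpha> \<le> t k \<Longrightarrow> \<exists>B\<ge>0. \<forall>x. norm (a j k \<alpha> x) \<le> B"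
  shows "\<exists>K\<ge>0. \<forall>s\<in>{0<..1}. \<forall>u\<in>weakly_diff_sys N t. (\<forall>k\<in>{1..N}. weighted_sobolev s q (t k) (u k)) \<longrightarrow>
    wmult s u \<in> sobolev_sys N t q \<and>
    weighted_sys_norm N t s q u \<le> sum_norm N t q (wmult s u) + s * K * weighted_sys_norm N t s q u \<and>
    Lp_sys_norm N q (shifted (A_op N so t a) z (wmult s u) - wmult s (shifted (A_op N so t a) z u))
      \<le> s * K * weighted_sys_norm N t s q u"
proof -
  have "\<forall>\<alpha> :: 'n midx. \<exists>K\<ge>0. \<forall>s\<in>{0<..1}. \<forall>q l u. 1 \<le> q \<longrightarrow> mdeg \<alpha> \<le> l \<longrightarrow> weighted_sobolev s q l u \<longrightarrow>
    (\<exists>r. weak_deriv \<alpha> (fmult (base_weight s) u)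
           (fmult (base_weight s) (weak_diff \<alpha> u) + fmult (\<lambda>x. complex_of_real s) r) \<and>
       in_Lp q r \<and> Lp_norm q r \<le> K * weighted_norm s q l u)"
    using weighted_leibniz by blast
  then obtain K :: "'n midx \<Rightarrow> real" where K0: "\<And>\<alpha>. 0 \<le> K \<alpha>"
    and K: "\<And>\<alpha> s l u. s \<in> {0<..1} \<Longrightarrow> mdeg \<alpha> \<le> l \<Longrightarrow> weighted_sobolev s q l u \<Longrightarrow>
      \<exists>r. weak_deriv \<alpha> (fmult (base_weight s) u)
           (fmult (base_weight s) (weak_diff \<alpha> u) + fmult (\<lambda>x. complex_of_real s) r) \<and>
       in_Lp q r \<and> Lp_norm q r \<le> K \<alpha> * weighted_norm s q l u"
    using q by metis
  have "\<forall>j k \<alpha>. \<exists>B\<ge>0. j \<in> {1..N} \<and> k \<in> {1..N} \<and> mdeg \<alpha> \<le> t k \<longrightarrow> (\<forall>x. norm (a j k \<alpha> x) \<le> B)"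
    using ab by (metis order_refl)
  then obtain B where B0: "\<And>j k \<alpha>. 0 \<le> B j k \<alpha>"
    and B: "\<And>j k \<alpha> x. j \<in> {1..N} \<Longrightarrow> k \<in> {1..N} \<Longrightarrow> mdeg \<alpha> \<le> t k \<Longrightarrow> norm (a j k \<alpha> x) \<le> B j k \<alpha>"
    by metis
  define K1 where "K1 = (\<Sum>k = 1..N. \<Sum>\<alpha> :: 'n midx | mdeg \<alpha> \<le> t k. K \<alpha>)"
  define K2 where "K2 = (\<Sum>j = 1..N. \<Sum>k = 1..N. \<Sum>\<alpha> | mdeg \<alpha> \<le> t k. B j k \<alpha> * K \<alpha>)"
  have K12: "0 \<le> K1" "0 \<le> K2" unfolding K1_def K2_def using K0 B0 by (auto intro!: sum_nonneg)
  have "wmult s u \<in> sobolev_sys N t q \<and>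
    weighted_sys_norm N t s q u \<le> sum_norm N t q (wmult s u) + s * (K1 + K2) * weighted_sys_norm N t s q u \<and>
    Lp_sys_norm N q (shifted (A_op N so t a) z (wmult s u) - wmult s (shifted (A_op N so t a) z u))
      \<le> s * (K1 + K2) * weighted_sys_norm N t s q u"
    if s: "s \<in> {0<..1}" and uW: "u \<in> weakly_diff_sys N t"
      and u: "\<And>k. k \<in> {1..N} \<Longrightarrow> weighted_sobolev s q (t k) (u k)" for s u
  proof -
    let ?w = "base_weight s" and ?n = "weighted_sys_norm N t s q u" and ?c = "\<lambda>x :: real ^ 'n. complex_of_real s"
    let ?v = "wmult s u"
    have s0: "0 < s" using s by simp
    have n0: "0 \<le> ?n" by (rule weighted_sys_norm_nonneg)
    have "\<exists>r. k \<in> {1..N} \<and> mdeg \<alpha> \<le> t k \<longrightarrow> weak_deriv \<alpha> (?v k) (fmult ?w (weak_diff \<alpha> (u k)) + fmult ?c r) \<and>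
       in_Lp q r \<and> Lp_norm q r \<le> K \<alpha> * ?n" for k \<alpha>
    proof (cases "k \<in> {1..N} \<and> mdeg \<alpha> \<le> t k")
      case True
      then obtain r where r: "weak_deriv \<alpha> (?v k) (fmult ?w (weak_diff \<alpha> (u k)) + fmult ?c r)"
          "in_Lp q r" "Lp_norm q r \<le> K \<alpha> * weighted_norm s q (t k) (u k)"
        using K[OF s _ u] by (metis wmult_apply)
      have "K \<alpha> * weighted_norm s q (t k) (u k) \<le> K \<alpha> * ?n"
        using True K0 by (intro mult_left_mono weighted_norm_le_sys_norm) auto
      then show ?thesis using r order_trans by blast
    qed blast
    then obtain r where r: "\<And>k \<alpha>. k \<in> {1..N} \<Longrightarrow> mdeg \<alpha> \<le> t k \<Longrightarrow>
        weak_deriv \<alpha> (?v k) (fmult ?w (weak_diff \<alpha> (u k)) + fmult ?c (r k \<alpha>))"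
      and rq: "\<And>k \<alpha>. k \<in> {1..N} \<Longrightarrow> mdeg \<alpha> \<le> t k \<Longrightarrow> in_Lp q (r k \<alpha>)"
      and rn: "\<And>k \<alpha>. k \<in> {1..N} \<Longrightarrow> mdeg \<alpha> \<le> t k \<Longrightarrow> Lp_norm q (r k \<alpha>) \<le> K \<alpha> * ?n"
      by metis
    have wd: "weak_diff \<alpha> (?v k) = fmult ?w (weak_diff \<alpha> (u k)) + fmult ?c (r k \<alpha>)"
      if "k \<in> {1..N}" "mdeg \<alpha> \<le> t k" for k \<alpha>
      using weak_diff_eq[OF r[OF that]] .
    have uq: "in_Lp q (fmult ?w (weak_diff \<alpha> (u k)))" if "k \<in> {1..N}" "mdeg \<alpha> \<le> t k" for k \<alpha>
      using u[OF that(1)] that(2) by (simp add: weighted_sobolev_def)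
    have crq: "in_Lp q (fmult ?c (r k \<alpha>))" if "k \<in> {1..N}" "mdeg \<alpha> \<le> t k" for k \<alpha>
      using q by (intro in_Lp_scale rq that) auto
    have vq: "in_Lp q (weak_diff \<alpha> (?v k))" if "k \<in> {1..N}" "mdeg \<alpha> \<le> t k" for k \<alpha>
      unfolding wd[OF that] by (rule in_Lp_add[OF q uq[OF that] crq[OF that]])
    have vX: "?v \<in> sobolev_sys N t q"
      unfolding sobolev_sys_iff[OF q]
    proof (intro conjI ballI allI impI)
      show "weakly_diff (t k) (?v k)" if "k \<in> {1..N}" for k using r[OF that] by (blast intro: weakly_diffI)
      show "?v k = 0" if "k \<notin> {1..N}" for k using that uW by (simp add: weakly_diff_sys_def)
    qed (rule vq)
    have "Lp_norm q (fmult ?w (weak_diff \<alpha> (u k))) \<le> Lp_norm q (weak_diff \<alpha> (?v k)) + s * (K \<alpha> * ?n)"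
      if k: "k \<in> {1..N}" "mdeg \<alpha> \<le> t k" for k \<alpha>
    proof -
      have "fmult ?w (weak_diff \<alpha> (u k)) = weak_diff \<alpha> (?v k) + - fmult ?c (r k \<alpha>)"
        using wd[OF k] by simp
      also have "Lp_norm q \<dots> \<le> Lp_norm q (weak_diff \<alpha> (?v k)) + Lp_norm q (fmult ?c (r k \<alpha>))"
        using Lp_norm_add[OF q vq[OF k] in_Lp_uminus[OF _ crq[OF k]]] q Lp_norm_uminus[of q "fmult ?c (r k \<alpha>)"] by simp
      also have "Lp_norm q (fmult ?c (r k \<alpha>)) = s * Lp_norm q (r k \<alpha>)"
        using q s0 by (simp add: Lp_norm_scale)
      also have "\<dots> \<le> s * (K \<alpha> * ?n)" using rn[OF k] s0 by (intro mult_left_mono) auto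
      finally show ?thesis by simp
    qed
    then have "?n \<le> (\<Sum>k = 1..N. \<Sum>\<alpha> | mdeg \<alpha> \<le> t k. Lp_norm q (weak_diff \<alpha> (?v k)) + s * (K \<alpha> * ?n))"
      unfolding weighted_sys_norm_def weighted_norm_def by (intro sum_mono) auto
    also have "\<dots> = sum_norm N t q ?v + s * K1 * ?n"
      unfolding sum_norm_def K1_def by (simp add: sum.distrib sum_distrib_left sum_distrib_right mult_ac)
    also have "\<dots> \<le> sum_norm N t q ?v + s * (K1 + K2) * ?n"
      using s0 K12 n0 by (intro add_left_mono mult_right_mono mult_left_mono) auto
    finally have 1: "?n \<le> sum_norm N t q ?v + s * (K1 + K2) * ?n" .
    let ?R = "shifted (A_op N so t a) z ?v - wmult s (shifted (A_op N so t a) z u)"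
    let ?T = "\<lambda>j k \<alpha>. fmult (\<lambda>x. a j k \<alpha> x * (- \<i>) ^ mdeg \<alpha>) (fmult ?c (r k \<alpha>))"
    have Rj: "?R j = (\<Sum>k = 1..N. \<Sum>\<alpha> | mdeg \<alpha> \<le> t k. ?T j k \<alpha>)" if j: "j \<in> {1..N}" for j
    proof -
      have summand: "fmult (a j k \<alpha>) (D_op \<alpha> (?v k)) = fmult ?w (fmult (a j k \<alpha>) (D_op \<alpha> (u k))) + ?T j k \<alpha>"
        if "k \<in> {1..N}" "mdeg \<alpha> \<le> t k" for k \<alpha>
        unfolding D_op_def wd[OF that] by (simp add: fmult_add fmult_fmult mult_ac)
      have "A_op N so t a ?v j = (\<Sum>k = 1..N. \<Sum>\<alpha> | mdeg \<alpha> \<le> t k. fmult (a j k \<alpha>) (D_op \<alpha> (?v k)))"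
        using j so[OF j] by (simp only: A_op_def if_True add_0_left)
      also have "\<dots> = (\<Sum>k = 1..N. \<Sum>\<alpha> | mdeg \<alpha> \<le> t k. fmult ?w (fmult (a j k \<alpha>) (D_op \<alpha> (u k))) + ?T j k \<alpha>)"
        by (intro sum.cong refl summand) auto
      also have "\<dots> = fmult ?w (A_op N so t a u j) + (\<Sum>k = 1..N. \<Sum>\<alpha> | mdeg \<alpha> \<le> t k. ?T j k \<alpha>)"
        using j so[OF j] by (simp only: A_op_def if_True add_0_left sum.distrib fmult_sum)
      finally have "A_op N so t a ?v j = fmult ?w (A_op N so t a u j) + (\<Sum>k = 1..N. \<Sum>\<alpha> | mdeg \<alpha> \<le> t k. ?T j k \<alpha>)" .
      then show ?thesis by (simp add: shifted_def fmult_diff fmult_fmult mult_ac)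
    qed
    have Tq: "in_Lp q (?T j k \<alpha>) \<and> Lp_norm q (?T j k \<alpha>) \<le> s * (B j k \<alpha> * K \<alpha>) * ?n"
      if j: "j \<in> {1..N}" and k: "k \<in> {1..N}" "mdeg \<alpha> \<le> t k" for j k \<alpha>
    proof -
      have m: "(\<lambda>x. a j k \<alpha> x * (- \<i>) ^ mdeg \<alpha>) \<in> borel_measurable lebesgue"
        using am[OF j k] by (intro borel_measurable_times) auto
      have b: "norm (a j k \<alpha> x * (- \<i>) ^ mdeg \<alpha>) \<le> B j k \<alpha>" for x
        using B[OF j k, of x] by (simp add: norm_mult norm_power)
      have "Lp_norm q (?T j k \<alpha>) \<le> B j k \<alpha> * Lp_norm q (fmult ?c (r k \<alpha>))"
        using q by (intro fmult_bounded(2)[OF _ crq[OF k] m B0 b]) auto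
      also have "Lp_norm q (fmult ?c (r k \<alpha>)) = s * Lp_norm q (r k \<alpha>)"
        using q s0 by (simp add: Lp_norm_scale)
      also have "B j k \<alpha> * \<dots> \<le> B j k \<alpha> * (s * (K \<alpha> * ?n))"
        using rn[OF k] s0 B0 by (intro mult_left_mono) auto
      finally have "Lp_norm q (?T j k \<alpha>) \<le> s * (B j k \<alpha> * K \<alpha>) * ?n" by (simp only: mult_ac)
      moreover have "in_Lp q (?T j k \<alpha>)"
        using q by (intro fmult_bounded(1)[OF _ crq[OF k] m B0 b]) auto
      ultimately show ?thesis by blast
    qed
    have "Lp_norm q (?R j) \<le> (\<Sum>k = 1..N. \<Sum>\<alpha> | mdeg \<alpha> \<le> t k. s * (B j k \<alpha> * K \<alpha>) * ?n)"
      if j: "j \<in> {1..N}" for j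
    proof -
      have "Lp_norm q (?R j) \<le> (\<Sum>k = 1..N. Lp_norm q (\<Sum>\<alpha> | mdeg \<alpha> \<le> t k. ?T j k \<alpha>))"
        unfolding Rj[OF j] using Tq[OF j] by (intro Lp_norm_sum[OF q] in_Lp_sum[OF q]) auto
      also have "\<dots> \<le> (\<Sum>k = 1..N. \<Sum>\<alpha> | mdeg \<alpha> \<le> t k. Lp_norm q (?T j k \<alpha>))"
        using Tq[OF j] by (intro sum_mono Lp_norm_sum[OF q]) auto
      also have "\<dots> \<le> (\<Sum>k = 1..N. \<Sum>\<alpha> | mdeg \<alpha> \<le> t k. s * (B j k \<alpha> * K \<alpha>) * ?n)"
        using Tq[OF j] by (intro sum_mono) auto
      finally show ?thesis .
    qed
    then have "Lp_sys_norm N q ?R \<le> (\<Sum>j = 1..N. \<Sum>k = 1..N. \<Sum>\<alpha> | mdeg \<alpha> \<le> t k. s * (B j k \<alpha> * K \<alpha>) * ?n)"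
      unfolding Lp_sys_norm_def by (intro sum_mono)
    also have "\<dots> = s * K2 * ?n"
      unfolding K2_def by (simp only: sum_distrib_left sum_distrib_right)
    also have "\<dots> \<le> s * (K1 + K2) * ?n"
      using s0 K12 n0 by (intro mult_right_mono mult_left_mono) auto
    finally show ?thesis using vX 1 by blast
  qed
  then show ?thesis using K12 by (intro exI[of _ "K1 + K2"]) auto
qed

lemma sobolev_sys_subset_Lp_sys: "sobolev_sys N t p \<subseteq> Lp_sys N p"
  by (auto simp: sobolev_sys_def Lp_sys_def sobolev_def)

text \<open>Fix \<open>q < p\<close>. A finite-rank operator \<open>F\<close> built from cut-off functions makes \<open>T + F\<close> invertible on
  \<open>sobolev_sys N t q\<close>. Conjugation with a slowly varying weight \<open>w\<close> perturbs \<open>T\<close> so little that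
  \<open>T + w\<^sup>-\<^sup>1 F w\<close> remains injective on \<open>w\<^sup>-\<^sup>1 sobolev_sys N t q\<close>, a space which contains
  \<open>sobolev_sys N t q\<close> and \<open>sobolev_sys N t p\<close>. As the index is \<open>0\<close> for both exponents, the
  restrictions of this operator to these two spaces are bijective, and their inverses agree.\<close>

lemma fredholm_regularity:
  fixes a :: "'n::finite coeffs" and N :: nat and t so :: "nat \<Rightarrow> nat" and z :: complex
  defines "X \<equiv> \<lambda>p. sobolev_sys N t p :: 'n sys set" and "Y \<equiv> \<lambda>p. Lp_sys N p :: 'n sys set"
    and "T \<equiv> shifted (A_op N so t a) z"
  assumes q: "1 < q" and pq: "q < p" and N: "1 \<le> N" and so: "\<And>j. j \<in> {1..N} \<Longrightarrow> so j = 0"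
    and am: "\<And>j k \<alpha>. j \<in> {1..N} \<Longrightarrow> k \<in> {1..N} \<Longrightarrow> mdeg \<alpha> \<le> t k \<Longrightarrow> a j k \<alpha> \<in> borel_measurable lebesgue"
    and ab: "\<And>j k \<alpha>. j \<in> {1..N} \<Longrightarrow> k \<in> {1..N} \<Longrightarrow> mdeg \<alpha> \<le> t k \<Longrightarrow> \<exists>B\<ge>0. \<forall>x. norm (a j k \<alpha> x) \<le> B"
    and bd: "bounded_between (X q) (sobolev_sys_norm N t q) (Y q) (Lp_sys_norm N q) T"
    and frq: "fredholm_with_index (X q) (Y q) (Lp_sys_norm N q) T 0"
    and frp: "fredholm_with_index (X p) (Y p) (Lp_sys_norm N p) T 0"
  shows "u \<in> X p \<Longrightarrow> T u \<in> Y q \<Longrightarrow> u \<in> X q" and "u \<in> X q \<Longrightarrow> T u \<in> Y p \<Longrightarrow> u \<in> X p"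
proof -
  have q1: "1 \<le> q" and p1: "1 \<le> p" using q pq by auto
  let ?W = "weakly_diff_sys N t :: 'n sys set"
  have T: "linear_on sscale ?W T" unfolding T_def by (rule linear_on_shifted_A_op[OF so])
  have XW: "X p \<subseteq> ?W" "X q \<subseteq> ?W" unfolding X_def by (rule sobolev_sys_weakly_diff[OF p1] sobolev_sys_weakly_diff[OF q1])+
  have sX: "sys.subspace (X p)" "sys.subspace (X q)" unfolding X_def by (rule sobolev_sys_subspace[OF p1] sobolev_sys_subspace[OF q1])+
  have sY: "sys.subspace (Y p)" "sys.subspace (Y q)"
    unfolding Y_def by (rule norm_on_subspace[OF norm_on_Lp_sys[OF p1]] norm_on_subspace[OF norm_on_Lp_sys[OF q1]])+
  have sW: "sys.subspace ?W" by (rule weakly_diff_sys_subspace)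
  have Tq: "linear_on sscale (X q) T" and Tp: "linear_on sscale (X p) T"
    using linear_on_subset[OF T sX(2) XW(2)] linear_on_subset[OF T sX(1) XW(1)] .
  obtain C where TY: "T ` X q \<subseteq> Y q" and C: "\<And>u. u \<in> X q \<Longrightarrow> Lp_sys_norm N q (T u) \<le> C * sobolev_sys_norm N t q u"
    using bd unfolding bounded_between_def by blast
  have C': "Lp_sys_norm N q (T u) \<le> \<bar>C\<bar> * sum_norm N t q u" if "u \<in> X q" for u
  proof -
    have nn: "0 \<le> sobolev_sys_norm N t q u" unfolding sobolev_sys_norm_def sobolev_norm_def by (intro sum_nonneg) auto
    have "C * sobolev_sys_norm N t q u \<le> \<bar>C\<bar> * sobolev_sys_norm N t q u" using nn by (intro mult_right_mono) auto
    also have "\<dots> \<le> \<bar>C\<bar> * sum_norm N t q u" by (intro mult_left_mono sobolev_sys_norm_le_sum_norm[OF q1]) auto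
    finally show ?thesis using C[OF that] by linarith
  qed
  have Xq: "X q = sobolev_sys N t q" and Yq: "Y q = Lp_sys N q" by (simp_all add: X_def Y_def)
  have ex: "\<exists>m ks hs \<gamma> M. 0 < M \<and> (\<forall>i<m::nat. ks i \<in> {1..N} \<and> cutoff_fun (hs i) \<and> (\<forall>k. cutoff_fun (\<gamma> i k))) \<and>
    (\<forall>u\<in>X q. sum_norm N t q u \<le>
       M * Lp_sys_norm N q (T u + (\<Sum>i<m. sscale (pairing (u (ks i)) (hs i)) (cutoff_sys N (\<gamma> i)))))"
    by (rule injective_cutoff_perturbation[OF Xq Yq q1 N Tq TY C' frq])
  obtain m ks hs \<gamma> M where M: "0 < M"
    and khA: "\<forall>i<m::nat. ks i \<in> {1..N} \<and> cutoff_fun (hs i) \<and> (\<forall>k. cutoff_fun (\<gamma> i k))"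
    and lowerA: "\<forall>u\<in>X q. sum_norm N t q u \<le>
       M * Lp_sys_norm N q (T u + (\<Sum>i<m. sscale (pairing (u (ks i)) (hs i)) (cutoff_sys N (\<gamma> i))))"
    using ex by - (elim exE conjE, erule (2) that)
  have kh: "ks i \<in> {1..N} \<and> cutoff_fun (hs i) \<and> (\<forall>k. cutoff_fun (\<gamma> i k))" if "i < m" for i
    using khA that by blast
  note lower = bspec[OF lowerA]
  have "\<exists>K\<ge>0. \<forall>s\<in>{0<..1}. \<forall>u\<in>?W. (\<forall>k\<in>{1..N}. weighted_sobolev s q (t k) (u k)) \<longrightarrow>
    wmult s u \<in> X q \<and>
    weighted_sys_norm N t s q u \<le> sum_norm N t q (wmult s u) + s * K * weighted_sys_norm N t s q u \<and>
    Lp_sys_norm N q (T (wmult s u) - wmult s (T u)) \<le> s * K * weighted_sys_norm N t s q u"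
    unfolding X_def T_def by (rule weighted_commutator[where so = so and a = a and N = N and t = t, OF q1 so am ab])
  then obtain K where K: "0 \<le> K" and commA: "\<forall>s\<in>{0<..1}. \<forall>u\<in>?W. (\<forall>k\<in>{1..N}. weighted_sobolev s q (t k) (u k)) \<longrightarrow>
    wmult s u \<in> X q \<and>
    weighted_sys_norm N t s q u \<le> sum_norm N t q (wmult s u) + s * K * weighted_sys_norm N t s q u \<and>
    Lp_sys_norm N q (T (wmult s u) - wmult s (T u)) \<le> s * K * weighted_sys_norm N t s q u"
    by - (elim exE conjE, erule (1) that)
  note comm = commA[rule_format]
  \<comment> \<open>This choice gives \<open>s * K \<le> 1 / 2\<close> and \<open>s * K * M \<le> 1 / 4\<close>.\<close>
  define s where "s = 1 / (1 + 2 * K + 4 * (K * M))"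
  have KM: "0 \<le> K * M" using K M by simp
  have s: "s \<in> {0<..1}" using K KM unfolding s_def by (auto simp: divide_simps)
  have sK: "s * K \<le> 1 / 2" "s * (K * M) \<le> 1 / 4"
    using K KM unfolding s_def by (auto simp: divide_simps)
  let ?w = "base_weight s :: real ^ 'n \<Rightarrow> complex"
  define hs' where "hs' i = (\<lambda>x. ?w x * hs i x)" for i
  define \<gamma>' where "\<gamma>' i k = (\<lambda>x. inverse (?w x) * \<gamma> i k x)" for i k
  have winv: "continuous_on UNIV (\<lambda>x. inverse (?w x))"
    by (intro continuous_on_inverse continuous_weight) (simp add: base_weight_nonzero)
  have kh': "ks i \<in> {1..N} \<and> cutoff_fun (hs' i)" "cutoff_fun (\<gamma>' i k)" if "i < m" for i k
    using kh[OF that] unfolding hs'_def \<gamma>'_def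
    by (auto intro: cutoff_fun_mult_continuous[OF _ continuous_weight] cutoff_fun_mult_continuous[OF _ winv])
  define F where "F u = (\<Sum>i<m. sscale (pairing (u (ks i)) (hs' i)) (cutoff_sys N (\<gamma>' i)))" for u
  have linF: "linear_on sscale Z F" if "sys.subspace Z" "Z \<subseteq> ?W" for Z
    unfolding F_def by (rule linear_on_rank_op[OF that]) (rule kh'(1))
  have gY: "cutoff_sys N (\<gamma>' i) \<in> Y p" "cutoff_sys N (\<gamma>' i) \<in> Y q" if "i < m" for i
    using kh'(2)[OF that] p1 q1 unfolding Y_def by (auto intro!: cutoff_sys_Lp)
  have FY: "F u \<in> Y p" "F u \<in> Y q" for u
  proof -
    show "F u \<in> Y p" unfolding F_def using gY(1) by (intro sys.subspace_sum[OF sY(1)] sys.subspace_scale[OF sY(1)]) simp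
    show "F u \<in> Y q" unfolding F_def using gY(2) by (intro sys.subspace_sum[OF sY(2)] sys.subspace_scale[OF sY(2)]) simp
  qed
  have conj: "wmult s (F u) = (\<Sum>i<m. sscale (pairing (wmult s u (ks i)) (hs i)) (cutoff_sys N (\<gamma> i)))" for u
  proof -
    have "wmult s (cutoff_sys N (\<gamma>' i)) = cutoff_sys N (\<gamma> i)" for i
      by (rule ext) (auto simp: cutoff_sys_def \<gamma>'_def fmult.abs_eq base_weight_nonzero mult.assoc[symmetric])
    moreover have "pairing (wmult s u (ks i)) (hs i) = pairing (u (ks i)) (hs' i)" for i
      by (simp add: pairing_fmult hs'_def)
    ultimately show ?thesis unfolding F_def wmult_sum wmult_scale by (simp only:)
  qed
  \<comment> \<open>If \<open>(T + F) u = 0\<close>, then the operator with the lower bound maps \<open>v = w u\<close> to \<open>T v - w T u\<close>, which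
    is \<open>O(s)\<close> times the norm of \<open>v\<close>; for the chosen \<open>s\<close> this forces \<open>v = 0\<close>.\<close>
  have inj: "u = 0" if u: "u \<in> ?W" and uw: "\<And>k. k \<in> {1..N} \<Longrightarrow> weighted_sobolev s q (t k) (u k)"
    and z: "T u + F u = 0" for u
  proof -
    let ?v = "wmult s u" and ?n = "weighted_sys_norm N t s q u"
    have v: "?v \<in> X q" "?n \<le> sum_norm N t q ?v + s * K * ?n" "Lp_sys_norm N q (T ?v - wmult s (T u)) \<le> s * K * ?n"
      using comm[OF s u uw] by simp_all
    have n0: "0 \<le> ?n" by (rule weighted_sys_norm_nonneg)
    have "s * K * ?n \<le> 1 / 2 * ?n" using sK(1) n0 by (rule mult_right_mono)
    then have n: "?n \<le> 2 * sum_norm N t q ?v" using v(2) by linarith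
    have "wmult s (T u) + wmult s (F u) = 0" unfolding wmult_add[symmetric] z by (rule wmult_zero)
    then have "wmult s (F u) = - wmult s (T u)" by (simp only: add_eq_0_iff)
    then have TF: "T ?v + wmult s (F u) = T ?v - wmult s (T u)" by (simp only: add_uminus_conv_diff)
    have "sum_norm N t q ?v \<le> M * Lp_sys_norm N q (T ?v - wmult s (T u))"
      using lower[OF v(1)] unfolding conj[symmetric] TF .
    also have "\<dots> \<le> M * (s * K * (2 * sum_norm N t q ?v))"
    proof -
      have "s * K * ?n \<le> s * K * (2 * sum_norm N t q ?v)" using n s K by (intro mult_left_mono) auto
      then show ?thesis using v(3) M by (intro mult_left_mono) auto
    qed
    also have "\<dots> = (2 * (s * (K * M))) * sum_norm N t q ?v" by (simp only: mult_ac)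
    also have "\<dots> \<le> 1 / 2 * sum_norm N t q ?v"
      using sK(2) by (intro mult_right_mono sum_norm_nonneg) auto
    finally have "sum_norm N t q ?v = 0" using sum_norm_nonneg[of N t q ?v] by linarith
    then have "?v = 0" using norm_on_eq_0[OF norm_on_sobolev_sys[OF q1] v(1)[unfolded X_def]] by blast
    then show "u = 0" by (rule wmult_eq_0)
  qed
  have s0: "0 < s" using s by simp
  have wp: "weighted_sobolev s q (t k) (u k)" if "u \<in> X p" "k \<in> {1..N}" for u k
    using that unfolding X_def sobolev_sys_iff[OF p1] weighted_sobolev_def
    by (auto intro: in_Lp_base_weight[OF s0 q1 less_imp_le[OF pq]])
  have wq: "weighted_sobolev s q (t k) (u k)" if "u \<in> X q" "k \<in> {1..N}" for u k
    using that unfolding X_def sobolev_sys_iff[OF q1] weighted_sobolev_def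
    by (auto intro: in_Lp_base_weight[OF s0 q1 order_refl])
  have wdiff: "weighted_sobolev s q l (f - g)" if "weighted_sobolev s q l f" "weighted_sobolev s q l g" for l and f g :: "'n ae_fun"
    unfolding weighted_sobolev_def
  proof (intro conjI allI impI)
    have fg: "weakly_diff l f" "weakly_diff l g" using that by (simp_all add: weighted_sobolev_def)
    then show "weakly_diff l (f - g)" by (rule weakly_diff_diff(1))
    fix \<beta> :: "'n midx" assume \<beta>: "mdeg \<beta> \<le> l"
    show "in_Lp q (fmult (base_weight s) (weak_diff \<beta> (f - g)))"
      unfolding weakly_diff_diff(2)[OF fg \<beta>] fmult_diff
      using that \<beta> by (intro in_Lp_diff[OF q1]) (simp_all add: weighted_sobolev_def)
  qed
  have linS: "linear_on sscale ?W (\<lambda>u. T u + F u)"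
    by (rule sys.linear_on_add[OF T linF[OF sW subset_refl]])
  have eq: "u = v" if u: "u \<in> X p" and v: "v \<in> X q" and TFuv: "T u + F u = T v + F v" for u v
  proof -
    have W: "u \<in> ?W" "v \<in> ?W" using u v XW by auto
    have "u - v = 0"
    proof (rule inj)
      show "u - v \<in> ?W" by (rule sys.subspace_diff[OF sW W])
      show "weighted_sobolev s q (t k) ((u - v) k)" if "k \<in> {1..N}" for k
        unfolding sys_apply by (rule wdiff[OF wp[OF u that] wq[OF v that]])
      show "T (u - v) + F (u - v) = 0"
        using sys.linear_on_diff[OF linS W] unfolding TFuv by (simp only: diff_self)
    qed
    then show ?thesis by (simp only: right_minus_eq)
  qed
  have fin: "finite ((\<lambda>i. cutoff_sys N (\<gamma>' i)) ` {..<m})" by simp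
  have span: "F ` Z \<subseteq> sys.span ((\<lambda>i. cutoff_sys N (\<gamma>' i)) ` {..<m})" for Z
    unfolding F_def by (intro image_subsetI rank_op_in_span)
  have surj_q: "\<exists>u\<in>X q. T u + F u = y" if "y \<in> Y q" for y
  proof (rule fredholm_rank_perturbation_surj[OF frq Tq sY(2) linF[OF sX(2) XW(2)] fin _ span _ that])
    show "(\<lambda>i. cutoff_sys N (\<gamma>' i)) ` {..<m} \<subseteq> Y q" using gY by auto
    show "u = 0" if "u \<in> X q" "T u + F u = 0" for u
      using inj[OF subsetD[OF XW(2) that(1)] wq[OF that(1)] that(2)] .
  qed
  have surj_p: "\<exists>u\<in>X p. T u + F u = y" if "y \<in> Y p" for y
  proof (rule fredholm_rank_perturbation_surj[OF frp Tp sY(1) linF[OF sX(1) XW(1)] fin _ span _ that])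
    show "(\<lambda>i. cutoff_sys N (\<gamma>' i)) ` {..<m} \<subseteq> Y p" using gY by auto
    show "u = 0" if "u \<in> X p" "T u + F u = 0" for u
      using inj[OF subsetD[OF XW(1) that(1)] wp[OF that(1)] that(2)] .
  qed
  show "u \<in> X q" if u: "u \<in> X p" "T u \<in> Y q"
  proof -
    have "T u + F u \<in> Y q" by (rule sys.subspace_add[OF sY(2) u(2) FY(2)])
    then obtain v where v: "v \<in> X q" "T v + F v = T u + F u" using surj_q by blast
    then show ?thesis using eq[OF u(1) v(1) v(2)[symmetric]] by simp
  qed
  show "u \<in> X p" if u: "u \<in> X q" "T u \<in> Y p"
  proof -
    have "T u + F u \<in> Y p" by (rule sys.subspace_add[OF sY(1) u(2) FY(1)])
    then obtain v where v: "v \<in> X p" "T v + F v = T u + F u" using surj_p by blast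
    then show ?thesis using eq[OF v(1) u(1) v(2)] by simp
  qed
qed

lemma iterated_kernel_subset: "iterated_kernel D T m \<subseteq> insert 0 D"
  by (cases m) auto

lemma iterated_kernel_cong:
  assumes "\<And>u. u \<in> D \<Longrightarrow> T u \<in> insert 0 E \<Longrightarrow> u \<in> E" "\<And>u. u \<in> E \<Longrightarrow> T u \<in> insert 0 D \<Longrightarrow> u \<in> D"
  shows "iterated_kernel D T m = iterated_kernel E T m"
proof (induction m)
  case (Suc m)
  have "u \<in> D \<and> T u \<in> iterated_kernel D T m \<longleftrightarrow> u \<in> E \<and> T u \<in> iterated_kernel E T m" for u
    using assms[of u] Suc iterated_kernel_subset[of D T m] iterated_kernel_subset[of E T m] by blast
  then show ?case unfolding iterated_kernel.simps by blast
qed simp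

theorem theorem4p3:
  fixes N d :: nat
    and s t kk :: "nat \<Rightarrow> nat"
    and a :: "('n::finite) coeffs"
    and L :: "complex set"
    and lam_dag :: real
  assumes "1 < N"
    and "system_orders N s t"
    and "block_indices N s t d kk"
    and "closed_sector L"
    and "\<forall>j\<in>{1..N}. s j = 0 \<and> even (t j)"
    and "weakly_smooth N s t a"
    and "parameter_elliptic N s t d kk a L"
    and "admissible_threshold N s t a L lam_dag"
    and "\<forall>j\<in>{1..N}. \<forall>k\<in>{1..N}. \<forall>\<alpha>. mdeg \<alpha> \<le> t k \<longrightarrow> a j k \<alpha> \<in> C_bar CARD('n)"
    and "\<forall>j\<in>{1..N}. \<forall>k\<in>{1..N}. \<forall>\<alpha>. mdeg \<alpha> \<le> t k \<longrightarrow>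
           a j k \<alpha> \<in> C_bar (mdeg \<alpha> + CARD('n)) \<inter> C_bar0 (mdeg \<alpha> + 1)"
    and "\<forall>j\<in>{1..N}. \<forall>k\<in>{1..N}. \<forall>\<alpha>. mdeg \<alpha> \<le> t k \<longrightarrow>
           j > k \<and> t j < t k \<and> mdeg \<alpha> \<ge> t j \<longrightarrow> (\<forall>x. a j k \<alpha> x = 0)"
    and "\<forall>j\<in>{1..N}. \<forall>k\<in>{1..N}. \<forall>\<alpha>. mdeg \<alpha> \<le> t k \<longrightarrow>
           j < k \<and> t j > t k \<and> mdeg \<alpha> = t k \<longrightarrow> (\<forall>x. a j k \<alpha> x = 0)"
  shows "\<forall>p q. 1 < p \<and> 1 < q \<longrightarrow>
    {z \<in> L_dagger L lam_dag. eigenvalue_of (sobolev_sys N t p) (A_op N s t a) z} =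
      {z \<in> L_dagger L lam_dag. eigenvalue_of (sobolev_sys N t q) (A_op N s t a) z} \<and>
    (\<forall>z\<in>L_dagger L lam_dag. eigenvalue_of (sobolev_sys N t p) (A_op N s t a) z \<longrightarrow>
       geom_mult (sobolev_sys N t p) (A_op N s t a) z =
         geom_mult (sobolev_sys N t q) (A_op N s t a) z \<and>
       alg_mult (sobolev_sys N t p) (A_op N s t a) z =
         alg_mult (sobolev_sys N t q) (A_op N s t a) z)"
proof -
  let ?X = "sobolev_sys N t" and ?A = "A_op N s t a"
  have so: "s j = 0" if "j \<in> {1..N}" for j using assms(5) that by blast
  have coef: "continuous_on UNIV (a j k \<alpha>)" "bounded (range (a j k \<alpha>))"
    if "j \<in> {1..N}" "k \<in> {1..N}" "mdeg \<alpha> \<le> t k" for j k \<alpha>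
  proof -
    have c: "a j k \<alpha> \<in> C_bar CARD('n)" using assms(9) that by blast
    then show "continuous_on UNIV (a j k \<alpha>)" unfolding C_bar_def using C_class_continuous by blast
    have "\<forall>\<beta>. mdeg \<beta> \<le> CARD('n) \<longrightarrow> bounded (range (mdiff \<beta> (a j k \<alpha>)))"
      using c unfolding C_bar_def by blast
    from this[rule_format, of "\<lambda>_. 0"] show "bounded (range (a j k \<alpha>))" by (simp add: mdiff_zero)
  qed
  have am: "a j k \<alpha> \<in> borel_measurable lebesgue" if "j \<in> {1..N}" "k \<in> {1..N}" "mdeg \<alpha> \<le> t k" for j k \<alpha>
    by (rule continuous_measurable_lebesgue[OF coef(1)[OF that]])
  have ab: "\<exists>B\<ge>0. \<forall>x. norm (a j k \<alpha> x) \<le> B" if jk: "j \<in> {1..N}" "k \<in> {1..N}" "mdeg \<alpha> \<le> t k" for j k \<alpha>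
  proof -
    obtain B where "\<And>x. norm (a j k \<alpha> x) \<le> B" using coef(2)[OF jk] unfolding bounded_iff by blast
    then show ?thesis by (intro exI[of _ "\<bar>B\<bar>"]) (auto intro: order_trans[OF _ abs_ge_self])
  qed
  have fred: "bounded_between (?X p) (sobolev_sys_norm N t p) (Lp_sys N p) (Lp_sys_norm N p) (shifted ?A z)"
      "fredholm_with_index (?X p) (Lp_sys N p) (Lp_sys_norm N p) (shifted ?A z) 0"
    if "1 < p" "z \<in> L_dagger L lam_dag" for p z
    using assms(8) that unfolding admissible_threshold_def Let_def by blast+
  have step: "iterated_kernel (?X p) (shifted ?A z) m = iterated_kernel (?X q) (shifted ?A z) m"
    if z: "z \<in> L_dagger L lam_dag" and q: "1 < q" and pq: "q < p" for p q z m
  proof (rule iterated_kernel_cong)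
    have p: "1 < p" using q pq by simp
    have N: "1 \<le> N" using assms(1) by simp
    have Y: "insert 0 (?X r) \<subseteq> Lp_sys N r" for r
    proof -
      have "0 \<in> Lp_sys N r" by (simp add: Lp_sys_def)
      then show ?thesis using sobolev_sys_subset_Lp_sys[of N t r] by blast
    qed
    have reg1: "u \<in> ?X q" if "u \<in> ?X p" "shifted ?A z u \<in> Lp_sys N q" for u
      by (rule fredholm_regularity(1)[where so = s and a = a and N = N and t = t and z = z,
            OF q pq N so am ab fred[OF q z] fred(2)[OF p z] that])
    have reg2: "u \<in> ?X p" if "u \<in> ?X q" "shifted ?A z u \<in> Lp_sys N p" for u
      by (rule fredholm_regularity(2)[where so = s and a = a and N = N and t = t and z = z,
            OF q pq N so am ab fred[OF q z] fred(2)[OF p z] that])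
    show "u \<in> ?X q" if "u \<in> ?X p" "shifted ?A z u \<in> insert 0 (?X q)" for u
      using reg1[OF that(1)] that(2) Y by blast
    show "u \<in> ?X p" if "u \<in> ?X q" "shifted ?A z u \<in> insert 0 (?X p)" for u
      using reg2[OF that(1)] that(2) Y by blast
  qed
  have same: "iterated_kernel (?X p) (shifted ?A z) m = iterated_kernel (?X q) (shifted ?A z) m"
    if "z \<in> L_dagger L lam_dag" "1 < q" "1 < p" for p q z m
  proof -
    consider "p = q" | "q < p" | "p < q" by linarith
    then show ?thesis
    proof cases
      case 1
      then show ?thesis by (simp only:)
    next
      case 2
      show ?thesis by (rule step[OF that(1,2) 2])
    next
      case 3
      show ?thesis by (rule step[OF that(1,3) 3, symmetric])
    qed
  qed
  have kernel: "kernel_on D T = iterated_kernel D T 1" for D and T :: "'n sys \<Rightarrow> 'n sys"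
    unfolding kernel_on_def One_nat_def iterated_kernel.simps singleton_iff ..
  have eigen: "eigenvalue_of D ?A z \<longleftrightarrow> (\<exists>u\<in>kernel_on D (shifted ?A z). u \<noteq> 0)" for D z
    unfolding eigenvalue_of_def kernel_on_def shifted_def right_minus_eq by blast
  have key: "eigenvalue_of (?X p) ?A z = eigenvalue_of (?X q) ?A z \<and>
      geom_mult (?X p) ?A z = geom_mult (?X q) ?A z \<and> alg_mult (?X p) ?A z = alg_mult (?X q) ?A z"
    if "z \<in> L_dagger L lam_dag" "1 < q" "1 < p" for p q z
    unfolding eigen geom_mult_def alg_mult_def principal_subspace_def kernel same[OF that] by (intro conjI refl)
  show ?thesis
  proof (intro allI impI conjI ballI)
    fix p q :: real assume pq: "1 < p \<and> 1 < q"
    show "{z \<in> L_dagger L lam_dag. eigenvalue_of (?X p) ?A z} = {z \<in> L_dagger L lam_dag. eigenvalue_of (?X q) ?A z}"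
    proof (rule Collect_cong)
      fix z
      show "z \<in> L_dagger L lam_dag \<and> eigenvalue_of (?X p) ?A z \<longleftrightarrow> z \<in> L_dagger L lam_dag \<and> eigenvalue_of (?X q) ?A z"
        using key[of z q p] pq by (cases "z \<in> L_dagger L lam_dag") simp_all
    qed
    fix z assume "z \<in> L_dagger L lam_dag"
    from key[OF this, of q p] show "geom_mult (?X p) ?A z = geom_mult (?X q) ?A z"
      "alg_mult (?X p) ?A z = alg_mult (?X q) ?A z"
      using pq by simp_all
  qed
qed

end
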